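(* Let $n\ge 1$. The spectrum of the Dirichlet-to-Neumann operator $T^{[n]}$ on the closed unit ball $\mathbf{B}^{n+1}$ of $\mathbf{R}^{n+1}$ (acting on $n$-forms of $\mathbf{S}^n=\partial\mathbf{B}^{n+1}$) consists of the eigenvalue $$\nu''_{1,n}=n+1,$$ with multiplicity one (the associated eigenspace being spanned by the volume form of $\mathbf{S}^n$) and, for integers $k\ge 1$, the eigenvalues $$\nu'_{k,n}=(k+n-1)\,\frac{n+2k+1}{n+2k-1},$$ with multiplicity $M_{k,n-1}$ and associated eigenspace $J^{\star}(H'_{k-1,n})$. (If the number $n+1$ also occurs among the $\nu'_{k,n}$, its multiplicity as an eigenvalue is the sum of the multiplicities listed, and its full eigenspace is the direct sum of the corresponding spaces.)
   Context: Dirichlet-to-Neumann operator on forms. Let $\Omega$ be a compact connected $(n+1)$-dimensional Riemannian manifold with smooth boundary $\Sigma$, let $N$ be the inner unit normal to $\Sigma$, let $J^{\star}:\Lambda^p(\Omega)\to\Lambda^p(\Sigma)$ be the restriction (pull-back to the boundary) of smooth $p$-forms, $i_N$ the interior product with $N$, $\delta$ the codifferential and $\Delta=d\delta+\delta d$ the Hodge Laplacian. For $0\le p\le n$ and $\omega\in\Lambda^p(\Sigma)$ there is a unique $p$-form $\widehat\omega$ on $\Omega$ (the harmonic tangential extension of $\omega$) with $\Delta\widehat\omega=0$ on $\Omega$, $J^{\star}\widehat\omega=\omega$ and $i_N\widehat\omega=0$ on $\Sigma$. One sets $T^{[p]}\omega=-i_N d\widehat\omega$. $T^{[p]}:\Lambda^p(\Sigma)\to\Lambda^p(\Sigma)$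 is a self-adjoint, non-negative, elliptic pseudo-differential operator with discrete spectrum. Polynomial forms. Let $P_{k,p}$ be the vector space of $p$-forms $\omega=\sum_{i_1<\dots<i_p}\omega_{i_1\dots i_p}dx_{i_1}\wedge\dots\wedge dx_{i_p}$ on $\mathbf{R}^{n+1}$ whose components are homogeneous polynomials of degree $k\ge 0$. Let $Z=\sum_{j=1}^{n+1}x_j\frac{\partial}{\partial x_j}$ be the radial vector field, and set $$H_{k,p}=\{\omega\in P_{k,p}:\Delta\omega=0,\ \delta\omega=0\},\quad H'_{k,p}=\{\omega\in H_{k,p}: d\omega=0\},\quad H''_{k,p}=\{\omega\in H_{k,p}: i_Z\omega=0\},$$ and $M_{k,p}=\dim(H''_{k,p})$. (For $p=0$ the condition $i_Z\omega=0$ is vacuous.) On such polynomial forms $J^{\star}$ denotes the restriction (pull-back) to $\mathbf{S}^n$. *)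

theory Defs
  imports "HOL-Analysis.Analysis" "HOL-Library.Function_Algebras"
begin

text \<open>
  A covector of degree \<open>p\<close> on a subspace \<open>V\<close> is a function on argument lists; it is
  normalised to vanish on every list that is not a list of \<open>p\<close> vectors of \<open>V\<close>, so that equality
  of functions is equality of covectors.
\<close>

definition alternating_on :: "nat \<Rightarrow> 'a::real_vector set \<Rightarrow> ('a list \<Rightarrow> real) \<Rightarrow> bool" where
  "alternating_on p V \<alpha> \<longleftrightarrow>
     (\<forall>vs. \<not> (length vs = p \<and> set vs \<subseteq> V) \<longrightarrow> \<alpha> vs = 0) \<and>
     (\<forall>vs i u w a b. length vs = p \<longrightarrow> set vs \<subseteq> V \<longrightarrow> i < p \<longrightarrow> u \<in> V \<longrightarrow> w \<in> V \<longrightarrow>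
        \<alpha> (vs[i := a *\<^sub>R u + b *\<^sub>R w]) = a * \<alpha> (vs[i := u]) + b * \<alpha> (vs[i := w])) \<and>
     (\<forall>vs. length vs = p \<longrightarrow> set vs \<subseteq> V \<longrightarrow> \<not> distinct vs \<longrightarrow> \<alpha> vs = 0)"

type_synonym 'a form = "'a \<Rightarrow> 'a list \<Rightarrow> real"

definition form_scale :: "real \<Rightarrow> 'a form \<Rightarrow> 'a form" where
  "form_scale c \<omega> = (\<lambda>x vs. c * \<omega> x vs)"

interpretation forms: vector_space "form_scale :: real \<Rightarrow> 'a form \<Rightarrow> 'a form"
  by unfold_locales (auto simp: form_scale_def fun_eq_iff algebra_simps)

primrec Ck_on :: "nat \<Rightarrow> ('a::real_normed_vector \<Rightarrow> real) \<Rightarrow> 'a set \<Rightarrow> bool" where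
  "Ck_on 0 f U \<longleftrightarrow> continuous_on U f"
| "Ck_on (Suc k) f U \<longleftrightarrow> (\<forall>x\<in>U. f differentiable (at x)) \<and>
     (\<forall>v. Ck_on k (\<lambda>x. frechet_derivative f (at x) v) U)"

text \<open>
  Smooth \<open>p\<close>-forms on a subset \<open>M\<close> of Euclidean space with tangent spaces \<open>T x\<close>: locally they are
  restrictions of smooth forms of the ambient space. On a closed ball this is smoothness up to
  the boundary. Forms are extended by \<open>0\<close> outside \<open>M\<close>.
\<close>

definition smooth_forms ::
    "'a::real_normed_vector set \<Rightarrow> ('a \<Rightarrow> 'a set) \<Rightarrow> nat \<Rightarrow> 'a form set" where
  "smooth_forms M T p = {\<omega>.
     (\<forall>x\<in>M. alternating_on p (T x) (\<omega> x)) \<and> (\<forall>x. x \<notin> M \<longrightarrow> \<omega> x = 0) \<and>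
     (\<forall>x\<in>M. \<exists>U \<eta>. open U \<and> x \<in> U \<and> (\<forall>y\<in>U. alternating_on p UNIV (\<eta> y)) \<and>
        (\<forall>vs k. Ck_on k (\<lambda>y. \<eta> y vs) U) \<and>
        (\<forall>y\<in>M \<inter> U. \<forall>vs. set vs \<subseteq> T y \<longrightarrow> \<omega> y vs = \<eta> y vs))}"

text \<open>
  Exterior derivative and codifferential of the flat metric, the latter being
  \<open>- (\<Sum>j. i_{e_j} (\<nabla>_{e_j} \<omega>))\<close>. Derivatives are taken within \<open>S\<close>; they are
  uniquely determined for \<open>S = UNIV\<close> and, including at boundary points, for \<open>S = cball 0 1\<close>.
\<close>

definition form_d :: "'a::euclidean_space set \<Rightarrow> 'a form \<Rightarrow> 'a form" where
  "form_d S \<omega> = (\<lambda>x vs. if x \<in> S then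
     (\<Sum>i<length vs. (-1) ^ i *
        frechet_derivative (\<lambda>y. \<omega> y (take i vs @ drop (Suc i) vs)) (at x within S) (vs ! i))
     else 0)"

definition codiff :: "'a::euclidean_space set \<Rightarrow> 'a form \<Rightarrow> 'a form" where
  "codiff S \<omega> = (\<lambda>x vs. if x \<in> S then
     - (\<Sum>b\<in>Basis. frechet_derivative (\<lambda>y. \<omega> y (b # vs)) (at x within S) b) else 0)"

definition hodge_laplacian :: "'a::euclidean_space set \<Rightarrow> 'a form \<Rightarrow> 'a form" where
  "hodge_laplacian S \<omega> = form_d S (codiff S \<omega>) + codiff S (form_d S \<omega>)"

definition interior_product :: "('a \<Rightarrow> 'a) \<Rightarrow> 'a form \<Rightarrow> 'a form" where
  "interior_product X \<omega> = (\<lambda>x vs. \<omega> x (X x # vs))"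

definition sphere_tangent :: "'a::euclidean_space \<Rightarrow> 'a set" where
  "sphere_tangent x = {v. v \<bullet> x = 0}"

abbreviation sphere_forms :: "nat \<Rightarrow> 'a::euclidean_space form set" where
  "sphere_forms \<equiv> smooth_forms (sphere 0 1) sphere_tangent"

abbreviation ball_forms :: "nat \<Rightarrow> 'a::euclidean_space form set" where
  "ball_forms \<equiv> smooth_forms (cball 0 1) (\<lambda>_. UNIV)"

definition sphere_pullback :: "'a::euclidean_space form \<Rightarrow> 'a form" where
  "sphere_pullback \<omega> =
     (\<lambda>x vs. if x \<in> sphere 0 1 \<and> set vs \<subseteq> sphere_tangent x then \<omega> x vs else 0)"

definition inner_normal :: "'a::euclidean_space \<Rightarrow> 'a" where
  "inner_normal x = - x"

definition is_harmonic_extension ::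
    "nat \<Rightarrow> 'a::euclidean_space form \<Rightarrow> 'a form \<Rightarrow> bool" where
  "is_harmonic_extension p \<omega> \<phi> \<longleftrightarrow> \<phi> \<in> ball_forms p \<and> hodge_laplacian (cball 0 1) \<phi> = 0 \<and>
     sphere_pullback \<phi> = \<omega> \<and> (\<forall>x\<in>sphere 0 1. interior_product inner_normal \<phi> x = 0)"

definition harmonic_extension :: "nat \<Rightarrow> 'a::euclidean_space form \<Rightarrow> 'a form" where
  "harmonic_extension p \<omega> = (THE \<phi>. is_harmonic_extension p \<omega> \<phi>)"

text \<open>
  The domain records that the extension is well defined. By well-posedness of the boundary value
  problem it is all of \<open>sphere_forms p\<close> when \<open>p < DIM('a)\<close>.
\<close>

definition dn_domain :: "nat \<Rightarrow> 'a::euclidean_space form set" where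
  "dn_domain p = {\<omega> \<in> sphere_forms p. \<exists>!\<phi>. is_harmonic_extension p \<omega> \<phi>}"

definition dn_operator :: "nat \<Rightarrow> 'a::euclidean_space form \<Rightarrow> 'a form" where
  "dn_operator p \<omega> = sphere_pullback
     (- interior_product inner_normal (form_d (cball 0 1) (harmonic_extension p \<omega>)))"

definition dn_eigenspace :: "nat \<Rightarrow> real \<Rightarrow> 'a::euclidean_space form set" where
  "dn_eigenspace p \<mu> = {\<omega> \<in> dn_domain p. dn_operator p \<omega> = form_scale \<mu> \<omega>}"

text \<open>
  The operator is self-adjoint with discrete spectrum, so its spectrum is the set of its (real)
  eigenvalues. The type argument is the ambient Euclidean space.
\<close>

definition dn_spectrum :: "'a::euclidean_space itself \<Rightarrow> nat \<Rightarrow> real set" where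
  "dn_spectrum _ p = {\<mu>. \<exists>\<omega> \<in> (dn_eigenspace p \<mu> :: 'a form set). \<omega> \<noteq> 0}"

definition homogeneous_polynomial :: "nat \<Rightarrow> ('a::euclidean_space \<Rightarrow> real) \<Rightarrow> bool" where
  "homogeneous_polynomial k f \<longleftrightarrow> (\<exists>c. \<forall>x.
     f x = (\<Sum>e | e \<in> Basis \<rightarrow>\<^sub>E {..k} \<and> sum e Basis = k. c e * (\<Prod>b\<in>Basis. (x \<bullet> b) ^ e b)))"

definition poly_forms :: "nat \<Rightarrow> nat \<Rightarrow> 'a::euclidean_space form set" where
  "poly_forms k p = {\<omega>. (\<forall>x. alternating_on p UNIV (\<omega> x)) \<and>
     (\<forall>bs. length bs = p \<longrightarrow> set bs \<subseteq> Basis \<longrightarrow> homogeneous_polynomial k (\<lambda>x. \<omega> x bs))}"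

definition H_forms :: "nat \<Rightarrow> nat \<Rightarrow> 'a::euclidean_space form set" where
  "H_forms k p = {\<omega> \<in> poly_forms k p. hodge_laplacian UNIV \<omega> = 0 \<and> codiff UNIV \<omega> = 0}"

definition H1_forms :: "nat \<Rightarrow> nat \<Rightarrow> 'a::euclidean_space form set" where
  "H1_forms k p = {\<omega> \<in> H_forms k p. form_d UNIV \<omega> = 0}"

text \<open>The radial vector field \<open>Z\<close> is the identity.\<close>

definition H2_forms :: "nat \<Rightarrow> nat \<Rightarrow> 'a::euclidean_space form set" where
  "H2_forms k p = {\<omega> \<in> H_forms k p. interior_product (\<lambda>x. x) \<omega> = 0}"

definition M_dim :: "'a::euclidean_space itself \<Rightarrow> nat \<Rightarrow> nat \<Rightarrow> nat" where
  "M_dim _ k p = forms.dim (H2_forms k p :: 'a form set)"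

text \<open>
  \<open>dx_1 \<and> \<dots> \<and> dx_{n+1}\<close>, as a determinant. The enumeration of the basis amounts to a choice of
  orientation, so it affects the volume form only by a sign.
\<close>

definition basis_enum :: "'a::euclidean_space list" where
  "basis_enum = (SOME bs. distinct bs \<and> set bs = Basis)"

definition euclidean_volume :: "'a::euclidean_space form" where
  "euclidean_volume = (\<lambda>x vs. if length vs = DIM('a) then
     (\<Sum>\<pi> | \<pi> permutes {..<DIM('a)}. of_int (sign \<pi>) * (\<Prod>i<DIM('a). vs ! i \<bullet> basis_enum ! \<pi> i))
     else 0)"

definition sphere_volume :: "'a::euclidean_space form" where
  "sphere_volume =
     sphere_pullback (interior_product (\<lambda>x. - inner_normal x) euclidean_volume)"

definition nu1 :: "nat \<Rightarrow> nat \<Rightarrow> real" where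
  "nu1 k n = (real k + real n - 1) * ((real n + 2 * real k + 1) / (real n + 2 * real k - 1))"

end

theory Submission
  imports Defs
begin

text \<open>
  Writing an \<open>n\<close>-form as \<open>i\<^sub>W vol\<close> turns it into a vector field \<open>W\<close>: the Hodge Laplacian acts on the
  Cartesian components of \<open>W\<close>, and the exterior derivative is \<open>(div W) vol\<close>. The harmonic tangential
  extension of \<open>f vol\<^sub>S\<close> is therefore the harmonic field with \<open>W = f x\<close> on the sphere, and \<open>T\<close> maps
  \<open>f vol\<^sub>S\<close> to \<open>(div W) vol\<^sub>S\<close>. If \<open>q\<close> is the harmonic extension of \<open>f\<close> and \<open>R\<close> the radial derivative,
  then \<open>W = x q + (1 - \<bar>x\<bar>\<^sup>2) u\<close>, where \<open>u\<close> is the regular solution of \<open>(n + 1 + 2 R) u = \<nabla> q\<close>. For a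
  homogeneous harmonic polynomial \<open>q\<close> of degree \<open>k\<close> this is explicit and yields the eigenvalue \<open>nu1 k n\<close>,
  and \<open>n + 1\<close> for constants.

  Conversely, if \<open>div W = \<mu> q\<close>, put \<open>c = \<mu> - n - 1\<close> and \<open>h = x \<bullet> u\<close>. Then \<open>R q = c q + 2 h\<close> and
  \<open>2 R h = c q + (3 - n) h\<close>. Partial derivatives of a solution of such a system solve the system with
  the matrix lowered by the identity. After finitely many derivatives the matrix is negative definite,
  and then the solution vanishes, because its square sum does not increase along rays. Going back,
  \<open>q - q(0)\<close> is homogeneous of the one degree \<open>k\<close> with \<open>nu1 k n = \<mu>\<close>, or zero.

  For the multiplicities, Cartan's formula shows that \<open>i\<^sub>Z\<close> is a bijection from \<open>H1_forms (k - 1) n\<close> to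
  \<open>H2_forms k (n - 1)\<close>, and the elements of \<open>H1_forms (k - 1) n\<close> are the gradients of harmonic polynomials
  of degree \<open>k\<close>.
\<close>

subsection \<open>Alternating forms and the volume form\<close>

text \<open>Data on the sphere are merely smooth, so an eigenform comes with no expansion to be
  compared degree by degree; homogeneity has to be extracted from the eigenvalue equation. That
  equation even supplies \<open>q\<close>: \<open>div W\<close> is harmonic and equals
  \<open>\<mu> q\<close> on the sphere, so \<open>q = div W / \<mu>\<close> when
  \<open>\<mu>\<close> is nonzero. Uniqueness of harmonic functions turns the boundary condition on
  \<open>W\<close> into an explicit formula on the whole ball, where \<open>div W = \<mu> q\<close>
  closes into two equations for \<open>q\<close> and \<open>h\<close>. On functions of degree
  \<open>i\<close> the radial derivative is multiplication by \<open>i\<close>, so a nonzero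
  solution of degree \<open>i\<close> requires the matrix minus \<open>i\<close> to be singular. At
  degree 0 the determinant is \<open>c (1 - n) / 2\<close>, which vanishes for \<open>n = 1\<close>
  whatever \<open>\<mu>\<close> is; hence the constant \<open>q(0)\<close> is split off and the
  first derivatives of \<open>q\<close> and \<open>h\<close> are studied. For a degree
  \<open>k \<ge> 1\<close> of \<open>q\<close> the determinant vanishes exactly when
  \<open>nu1 k n = \<mu>\<close>, and \<open>nu1\<close> is injective in \<open>k\<close>, so at
  most one degree survives. The two families of eigenvalues meet only in
  \<open>nu1 1 1 = 2 = n + 1\<close>.\<close>

abbreviation omit :: "nat \<Rightarrow> 'b list \<Rightarrow> 'b list" where
  "omit i vs \<equiv> take i vs @ drop (Suc i) vs"

lemma omit_update: "i < length vs \<Longrightarrow> omit i (vs[i := u]) = omit i vs"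
  by simp

lemma omit_update_less: "i < j \<Longrightarrow> j < length vs \<Longrightarrow> omit i (vs[j := u]) = (omit i vs)[j - 1 := u]"
  by (auto simp: list_update_append drop_update_swap Suc_le_eq)

lemma omit_update_greater: "j < i \<Longrightarrow> i < length vs \<Longrightarrow> omit i (vs[j := u]) = (omit i vs)[j := u]"
  by (simp add: list_update_append take_update_swap)

lemma length_omit: "i < length vs \<Longrightarrow> length (omit i vs) = length vs - 1"
  by simp

text \<open>Prepares the sign count in \<open>alternating_antisymmetrise\<close>: when the entries
  \<open>i\<close> and \<open>j\<close> agree, the two shortened lists differ only by moving one
  vector across \<open>ys\<close>.\<close>

lemma omit_list_split:
  assumes "i < j" "j < length vs"
  obtains xs ys zs where "vs = xs @ vs!i # ys @ vs!j # zs" "length xs = i" "length ys = j - i - 1"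
    "omit i vs = xs @ ys @ vs!j # zs" "omit j vs = xs @ vs!i # ys @ zs"
proof -
  define xs ys zs where "xs = take i vs" and "ys = take (j - i - 1) (drop (Suc i) vs)"
    and "zs = drop (Suc j) vs"
  have 1: "vs = xs @ vs!i # drop (Suc i) vs"
    using assms by (simp add: xs_def id_take_nth_drop)
  have 2: "drop (Suc i) vs = ys @ vs!j # zs"
  proof -
    have "drop (Suc i) vs = take (j - i - 1) (drop (Suc i) vs)
        @ drop (Suc i) vs ! (j - i - 1) # drop (Suc (j - i - 1)) (drop (Suc i) vs)"
      using assms by (intro id_take_nth_drop) auto
    then show ?thesis
      using assms by (simp add: ys_def zs_def)
  qed
  have l: "length xs = i" "length ys = j - i - 1"
    using assms by (auto simp: xs_def ys_def)
  have v: "vs = xs @ vs!i # ys @ vs!j # zs"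
    using 1 2 by simp
  have "omit i vs = xs @ ys @ vs!j # zs"
    using 2 by (simp add: xs_def)
  moreover have "omit j vs = xs @ vs!i # ys @ zs"
  proof -
    have "take j vs = take j (xs @ vs!i # ys @ vs!j # zs)"
      using v by simp
    also have "\<dots> = xs @ vs!i # ys"
      using l assms by (simp add: take_Cons')
    finally show ?thesis by (simp add: zs_def)
  qed
  ultimately show ?thesis using that v l by blast
qed

abbreviation alternating :: "nat \<Rightarrow> ('a::real_vector list \<Rightarrow> real) \<Rightarrow> bool" where
  "alternating p \<equiv> alternating_on p UNIV"

lemma alternating_length: "alternating p \<alpha> \<Longrightarrow> length vs \<noteq> p \<Longrightarrow> \<alpha> vs = 0"
  by (auto simp: alternating_on_def)

lemma alternating_update:
  "alternating p \<alpha> \<Longrightarrow> length vs = p \<Longrightarrow> i < p \<Longrightarrow>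
     \<alpha> (vs[i := a *\<^sub>R u + b *\<^sub>R w]) = a * \<alpha> (vs[i := u]) + b * \<alpha> (vs[i := w])"
  by (simp add: alternating_on_def)

lemma alternating_not_distinct: "alternating p \<alpha> \<Longrightarrow> \<not> distinct vs \<Longrightarrow> \<alpha> vs = 0"
  by (metis alternating_on_def subset_UNIV)

lemma alternatingI:
  assumes "\<And>vs. length vs \<noteq> p \<Longrightarrow> \<alpha> vs = 0"
    and "\<And>vs i u w a b. length vs = p \<Longrightarrow> i < p \<Longrightarrow>
       \<alpha> (vs[i := a *\<^sub>R u + b *\<^sub>R w]) = a * \<alpha> (vs[i := u]) + b * \<alpha> (vs[i := w])"
    and "\<And>vs. length vs = p \<Longrightarrow> \<not> distinct vs \<Longrightarrow> \<alpha> vs = 0"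
  shows "alternating p \<alpha>"
  using assms unfolding alternating_on_def by blast

lemma alternating_linear:
  assumes "alternating p \<alpha>" "length vs = p" "i < p"
  shows "linear (\<lambda>u. \<alpha> (vs[i := u]))"
proof (rule linearI)
  show "\<alpha> (vs[i := x + y]) = \<alpha> (vs[i := x]) + \<alpha> (vs[i := y])" for x y
    using alternating_update[OF assms, of 1 x 1 y] by simp
  show "\<alpha> (vs[i := c *\<^sub>R x]) = c *\<^sub>R \<alpha> (vs[i := x])" for x c
    using alternating_update[OF assms, of c x 0 x] by simp
qed

lemma alternating_linear_append:
  assumes "alternating p \<alpha>"
  shows "linear (\<lambda>u. \<alpha> (xs @ u # ys))"
proof (cases "length xs + length ys + 1 = p")
  case True
  then show ?thesis
    using alternating_linear[OF assms, of "xs @ 0 # ys" "length xs"] by simp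
next
  case False
  then have "(\<lambda>u. \<alpha> (xs @ u # ys)) = (\<lambda>u. 0)"
    using alternating_length[OF assms] by auto
  then show ?thesis by (simp add: linear_zero)
qed

lemma alternating_linear_Cons: "alternating p \<alpha> \<Longrightarrow> linear (\<lambda>u. \<alpha> (u # vs))"
  using alternating_linear_append[of p \<alpha> "[]"] by simp

lemma alternating_zero: "alternating p (\<lambda>_. 0)"
  by (auto simp: alternating_on_def)

lemma alternating_add: "alternating p \<alpha> \<Longrightarrow> alternating p \<beta> \<Longrightarrow> alternating p (\<lambda>vs. \<alpha> vs + \<beta> vs)"
  by (rule alternatingI)
    (simp_all add: alternating_length alternating_update alternating_not_distinct algebra_simps)

lemma alternating_diff: "alternating p \<alpha> \<Longrightarrow> alternating p \<beta> \<Longrightarrow> alternating p (\<lambda>vs. \<alpha> vs - \<beta> vs)"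
  by (rule alternatingI)
    (simp_all add: alternating_length alternating_update alternating_not_distinct algebra_simps)

lemma alternating_scale: "alternating p \<alpha> \<Longrightarrow> alternating p (\<lambda>vs. c * \<alpha> vs)"
  by (rule alternatingI)
    (simp_all add: alternating_length alternating_update alternating_not_distinct algebra_simps)

lemma alternating_Cons:
  assumes "alternating (Suc p) \<alpha>"
  shows "alternating p (\<lambda>vs. \<alpha> (x # vs))"
proof (rule alternatingI)
  show "\<alpha> (x # vs) = 0" if "length vs \<noteq> p" for vs
    using that alternating_length[OF assms] by simp
  show "\<alpha> (x # vs[i := a *\<^sub>R u + b *\<^sub>R w]) = a * \<alpha> (x # vs[i := u]) + b * \<alpha> (x # vs[i := w])"
    if "length vs = p" "i < p" for vs i u w a b
    using alternating_update[OF assms, of "x # vs" "Suc i" a u b w] that by simp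
  show "\<alpha> (x # vs) = 0" if "length vs = p" "\<not> distinct vs" for vs
    using that alternating_not_distinct[OF assms] by simp
qed

text \<open>Polarisation: the value with \<open>a + b\<close> in both slots is zero, and expanding
  it leaves the two mixed terms.\<close>

lemma alternating_swap:
  assumes "alternating p \<alpha>"
  shows "\<alpha> (xs @ a # b # ys) = - \<alpha> (xs @ b # a # ys)"
proof -
  have l1: "linear (\<lambda>u. \<alpha> (xs @ u # c # ys))" for c
    by (rule alternating_linear_append[OF assms])
  have l2: "linear (\<lambda>u. \<alpha> (xs @ c # u # ys))" for c
    using alternating_linear_append[OF assms, of "xs @ [c]" ys] by simp
  have z: "\<alpha> (xs @ c # c # ys) = 0" for c
    using alternating_not_distinct[OF assms] by simp
  show ?thesis
    using z[of "a + b"] z[of a] z[of b] by (simp add: linear_add[OF l1] linear_add[OF l2])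
qed

lemma alternating_move:
  assumes "alternating p \<alpha>"
  shows "\<alpha> (xs @ ys @ a # zs) = (-1) ^ length ys * \<alpha> (xs @ a # ys @ zs)"
proof (induction ys arbitrary: xs)
  case (Cons y ys)
  have "\<alpha> (xs @ (y # ys) @ a # zs) = (-1) ^ length ys * \<alpha> (xs @ y # a # ys @ zs)"
    using Cons[of "xs @ [y]"] by simp
  then show ?case using alternating_swap[OF assms, of xs y a "ys @ zs"] by simp
qed simp

lemma alternating_omit:
  assumes "alternating p \<alpha>" "i < length vs"
  shows "\<alpha> ((vs ! i) # omit i vs) = (-1) ^ i * \<alpha> vs"
proof -
  have "\<alpha> vs = \<alpha> ([] @ take i vs @ (vs ! i) # drop (Suc i) vs)"
    using id_take_nth_drop[OF assms(2)] by simp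
  also have "\<dots> = (-1) ^ i * \<alpha> ((vs ! i) # omit i vs)"
    using assms(2) by (subst alternating_move[OF assms(1)]) simp
  finally show ?thesis by simp
qed

text \<open>Reordering changes the value only by a sign. Recording whether it vanishes avoids the
  signs of permutations; the prefix \<open>pre\<close> collects the entries that the induction has
  already matched.\<close>

lemma alternating_mset_zero_iff:
  assumes "alternating p \<alpha>" "mset xs = mset ys"
  shows "\<alpha> (pre @ xs) = 0 \<longleftrightarrow> \<alpha> (pre @ ys) = 0"
  using assms(2)
proof (induction xs arbitrary: ys pre)
  case (Cons x xs)
  then have "x \<in> set ys" by (metis list.set_intros(1) mset_eq_setD)
  then obtain y1 y2 where y: "ys = y1 @ x # y2" by (meson split_list)
  with Cons.prems have "mset xs = mset (y1 @ y2)" by simp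
  from Cons.IH[OF this, of "pre @ [x]"] show ?case
    using alternating_move[OF assms(1), of pre y1 x y2] y by simp
qed simp

lemma linear_sum_Basis:
  fixes f :: "'a::euclidean_space \<Rightarrow> real"
  assumes "linear f" shows "f x = (\<Sum>b\<in>Basis. (x \<bullet> b) * f b)"
proof -
  have "f x = f (\<Sum>b\<in>Basis. (x \<bullet> b) *\<^sub>R b)" by (simp add: euclidean_representation)
  also have "\<dots> = (\<Sum>b\<in>Basis. (x \<bullet> b) * f b)"
    by (simp add: linear_sum[OF assms] linear_cmul[OF assms])
  finally show ?thesis .
qed

lemma alternating_eq_zero_Basis:
  fixes \<alpha> :: "'a::euclidean_space list \<Rightarrow> real"
  assumes \<alpha>: "alternating p \<alpha>"
    and z: "\<And>bs. length bs = p \<Longrightarrow> distinct bs \<Longrightarrow> set bs \<subseteq> Basis \<Longrightarrow> \<alpha> bs = 0"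
  shows "\<alpha> vs = 0"
proof -
  have "\<alpha> (us @ ws) = 0" if "set ws \<subseteq> Basis" "length us + length ws = p" for us ws
    using that
  \<comment> \<open>The last arbitrary vector is expanded in the basis and joins the basis vectors
    in \<open>ws\<close>.\<close>
  proof (induction us arbitrary: ws rule: rev_induct)
    case Nil
    then show ?case using z[of ws] alternating_not_distinct[OF \<alpha>, of ws] by (cases "distinct ws") auto
  next
    case (snoc u us)
    have "linear (\<lambda>u. \<alpha> (us @ u # ws))"
      by (rule alternating_linear_append[OF \<alpha>])
    from linear_sum_Basis[OF this, of u] show ?case
      using snoc by simp
  qed
  from this[of "[]" vs] show ?thesis
    using alternating_length[OF \<alpha>, of vs] by (cases "length vs = p") auto
qed

section \<open>The determinant, the trace identity and covectors of codimension one\<close>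

lemma basis_enum: "distinct (basis_enum :: 'a::euclidean_space list)" "set (basis_enum :: 'a list) = Basis"
proof -
  have "\<exists>bs :: 'a list. distinct bs \<and> set bs = Basis"
    using finite_distinct_list[of "Basis :: 'a set"] by auto
  from someI_ex[OF this] show "distinct (basis_enum :: 'a list)" "set (basis_enum :: 'a list) = Basis"
    by (simp_all add: basis_enum_def)
qed

lemma length_basis_enum [simp]: "length (basis_enum :: 'a::euclidean_space list) = DIM('a)"
  using distinct_card[OF basis_enum(1)[where 'a='a]] basis_enum(2)[where 'a='a] by simp

lemma basis_enum_inner:
  assumes "i < DIM('a)" "j < DIM('a)"
  shows "(basis_enum ! i) \<bullet> (basis_enum ! j :: 'a::euclidean_space) = (if i = j then 1 else 0)"
proof -
  have "basis_enum ! i \<in> (Basis :: 'a set)" "basis_enum ! j \<in> (Basis :: 'a set)"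
    using assms basis_enum(2)[where 'a='a] by (metis length_basis_enum nth_mem)+
  moreover have "(basis_enum ! i = (basis_enum ! j :: 'a)) \<longleftrightarrow> i = j"
    using basis_enum(1)[where 'a='a] assms by (simp add: nth_eq_iff_index_eq)
  ultimately show ?thesis by (simp add: inner_Basis)
qed

lemma sum_basis_enum: "(\<Sum>i<DIM('a). f (basis_enum ! i)) = (\<Sum>b\<in>(Basis :: 'a::euclidean_space set). f b)"
proof -
  have "bij_betw ((!) basis_enum) {..<DIM('a)} (Basis :: 'a set)"
    using bij_betw_nth[OF basis_enum(1)[where 'a='a]] basis_enum(2)[where 'a='a]
    by (metis length_basis_enum)
  then show ?thesis by (rule sum.reindex_bij_betw)
qed

text \<open>The volume form has constant coefficients, so the base point \<open>0\<close> is an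
  arbitrary choice.\<close>

definition vol :: "'a::euclidean_space list \<Rightarrow> real" where
  "vol = euclidean_volume 0"

lemma euclidean_volume_eq_vol: "euclidean_volume x = vol"
  by (simp add: vol_def euclidean_volume_def)

lemma vol_eq:
  "length vs = DIM('a) \<Longrightarrow> vol (vs :: 'a::euclidean_space list) =
    (\<Sum>\<pi> | \<pi> permutes {..<DIM('a)}. of_int (sign \<pi>) * (\<Prod>i<DIM('a). vs ! i \<bullet> basis_enum ! \<pi> i))"
  by (simp add: vol_def euclidean_volume_def)

lemma alternating_vol: "alternating DIM('a) (vol :: 'a::euclidean_space list \<Rightarrow> real)"
proof (rule alternatingI)
  let ?N = "DIM('a)"
  show "vol vs = 0" if "length vs \<noteq> ?N" for vs :: "'a list"
    using that by (simp add: vol_def euclidean_volume_def)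
  show "vol (vs[i := a *\<^sub>R u + b *\<^sub>R w]) = a * vol (vs[i := u]) + b * vol (vs[i := w])"
    if "length vs = ?N" "i < ?N" for vs :: "'a list" and i a u b w
  proof -
    have *: "(\<Prod>j<?N. vs[i := t] ! j \<bullet> basis_enum ! \<pi> j)
        = (t \<bullet> basis_enum ! \<pi> i) * (\<Prod>j\<in>{..<?N} - {i}. vs ! j \<bullet> basis_enum ! \<pi> j)" for t \<pi>
      using that by (subst prod.remove[of _ i]) (auto intro!: prod.cong)
    have *: "vol (vs[i := t]) = (\<Sum>\<pi> | \<pi> permutes {..<?N}. of_int (sign \<pi>) *
        ((t \<bullet> basis_enum ! \<pi> i) * (\<Prod>j\<in>{..<?N} - {i}. vs ! j \<bullet> basis_enum ! \<pi> j)))" for t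
      using that by (subst vol_eq) (simp_all only: * length_list_update)
    show ?thesis
      unfolding * by (simp add: sum_distrib_left sum.distrib[symmetric] inner_left_distrib algebra_simps)
  qed
  show "vol vs = 0" if l: "length vs = ?N" and "\<not> distinct vs" for vs :: "'a list"
  proof -
    from that obtain i j where ij: "i < ?N" "j < ?N" "i \<noteq> j" "vs ! i = vs ! j"
      by (auto simp: distinct_conv_nth)
    \<comment> \<open>Composing all permutations with this transposition flips every sign but, as
      the two entries agree, preserves every product; so the sum equals its own negative.\<close>
    let ?t = "Transposition.transpose i j"
    have t: "?t permutes {..<?N}"
      by (rule permutes_swap_id) (use ij in auto)
    let ?f = "\<lambda>\<pi>. of_int (sign \<pi>) * (\<Prod>k<?N. vs ! k \<bullet> basis_enum ! \<pi> k) :: real"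
    have "vol vs = sum ?f {\<pi>. \<pi> permutes {..<?N}}"
      using l by (rule vol_eq)
    also have "\<dots> = (\<Sum>\<pi> | \<pi> permutes {..<?N}. ?f (\<pi> \<circ> ?t))"
      by (rule sum_permutations_compose_right[OF t])
    also have "\<dots> = (\<Sum>\<pi> | \<pi> permutes {..<?N}. - ?f \<pi>)"
    proof (rule sum.cong, rule refl, clarify)
      fix \<pi> assume p: "\<pi> permutes {..<?N}"
      have "permutation \<pi>" "permutation ?t"
        using p t permutation_permutes by blast+
      then have s: "sign (\<pi> \<circ> ?t) = - sign \<pi>"
        using ij by (simp add: sign_compose sign_swap_id)
      have "(\<Prod>k<?N. vs ! k \<bullet> basis_enum ! (\<pi> \<circ> ?t) k) = (\<Prod>k<?N. vs ! (?t k) \<bullet> basis_enum ! \<pi> (?t k))"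
        using ij by (intro prod.cong) (auto simp: Transposition.transpose_def)
      also have "\<dots> = (\<Prod>k<?N. vs ! k \<bullet> basis_enum ! \<pi> k)"
        using prod.permute[OF t, of "\<lambda>k. vs ! k \<bullet> basis_enum ! \<pi> k"] by (simp add: o_def)
      finally show "?f (\<pi> \<circ> ?t) = - ?f \<pi>"
        using s by simp
    qed
    also have "\<dots> = - vol vs"
      using l by (simp add: sum_negf vol_eq)
    finally show ?thesis by simp
  qed
qed

lemma vol_basis_enum: "vol (basis_enum :: 'a::euclidean_space list) = 1"
proof -
  let ?N = "DIM('a)"
  let ?f = "\<lambda>\<pi>. of_int (sign \<pi>) * (\<Prod>k<?N. basis_enum ! k \<bullet> (basis_enum ! \<pi> k :: 'a)) :: real"
  have "?f \<pi> = 0" if p: "\<pi> permutes {..<?N}" "\<pi> \<noteq> id" for \<pi>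
  proof -
    from p obtain k where "k < ?N" "\<pi> k \<noteq> k"
      by (metis eq_id_iff lessThan_iff permutes_not_in)
    moreover from this p have "\<pi> k < ?N" by (metis lessThan_iff permutes_in_image)
    ultimately have "basis_enum ! k \<bullet> (basis_enum ! \<pi> k :: 'a) = 0"
      by (subst basis_enum_inner) auto
    with \<open>k < ?N\<close> have "(\<Prod>k<?N. basis_enum ! k \<bullet> (basis_enum ! \<pi> k :: 'a)) = 0"
      by (meson finite_lessThan lessThan_iff prod_zero)
    then show ?thesis by simp
  qed
  then have "vol (basis_enum :: 'a list) = (\<Sum>\<pi>\<in>{id}. ?f \<pi>)"
    by (subst vol_eq, simp, intro sum.mono_neutral_right)
      (auto simp: finite_permutations permutes_id)
  also have "\<dots> = 1" by (simp add: basis_enum_inner)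
  finally show ?thesis .
qed

text \<open>The difference of the two sides vanishes on \<open>basis_enum\<close>, hence on each of
  its rearrangements, and these are all the lists of distinct basis vectors of full length.\<close>

lemma alternating_eq_vol:
  fixes \<beta> :: "'a::euclidean_space list \<Rightarrow> real"
  assumes "alternating DIM('a) \<beta>"
  shows "\<beta> vs = \<beta> basis_enum * vol vs"
proof -
  let ?\<gamma> = "\<lambda>vs. \<beta> vs - \<beta> basis_enum * vol vs"
  have alt: "alternating DIM('a) ?\<gamma>"
    by (intro alternating_diff alternating_scale assms alternating_vol)
  have "?\<gamma> vs = 0"
  proof (rule alternating_eq_zero_Basis[OF alt])
    fix bs :: "'a list" assume bs: "length bs = DIM('a)" "distinct bs" "set bs \<subseteq> Basis"
    then have "set bs = Basis"
      by (metis card_subset_eq distinct_card finite_Basis)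
    then have "mset bs = mset basis_enum"
      using bs basis_enum by (metis set_eq_iff_mset_eq_distinct)
    from alternating_mset_zero_iff[OF alt this, of "[]"] show "?\<gamma> bs = 0"
      by (simp add: vol_basis_enum)
  qed
  then show ?thesis by simp
qed

text \<open>The common pattern of \<open>form_d\<close>, where \<open>\<alpha> v\<close> is the
  derivative in direction \<open>v\<close>, and of \<open>trace_identity\<close>. If the entries
  \<open>i < j\<close> agree, the terms omitting any other entry still see the repetition; the two
  remaining terms cancel, because moving a vector across \<open>j - i - 1\<close> places costs
  exactly the missing sign.\<close>

lemma alternating_antisymmetrise:
  assumes lin: "\<And>vs. linear (\<lambda>v. \<alpha> v vs)" and alt: "\<And>v. alternating p (\<alpha> v)"
  shows "alternating (Suc p) (\<lambda>vs. \<Sum>i<length vs. (-1) ^ i * \<alpha> (vs ! i) (omit i vs))" (is "alternating _ ?\<beta>")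
proof (rule alternatingI)
  show "?\<beta> vs = 0" if "length vs \<noteq> Suc p" for vs
    using that alternating_length[OF alt] by (auto intro!: sum.neutral)
  show "?\<beta> (vs[j := a *\<^sub>R u + b *\<^sub>R w]) = a * ?\<beta> (vs[j := u]) + b * ?\<beta> (vs[j := w])"
    if l: "length vs = Suc p" and j: "j < Suc p" for vs j a u b w
  proof -
    have "\<alpha> (vs[j := a *\<^sub>R u + b *\<^sub>R w] ! i) (omit i (vs[j := a *\<^sub>R u + b *\<^sub>R w]))
        = a * \<alpha> (vs[j := u] ! i) (omit i (vs[j := u])) + b * \<alpha> (vs[j := w] ! i) (omit i (vs[j := w]))"
      if i: "i < Suc p" for i
    proof -
      consider "i = j" | "i < j" | "j < i" by linarith
      then show ?thesis
      proof cases
        case 1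
        then show ?thesis
          using l i by (simp only: omit_update nth_list_update_eq)
            (simp add: linear_add[OF lin] linear_cmul[OF lin])
      next
        case 2
        then show ?thesis
          using l i j alternating_update[OF alt, of "omit i vs" "j - 1" "vs ! i" a u b w]
          by (simp only: omit_update_less nth_list_update_neq) simp
      next
        case 3
        then show ?thesis
          using l i j alternating_update[OF alt, of "omit i vs" j "vs ! i" a u b w]
          by (simp only: omit_update_greater nth_list_update_neq) simp
      qed
    qed
    then show ?thesis
      using l by (simp add: sum_distrib_left sum.distrib[symmetric] algebra_simps)
  qed
  show "?\<beta> vs = 0" if l: "length vs = Suc p" and nd: "\<not> distinct vs" for vs
  proof -
    from nd obtain i j where ij: "i < j" "j < Suc p" "vs ! i = vs ! j"
      using l by (metis distinct_conv_nth nat_neq_iff)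
    let ?f = "\<lambda>k. (-1) ^ k * \<alpha> (vs ! k) (omit k vs)"
    have "?f k = 0" if "k < Suc p" "k \<noteq> i" "k \<noteq> j" for k
    proof -
      have nth: "omit k vs ! m = vs ! (if m < k then m else Suc m)" if "m < p" for m
        using that l \<open>k < Suc p\<close> by (auto simp: nth_append)
      \<comment> \<open>The position, after deletion of entry \<open>k\<close>, of the entry with
        old index \<open>m\<close>.\<close>
      let ?r = "\<lambda>m. if m < k then m else m - 1"
      have "?r i < p" "?r j < p" "?r i \<noteq> ?r j"
        using ij that by auto
      moreover have "omit k vs ! ?r i = vs ! i" "omit k vs ! ?r j = vs ! j"
        using nth[OF \<open>?r i < p\<close>] nth[OF \<open>?r j < p\<close>] that by auto
      ultimately have "\<exists>r s. r < p \<and> s < p \<and> r \<noteq> s \<and> omit k vs ! r = vs ! i \<and> omit k vs ! s = vs ! j"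
        by blast
      moreover have "length (omit k vs) = p"
        using length_omit[of k vs] l \<open>k < Suc p\<close> by simp
      ultimately obtain r s where "r < length (omit k vs)" "s < length (omit k vs)" "r \<noteq> s"
        "omit k vs ! r = omit k vs ! s"
        using ij(3) by metis
      then have "\<not> distinct (omit k vs)"
        unfolding distinct_conv_nth by blast
      then show ?thesis using alternating_not_distinct[OF alt] by simp
    qed
    then have "(\<Sum>k<Suc p. ?f k) = (\<Sum>k\<in>{i, j}. ?f k)"
      using ij by (intro sum.mono_neutral_right) auto
    also have "\<dots> = ?f i + ?f j" using ij by simp
    also have "\<dots> = 0"
    proof -
      have "j < length vs" using ij l by simp
      then obtain xs ys zs where s0: "vs = xs @ vs!i # ys @ vs!j # zs"
        and s: "length xs = i" "length ys = j - i - 1"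
          "omit i vs = xs @ ys @ vs!j # zs" "omit j vs = xs @ vs!i # ys @ zs"
        by (rule omit_list_split[OF ij(1)])
      have "\<alpha> (vs ! i) (omit i vs) = (-1) ^ (j - i - 1) * \<alpha> (vs ! j) (omit j vs)"
        unfolding s(3,4) alternating_move[OF alt] using ij s by simp
      moreover have "(-1) ^ i * (-1) ^ (j - i - 1) = - ((-1::real) ^ j)"
      proof -
        have "j = Suc (i + (j - i - 1))" using ij by simp
        then have "(-1::real) ^ j = - ((-1) ^ (i + (j - i - 1)))" by (metis power_Suc mult_minus1)
        then show ?thesis by (simp add: power_add)
      qed
      ultimately show ?thesis by (simp add: mult.assoc[symmetric])
    qed
    finally show ?thesis using l by simp
  qed
qed

text \<open>Of the basis components of \<open>w\<close> only the one along the omitted vector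
  counts; every other basis vector would repeat an entry of the list.\<close>

lemma vol_Cons_omit_basis_enum:
  assumes "i < DIM('a)"
  shows "vol (w # omit i basis_enum) = (-1) ^ i * (w \<bullet> (basis_enum ! i :: 'a::euclidean_space))"
proof -
  have lin: "linear (\<lambda>u. vol (u # omit i (basis_enum :: 'a list)))"
    by (rule alternating_linear_Cons[OF alternating_vol])
  have "vol (w # omit i basis_enum) = (\<Sum>b\<in>Basis. (w \<bullet> b) * vol (b # omit i (basis_enum :: 'a list)))"
    by (rule linear_sum_Basis[OF lin])
  also have "\<dots> = (\<Sum>b\<in>{basis_enum ! i}. (w \<bullet> b) * vol (b # omit i (basis_enum :: 'a list)))"
  proof (intro sum.mono_neutral_right ballI)
    show "{basis_enum ! i} \<subseteq> (Basis :: 'a set)"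
      using assms basis_enum(2)[where 'a='a] by (metis empty_subsetI insert_subset length_basis_enum nth_mem)
    fix b assume b: "b \<in> Basis - {basis_enum ! i :: 'a}"
    then obtain j where j: "j < DIM('a)" "b = basis_enum ! j"
      using basis_enum(2)[where 'a='a] by (metis DiffD1 in_set_conv_nth length_basis_enum)
    with b have "j \<noteq> i" by auto
    have "b \<in> set (omit i (basis_enum :: 'a list))"
    proof (cases "j < i")
      case True
      then show ?thesis using j assms by (auto simp: in_set_conv_nth)
    next
      case False
      with \<open>j \<noteq> i\<close> have "drop (Suc i) (basis_enum :: 'a list) ! (j - Suc i) = b"
        "j - Suc i < length (drop (Suc i) (basis_enum :: 'a list))"
        using j by auto
      then have "b \<in> set (drop (Suc i) (basis_enum :: 'a list))" by (metis nth_mem)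
      then show ?thesis by simp
    qed
    then have "vol (b # omit i (basis_enum :: 'a list)) = 0"
      by (intro alternating_not_distinct[OF alternating_vol]) simp
    then show "(w \<bullet> b) * vol (b # omit i (basis_enum :: 'a list)) = 0" by simp
  qed auto
  also have "\<dots> = (w \<bullet> (basis_enum ! i)) * ((-1) ^ i * vol (basis_enum :: 'a list))"
    using assms by (subst sum.insert) (simp_all add: alternating_omit[OF alternating_vol])
  finally show ?thesis by (simp add: vol_basis_enum)
qed

text \<open>The derivative of the determinant at the identity. The left side is alternating of top
  degree, hence a multiple of \<open>vol\<close>; evaluated at \<open>basis_enum\<close>, its
  \<open>i\<close>-th term is the \<open>i\<close>-th diagonal entry of \<open>A\<close>. With
  \<open>A\<close> the Jacobian of \<open>W\<close> it becomes
  \<open>d (i_W vol) = (div W) vol\<close>.\<close>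

lemma trace_identity:
  fixes A :: "'a::euclidean_space \<Rightarrow> 'a"
  assumes A: "linear A"
  shows "(\<Sum>i<length vs. (-1) ^ i * vol (A (vs ! i) # omit i vs)) = (\<Sum>b\<in>Basis. A b \<bullet> b) * vol vs"
proof -
  obtain m where m: "DIM('a) = Suc m" using DIM_positive[where 'a='a] by (metis Suc_pred)
  have lin: "linear (\<lambda>v. vol (A v # us))" for us
    using linear_compose[OF A alternating_linear_Cons[OF alternating_vol]] by (simp add: o_def)
  have "alternating (Suc m) (\<lambda>vs. \<Sum>i<length vs. (-1) ^ i * vol (A (vs ! i) # omit i vs))"
    using alternating_vol[where 'a='a] m
    by (intro alternating_antisymmetrise[where \<alpha> = "\<lambda>v us. vol (A v # us)"] lin alternating_Cons) simp
  from alternating_eq_vol[OF this[folded m], of vs]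
  have "(\<Sum>i<length vs. (-1) ^ i * vol (A (vs ! i) # omit i vs))
    = (\<Sum>i<DIM('a). (-1) ^ i * vol (A (basis_enum ! i) # omit i basis_enum)) * vol vs"
    by simp
  also have "(\<Sum>i<DIM('a). (-1) ^ i * vol (A (basis_enum ! i) # omit i basis_enum))
    = (\<Sum>i<DIM('a). A (basis_enum ! i) \<bullet> (basis_enum ! i))"
    by (intro sum.cong refl) (simp add: vol_Cons_omit_basis_enum del: append_assoc)
  also have "\<dots> = (\<Sum>b\<in>Basis. A b \<bullet> b)"
    by (rule sum_basis_enum[where f = "\<lambda>b. A b \<bullet> b"])
  finally show ?thesis .
qed

text \<open>The vector field \<open>W\<close> with \<open>\<alpha> = i\<^sub>W vol\<close>, for a covector \<open>\<alpha>\<close> of codimension one.\<close>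

definition dual_vector :: "('a::euclidean_space list \<Rightarrow> real) \<Rightarrow> 'a" where
  "dual_vector \<alpha> = (\<Sum>j<DIM('a). ((-1) ^ j * \<alpha> (omit j basis_enum)) *\<^sub>R (basis_enum ! j))"

lemma dual_vector_inner:
  assumes "i < DIM('a)"
  shows "dual_vector \<alpha> \<bullet> (basis_enum ! i :: 'a::euclidean_space) = (-1) ^ i * \<alpha> (omit i basis_enum)"
proof -
  have "dual_vector \<alpha> \<bullet> (basis_enum ! i)
      = (\<Sum>j<DIM('a). ((-1) ^ j * \<alpha> (omit j basis_enum)) * (basis_enum ! j \<bullet> (basis_enum ! i :: 'a)))"
    by (simp add: dual_vector_def inner_sum_left)
  also have "\<dots> = (\<Sum>j<DIM('a). if j = i then (-1) ^ i * \<alpha> (omit i basis_enum) else 0)"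
    using assms by (intro sum.cong refl) (simp add: basis_enum_inner del: append_assoc)
  finally show ?thesis using assms by simp
qed

text \<open>A list of \<open>n\<close> distinct basis vectors misses exactly one, so it rearranges
  some \<open>omit i basis_enum\<close>, and on those lists both sides agree by the choice of the
  coefficients of \<open>dual_vector\<close>.\<close>

lemma vol_dual_vector:
  fixes \<alpha> :: "'a::euclidean_space list \<Rightarrow> real"
  assumes n: "DIM('a) = Suc n" and \<alpha>: "alternating n \<alpha>"
  shows "\<alpha> vs = vol (dual_vector \<alpha> # vs)"
proof -
  let ?\<gamma> = "\<lambda>vs. \<alpha> vs - vol (dual_vector \<alpha> # vs)"
  have alt: "alternating n ?\<gamma>"
    using alternating_vol[where 'a='a] n by (intro alternating_diff \<alpha> alternating_Cons) simp
  have z: "?\<gamma> (omit i basis_enum) = 0" if "i < DIM('a)" for i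
    using that by (simp add: vol_Cons_omit_basis_enum dual_vector_inner del: append_assoc)
  have "?\<gamma> vs = 0"
  proof (rule alternating_eq_zero_Basis[OF alt])
    fix bs :: "'a list" assume bs: "length bs = n" "distinct bs" "set bs \<subseteq> Basis"
    then have "card (set bs) = n" by (simp add: distinct_card)
    then have "set bs \<noteq> Basis" using n by auto
    then obtain b where b: "b \<in> Basis" "b \<notin> set bs" using bs by auto
    then obtain i where i: "i < DIM('a)" "b = basis_enum ! i"
      using basis_enum(2)[where 'a='a] by (metis in_set_conv_nth length_basis_enum)
    have "card (insert b (set bs)) = DIM('a)" using b n \<open>card (set bs) = n\<close> by simp
    then have "insert b (set bs) = Basis"
      using b bs by (intro card_subset_eq) auto
    then have "mset (b # bs) = mset (basis_enum :: 'a list)"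
      using bs b basis_enum by (subst set_eq_iff_mset_eq_distinct[symmetric]) auto
    moreover have "mset (basis_enum :: 'a list) = mset (b # omit i basis_enum)"
      using i id_take_nth_drop[of i "basis_enum :: 'a list"]
      by (metis length_basis_enum mset.simps(2) mset_append union_mset_add_mset_right)
    ultimately have "mset bs = mset (omit i (basis_enum :: 'a list))" by simp
    from alternating_mset_zero_iff[OF alt this, of "[]"] z[OF i(1)] show "?\<gamma> bs = 0" by simp
  qed
  then show ?thesis by simp
qed

lemma vol_Cons_eq_zeroD:
  assumes "\<And>vs. vol (w # vs) = 0"
  shows "(w :: 'a::euclidean_space) = 0"
proof (rule euclidean_eqI)
  fix b :: 'a assume "b \<in> Basis"
  then obtain i where "i < DIM('a)" "b = basis_enum ! i"
    using basis_enum(2)[where 'a='a] by (metis in_set_conv_nth length_basis_enum)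
  then show "w \<bullet> b = 0 \<bullet> b"
    using assms vol_Cons_omit_basis_enum[of i w] by simp
qed

subsection \<open>Derivatives within a convex body\<close>

definition DV :: "'a::real_normed_vector set \<Rightarrow> 'a \<Rightarrow> ('a \<Rightarrow> real) \<Rightarrow> 'a \<Rightarrow> real" where
  "DV S v f = (\<lambda>x. frechet_derivative f (at x within S) v)"

text \<open>
  \<open>C_in\<close> generalises \<open>Ck_on\<close> to derivatives within \<open>S\<close>, which gives derivatives up to the boundary of
  the closed ball; both agree on the whole space.
\<close>

primrec C_in :: "nat \<Rightarrow> 'a::real_normed_vector set \<Rightarrow> ('a \<Rightarrow> real) \<Rightarrow> bool" where
  "C_in 0 S f \<longleftrightarrow> continuous_on S f"
| "C_in (Suc k) S f \<longleftrightarrow> (\<forall>x\<in>S. f differentiable (at x within S)) \<and> (\<forall>v. C_in k S (DV S v f))"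

definition smooth_in :: "'a::real_normed_vector set \<Rightarrow> ('a \<Rightarrow> real) \<Rightarrow> bool" where
  "smooth_in S f \<longleftrightarrow> (\<forall>k. C_in k S f)"

definition lap :: "'a::euclidean_space set \<Rightarrow> ('a \<Rightarrow> real) \<Rightarrow> 'a \<Rightarrow> real" where
  "lap S f x = (\<Sum>b\<in>Basis. DV S b (DV S b f) x)"

definition radial :: "'a::euclidean_space set \<Rightarrow> ('a \<Rightarrow> real) \<Rightarrow> 'a \<Rightarrow> real" where
  "radial S f x = DV S x f x"

lemma C_in_UNIV: "C_in k UNIV f \<longleftrightarrow> Ck_on k f UNIV"
  by (induction k arbitrary: f) (auto simp: DV_def)

text \<open>\<open>frechet_derivative\<close> is a choice among all derivatives. Functions that
  agree on \<open>S\<close> have the same set of derivatives within \<open>S\<close>, so the choice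
  is the same, whether or not derivatives are unique.\<close>

lemma DV_cong: "(\<And>y. y \<in> S \<Longrightarrow> f y = g y) \<Longrightarrow> x \<in> S \<Longrightarrow> DV S v f x = DV S v g x"
proof -
  assume a: "\<And>y. y \<in> S \<Longrightarrow> f y = g y" "x \<in> S"
  then have "(f has_derivative f') (at x within S) \<longleftrightarrow> (g has_derivative f') (at x within S)" for f'
    by (metis has_derivative_transform)
  then show ?thesis by (simp add: DV_def frechet_derivative_def)
qed

lemma C_in_cong: "(\<And>y. y \<in> S \<Longrightarrow> f y = g y) \<Longrightarrow> C_in k S f \<longleftrightarrow> C_in k S g"
proof (induction k arbitrary: f g)
  case 0
  then show ?case by (simp cong: continuous_on_cong)
next
  case (Suc k)
  have "f differentiable (at x within S) \<longleftrightarrow> g differentiable (at x within S)" if "x \<in> S" for x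
    using Suc.prems that unfolding differentiable_def by (metis has_derivative_transform)
  moreover have "C_in k S (DV S v f) \<longleftrightarrow> C_in k S (DV S v g)" for v
    by (rule Suc.IH) (rule DV_cong[OF Suc.prems])
  ultimately show ?case by simp
qed

lemma smooth_in_cong: "(\<And>y. y \<in> S \<Longrightarrow> f y = g y) \<Longrightarrow> smooth_in S f \<longleftrightarrow> smooth_in S g"
  by (simp add: smooth_in_def C_in_cong[of S f g])

lemma C_in_Suc_imp: "C_in (Suc k) S f \<Longrightarrow> C_in k S f"
proof (induction k arbitrary: f)
  case 0
  then show ?case
    by (simp add: continuous_on_eq_continuous_within differentiable_imp_continuous_within)
next
  case (Suc k)
  note p = iffD1[OF C_in.simps(2)[of "Suc k" S f] Suc.prems]
  have "C_in k S (DV S v f)" for v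
    using p by (intro Suc.IH) blast
  then show ?case using p by (subst C_in.simps(2)) blast
qed

lemma smooth_in_Suc: "smooth_in S f \<Longrightarrow> C_in (Suc k) S f"
  by (simp only: smooth_in_def)

lemma smooth_in_DV: "smooth_in S f \<Longrightarrow> smooth_in S (DV S v f)"
  unfolding smooth_in_def[of S "DV S v f"] using smooth_in_Suc[of S f] by simp

lemma smooth_in_differentiable: "smooth_in S f \<Longrightarrow> x \<in> S \<Longrightarrow> f differentiable (at x within S)"
  using smooth_in_Suc[of S f 0] by simp

lemma smooth_in_continuous_on: "smooth_in S f \<Longrightarrow> continuous_on S f"
  using smooth_in_Suc[of S f 0] C_in_Suc_imp[of 0 S f] by simp

lemma smooth_in_has_derivative:
  "smooth_in S f \<Longrightarrow> x \<in> S \<Longrightarrow> (f has_derivative (\<lambda>v. DV S v f x)) (at x within S)"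
  using smooth_in_differentiable[of S f x] by (simp add: DV_def frechet_derivative_works)

lemma linear_DV: "smooth_in S f \<Longrightarrow> x \<in> S \<Longrightarrow> linear (\<lambda>v. DV S v f x)"
  by (rule has_derivative_linear[OF smooth_in_has_derivative])

lemma DV_Basis:
  fixes f :: "'a::euclidean_space \<Rightarrow> real"
  assumes "smooth_in S f" "x \<in> S"
  shows "DV S v f x = (\<Sum>b\<in>Basis. (v \<bullet> b) * DV S b f x)"
proof -
  have lin: "linear (\<lambda>v. DV S v f x)" by (rule linear_DV[OF assms])
  have "DV S v f x = DV S (\<Sum>b\<in>Basis. (v \<bullet> b) *\<^sub>R b) f x" by (simp add: euclidean_representation)
  also have "\<dots> = (\<Sum>b\<in>Basis. (v \<bullet> b) * DV S b f x)"
    by (simp add: linear_sum[OF lin] linear_cmul[OF lin])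
  finally show ?thesis .
qed

text \<open>A common setting for the whole space and the closed ball: derivatives within
  \<open>S\<close> are unique at every point, boundary points included, and identities between
  continuous functions extend from the interior to the boundary.\<close>

locale convex_body =
  fixes S :: "'a::euclidean_space set"
  assumes convex_S: "convex S" and interior_S: "interior S \<noteq> {}"
begin

text \<open>On the segment from \<open>x\<close> to \<open>y\<close> the zero function has
  derivatives \<open>L (y - x)\<close> and \<open>0\<close>, so one-variable uniqueness gives
  \<open>L (y - x) = 0\<close> for all \<open>y\<close> in \<open>S\<close>. Differences of such
  vectors contain a multiple of every direction because \<open>S\<close> contains a ball.\<close>

lemma derivative_unique:
  fixes f :: "'a \<Rightarrow> real"
  assumes "(f has_derivative f') (at x within S)" "(f has_derivative f'') (at x within S)" "x \<in> S"
  shows "f' = f''"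
proof -
  define L where "L v = f' v - f'' v" for v
  have L: "((\<lambda>_. 0) has_derivative L) (at x within S)"
    using has_derivative_diff[OF assms(1,2)] by (simp add: L_def[abs_def])
  then have lin: "linear L" by (rule has_derivative_linear)
  have z: "L (y - x) = 0" if y: "y \<in> S" for y
  proof -
    have sub: "(\<lambda>t::real. x + t *\<^sub>R (y - x)) ` cbox 0 1 \<subseteq> S"
    proof clarsimp
      fix t :: real assume t: "0 \<le> t" "t \<le> 1"
      then have "(1 - t) *\<^sub>R x + t *\<^sub>R y \<in> S"
        using convex_S assms(3) y by (intro convexD) auto
      then show "x + t *\<^sub>R (y - x) \<in> S" by (simp add: algebra_simps)
    qed
    have "((\<lambda>t::real. x + t *\<^sub>R (y - x)) has_derivative (\<lambda>t. t *\<^sub>R (y - x))) (at 0 within cbox 0 1)"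
      by (auto intro!: derivative_eq_intros)
    moreover have "((\<lambda>_. 0) has_derivative L)
       (at (x + (0::real) *\<^sub>R (y - x)) within (\<lambda>t::real. x + t *\<^sub>R (y - x)) ` cbox 0 1)"
      using has_derivative_subset[OF L sub] by simp
    ultimately have "((\<lambda>t::real. 0::real) has_derivative (\<lambda>t. L (t *\<^sub>R (y - x)))) (at 0 within cbox 0 1)"
      by (rule has_derivative_in_compose)
    moreover have "((\<lambda>t::real. 0::real) has_derivative (\<lambda>t. 0)) (at 0 within cbox 0 1)"
      by simp
    ultimately have "(\<lambda>t::real. L (t *\<^sub>R (y - x))) = (\<lambda>t. 0)"
      by (intro frechet_derivative_unique_within_closed_interval[of 0 1 0]) auto
    from fun_cong[OF this, of 1] show ?thesis by simp
  qed
  obtain a e where ae: "e > 0" "ball a e \<subseteq> S"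
    using interior_S by (meson ex_in_conv mem_interior)
  have "L v = 0" for v
  proof (cases "v = 0")
    case False
    define c where "c = e / (2 * norm v)"
    have c: "c > 0" using ae False by (simp add: c_def)
    have "a + c *\<^sub>R v \<in> S" "a \<in> S"
      using ae False by (auto intro!: subsetD[OF ae(2)] simp: dist_norm c_def)
    from z[OF this(1)] z[OF this(2)] have "L ((a + c *\<^sub>R v - x) - (a - x)) = 0"
      by (simp only: linear_diff[OF lin])
    then show ?thesis using c by (simp add: linear_cmul[OF lin])
  qed (simp add: linear_0[OF lin])
  then show ?thesis by (auto simp: L_def)
qed

lemma DV_eqI:
  assumes "(f has_derivative f') (at x within S)" "x \<in> S"
  shows "DV S v f x = f' v"
proof -
  have "(f has_derivative frechet_derivative f (at x within S)) (at x within S)"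
    using Derivative.differentiableI[OF assms(1)] by (rule iffD1[OF frechet_derivative_works])
  from derivative_unique[OF this assms] show ?thesis by (simp add: DV_def)
qed

lemma DV_const [simp]: "x \<in> S \<Longrightarrow> DV S v (\<lambda>_. c) x = 0"
  by (rule DV_eqI[where f' = "\<lambda>_. 0"]) auto

lemma C_in_const: "C_in k S (\<lambda>_. c)"
proof (induction k arbitrary: c)
  case (Suc k)
  have "C_in k S (DV S v (\<lambda>_. c)) \<longleftrightarrow> C_in k S (\<lambda>_. 0)" for v
    by (rule C_in_cong) simp
  then show ?case using Suc by simp
qed simp

lemma smooth_in_const [simp]: "smooth_in S (\<lambda>_. c)"
  by (simp add: smooth_in_def C_in_const)

lemma DV_inner: "x \<in> S \<Longrightarrow> DV S v (\<lambda>x. x \<bullet> a) x = v \<bullet> a"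
  by (rule DV_eqI) (auto intro!: derivative_eq_intros)

lemma smooth_in_inner [simp]: "smooth_in S (\<lambda>x. x \<bullet> a)"
proof -
  have "C_in k S (\<lambda>x. x \<bullet> a)" for k
  proof (cases k)
    case (Suc m)
    have "C_in m S (DV S v (\<lambda>x. x \<bullet> a)) \<longleftrightarrow> C_in m S (\<lambda>_. v \<bullet> a)" for v
      by (rule C_in_cong) (simp add: DV_inner)
    moreover have "(\<lambda>x. x \<bullet> a) differentiable at x within S" for x
      unfolding differentiable_def by (rule exI, rule has_derivative_inner_left, rule has_derivative_ident)
    ultimately show ?thesis by (simp add: Suc C_in_const)
  qed (simp add: continuous_intros)
  then show ?thesis by (simp add: smooth_in_def)
qed

lemma C_in_has_derivative:
  "C_in (Suc k) S f \<Longrightarrow> x \<in> S \<Longrightarrow> (f has_derivative (\<lambda>v. DV S v f x)) (at x within S)"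
  by (simp add: DV_def frechet_derivative_works)

lemma C_in_add: "C_in k S f \<Longrightarrow> C_in k S g \<Longrightarrow> C_in k S (\<lambda>x. f x + g x)"
proof (induction k arbitrary: f g)
  case (Suc k)
  have d: "((\<lambda>x. f x + g x) has_derivative (\<lambda>v. DV S v f x + DV S v g x)) (at x within S)" if "x \<in> S" for x
    using that Suc.prems by (intro has_derivative_add C_in_has_derivative)
  have "C_in k S (DV S v (\<lambda>x. f x + g x)) \<longleftrightarrow> C_in k S (\<lambda>x. DV S v f x + DV S v g x)" for v
    by (rule C_in_cong) (rule DV_eqI[OF d])
  with Suc d show ?case by (auto simp: differentiable_def)
qed (simp add: continuous_on_add)

lemma C_in_mult: "C_in k S f \<Longrightarrow> C_in k S g \<Longrightarrow> C_in k S (\<lambda>x. f x * g x)"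
proof (induction k arbitrary: f g)
  case (Suc k)
  have d: "((\<lambda>x. f x * g x) has_derivative (\<lambda>v. f x * DV S v g x + DV S v f x * g x)) (at x within S)"
    if "x \<in> S" for x
    using that Suc.prems by (intro has_derivative_mult C_in_has_derivative)
  have "C_in k S (DV S v (\<lambda>x. f x * g x)) \<longleftrightarrow> C_in k S (\<lambda>x. f x * DV S v g x + DV S v f x * g x)" for v
    by (rule C_in_cong) (rule DV_eqI[OF d])
  moreover have "C_in k S (\<lambda>x. f x * DV S v g x + DV S v f x * g x)" for v
    using Suc.prems C_in_Suc_imp[of k S f] C_in_Suc_imp[of k S g]
    by (intro C_in_add Suc.IH) auto
  ultimately show ?case using d by (auto simp: differentiable_def)
qed (simp add: continuous_on_mult)

lemma smooth_in_add [simp]: "smooth_in S f \<Longrightarrow> smooth_in S g \<Longrightarrow> smooth_in S (\<lambda>x. f x + g x)"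
  by (simp add: smooth_in_def C_in_add)

lemma smooth_in_mult [simp]: "smooth_in S f \<Longrightarrow> smooth_in S g \<Longrightarrow> smooth_in S (\<lambda>x. f x * g x)"
  by (simp add: smooth_in_def C_in_mult)

lemma smooth_in_minus [simp]: "smooth_in S f \<Longrightarrow> smooth_in S (\<lambda>x. - f x)"
  using smooth_in_mult[of "\<lambda>_. -1" f] by simp

lemma smooth_in_diff [simp]: "smooth_in S f \<Longrightarrow> smooth_in S g \<Longrightarrow> smooth_in S (\<lambda>x. f x - g x)"
  using smooth_in_add[of f "\<lambda>x. - g x"] by simp

lemma smooth_in_divide [simp]: "smooth_in S f \<Longrightarrow> smooth_in S (\<lambda>x. f x / c)"
  using smooth_in_mult[of "f" "\<lambda>_. inverse c"] by (simp add: divide_inverse)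

lemma smooth_in_sum [simp]: "(\<And>i. i \<in> I \<Longrightarrow> smooth_in S (f i)) \<Longrightarrow> smooth_in S (\<lambda>x. \<Sum>i\<in>I. f i x)"
  by (induction I rule: infinite_finite_induct) auto

lemma smooth_in_power [simp]: "smooth_in S f \<Longrightarrow> smooth_in S (\<lambda>x. f x ^ m)"
  by (induction m) simp_all

lemma smooth_in_prod [simp]:
  "(\<And>i. i \<in> I \<Longrightarrow> smooth_in S (f i)) \<Longrightarrow> smooth_in S (\<lambda>x. \<Prod>i\<in>I. f i x)"
  by (induction I rule: infinite_finite_induct) simp_all

lemma smooth_in_inner_self [simp]: "smooth_in S (\<lambda>x. x \<bullet> x)"
proof -
  have "(\<lambda>x::'a. x \<bullet> x) = (\<lambda>x. \<Sum>b\<in>Basis. (x \<bullet> b) * (x \<bullet> b))"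
    by (rule ext) (rule euclidean_inner)
  then show ?thesis by simp
qed

lemma DV_add: "smooth_in S f \<Longrightarrow> smooth_in S g \<Longrightarrow> x \<in> S \<Longrightarrow>
    DV S v (\<lambda>x. f x + g x) x = DV S v f x + DV S v g x"
  by (rule DV_eqI) (intro has_derivative_add smooth_in_has_derivative)

lemma DV_diff: "smooth_in S f \<Longrightarrow> smooth_in S g \<Longrightarrow> x \<in> S \<Longrightarrow>
    DV S v (\<lambda>x. f x - g x) x = DV S v f x - DV S v g x"
  by (rule DV_eqI) (intro has_derivative_diff smooth_in_has_derivative)

lemma DV_mult: "smooth_in S f \<Longrightarrow> smooth_in S g \<Longrightarrow> x \<in> S \<Longrightarrow>
    DV S v (\<lambda>x. f x * g x) x = f x * DV S v g x + DV S v f x * g x"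
  by (rule DV_eqI) (intro has_derivative_mult smooth_in_has_derivative)

lemma DV_cmult: "smooth_in S f \<Longrightarrow> x \<in> S \<Longrightarrow> DV S v (\<lambda>x. c * f x) x = c * DV S v f x"
  by (simp add: DV_mult)

lemma DV_divide: "smooth_in S f \<Longrightarrow> x \<in> S \<Longrightarrow> DV S v (\<lambda>x. f x / c) x = DV S v f x / c"
  using DV_cmult[of f x v "inverse c"] by (simp add: divide_inverse mult.commute)

lemma DV_minus: "smooth_in S f \<Longrightarrow> x \<in> S \<Longrightarrow> DV S v (\<lambda>x. - f x) x = - DV S v f x"
  using DV_cmult[of f x v "-1"] by simp

lemma DV_sum: "(\<And>i. i \<in> I \<Longrightarrow> smooth_in S (f i)) \<Longrightarrow> x \<in> S \<Longrightarrow>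
    DV S v (\<lambda>x. \<Sum>i\<in>I. f i x) x = (\<Sum>i\<in>I. DV S v (f i) x)"
  by (rule DV_eqI) (rule has_derivative_sum, rule smooth_in_has_derivative)

lemma DV_inner_self: "x \<in> S \<Longrightarrow> DV S v (\<lambda>x. x \<bullet> x) x = 2 * (v \<bullet> x)"
  by (rule DV_eqI) (auto intro!: derivative_eq_intros simp: inner_commute)

text \<open>Links the ambient local extensions in \<open>smooth_forms\<close> to smoothness within
  \<open>S\<close>. On \<open>S \<inter> U\<close> the derivative of \<open>f\<close> within
  \<open>S\<close> is that of \<open>g\<close>, so the hypothesis is inherited by
  \<open>DV S v f\<close>.\<close>

lemma smooth_in_local:
  assumes "\<And>x. x \<in> S \<Longrightarrow> \<exists>U g. open U \<and> x \<in> U \<and> (\<forall>k. Ck_on k g U) \<and> (\<forall>y\<in>S \<inter> U. f y = g y)"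
  shows "smooth_in S f"
proof -
  have "C_in k S f" for k
    using assms
  proof (induction k arbitrary: f)
    case 0
    have "continuous (at x within S) f" if x: "x \<in> S" for x
    proof -
      obtain U g where U: "open U" "x \<in> U" "\<forall>k. Ck_on k g U" "\<forall>y\<in>S \<inter> U. f y = g y"
        using 0[OF x] by blast
      then have "continuous_on U g" by (metis Ck_on.simps(1))
      then have "continuous (at x within S) g"
        using U by (metis continuous_at_imp_continuous_within continuous_on_eq_continuous_at)
      then show ?thesis
      proof (rule continuous_transform_within_openin[where T=S])
        show "openin (top_of_set S) (S \<inter> U)" using U by blast
      qed (use U x in auto)
    qed
    then show ?case by (simp add: continuous_on_eq_continuous_within)
  next
    case (Suc k)
    have key: "(f has_derivative frechet_derivative g (at y)) (at y within S)"
      if U: "open U" "\<forall>k. Ck_on k g U" "\<forall>y\<in>S \<inter> U. f y = g y" and y: "y \<in> S \<inter> U" for U g y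
    proof -
      have "g differentiable (at y)"
        using U(2) y by (metis Ck_on.simps(2) IntD2)
      then have "(g has_derivative frechet_derivative g (at y)) (at y within S)"
        by (simp add: frechet_derivative_works has_derivative_at_withinI)
      moreover obtain e where "e > 0" "ball y e \<subseteq> U"
        using U(1) y by (meson IntD2 openE)
      ultimately show ?thesis
      proof (elim has_derivative_transform_within)
        show "y \<in> S" using y by simp
        show "g z = f z" if "z \<in> S" "dist z y < e" for z
          using that U(3) \<open>ball y e \<subseteq> U\<close> by (simp add: subset_iff dist_commute)
      qed
    qed
    have "f differentiable (at x within S)" if x: "x \<in> S" for x
      using Suc.prems[OF x] key x unfolding differentiable_def by blast
    moreover have "C_in k S (DV S v f)" for v
    proof (rule Suc.IH)
      fix x assume x: "x \<in> S"
      obtain U g where U: "open U" "x \<in> U" "\<forall>k. Ck_on k g U" "\<forall>y\<in>S \<inter> U. f y = g y"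
        using Suc.prems[OF x] by blast
      have "\<forall>k. Ck_on k (\<lambda>y. frechet_derivative g (at y) v) U"
        using U(3) by (metis Ck_on.simps(2))
      moreover have "DV S v f y = frechet_derivative g (at y) v" if "y \<in> S \<inter> U" for y
        using key[OF U(1,3,4) that] that by (intro DV_eqI) auto
      ultimately show "\<exists>U g. open U \<and> x \<in> U \<and> (\<forall>k. Ck_on k g U) \<and> (\<forall>y\<in>S \<inter> U. DV S v f y = g y)"
        using U(1,2) by blast
    qed
    ultimately show ?case by simp
  qed
  then show ?thesis by (simp add: smooth_in_def)
qed

lemma smooth_in_UNIV_imp: "smooth_in UNIV f \<Longrightarrow> smooth_in S f"
  by (rule smooth_in_local, rule exI[of _ UNIV], rule exI[of _ f]) (auto simp: smooth_in_def C_in_UNIV)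

lemma DV_UNIV_eq: "smooth_in UNIV f \<Longrightarrow> x \<in> S \<Longrightarrow> DV S v f x = DV UNIV v f x"
  using smooth_in_has_derivative[of UNIV f x]
  by (intro DV_eqI[OF has_derivative_at_withinI]) simp_all

lemma DERIV_line:
  assumes g: "smooth_in S g" and y: "y + s *\<^sub>R u \<in> interior S"
  shows "((\<lambda>s. g (y + s *\<^sub>R u)) has_real_derivative DV S u g (y + s *\<^sub>R u)) (at s)"
proof -
  have yS: "y + s *\<^sub>R u \<in> S" using y interior_subset by blast
  have "(g has_derivative (\<lambda>v. DV S v g (y + s *\<^sub>R u))) (at (y + s *\<^sub>R u))"
    using smooth_in_has_derivative[OF g yS] at_within_interior[OF y] by simp
  moreover have "((\<lambda>s. y + s *\<^sub>R u) has_derivative (\<lambda>h. h *\<^sub>R u)) (at s)"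
    by (auto intro!: derivative_eq_intros)
  ultimately have "((\<lambda>s. g (y + s *\<^sub>R u)) has_derivative (\<lambda>h. DV S (h *\<^sub>R u) g (y + s *\<^sub>R u))) (at s)"
    by (rule has_derivative_compose[rotated])
  moreover have "DV S (h *\<^sub>R u) g (y + s *\<^sub>R u) = DV S u g (y + s *\<^sub>R u) * h" for h
    using linear_cmul[OF linear_DV[OF g yS]] by simp
  ultimately show ?thesis by (simp add: has_field_derivative_def)
qed

text \<open>The mean value theorem applied once in direction \<open>v\<close> and once in direction
  \<open>w\<close>. The left side is symmetric in \<open>v\<close> and \<open>w\<close>, the right
  side is one of the two mixed derivatives.\<close>

lemma second_difference:
  assumes f: "smooth_in S f" and t: "t > 0"
    and I: "\<And>a b. 0 \<le> a \<Longrightarrow> a \<le> t \<Longrightarrow> 0 \<le> b \<Longrightarrow> b \<le> t \<Longrightarrow> x + a *\<^sub>R v + b *\<^sub>R w \<in> interior S"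
  shows "\<exists>a b. 0 < a \<and> a < t \<and> 0 < b \<and> b < t \<and>
    f (x + t *\<^sub>R v + t *\<^sub>R w) - f (x + t *\<^sub>R v) - f (x + t *\<^sub>R w) + f x
      = t\<^sup>2 * DV S w (DV S v f) (x + a *\<^sub>R v + b *\<^sub>R w)"
proof -
  define \<phi> where "\<phi> s = f ((x + t *\<^sub>R w) + s *\<^sub>R v) - f (x + s *\<^sub>R v)" for s
  have "\<exists>z. 0 < z \<and> z < t \<and> \<phi> t - \<phi> 0 = (t - 0) * (DV S v f ((x + t *\<^sub>R w) + z *\<^sub>R v) - DV S v f (x + z *\<^sub>R v))"
  proof (rule MVT2[OF t])
    fix s assume s: "0 \<le> s" "s \<le> t"
    have "(x + t *\<^sub>R w) + s *\<^sub>R v \<in> interior S" "x + s *\<^sub>R v \<in> interior S"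
      using I[of s t] I[of s 0] s t by (auto simp: algebra_simps)
    then show "(\<phi> has_real_derivative DV S v f ((x + t *\<^sub>R w) + s *\<^sub>R v) - DV S v f (x + s *\<^sub>R v)) (at s)"
      unfolding \<phi>_def[abs_def] by (intro DERIV_diff DERIV_line f)
  qed
  then obtain a where a: "0 < a" "a < t"
    "\<phi> t - \<phi> 0 = t * (DV S v f ((x + t *\<^sub>R w) + a *\<^sub>R v) - DV S v f (x + a *\<^sub>R v))" by auto
  have "\<exists>z. 0 < z \<and> z < t \<and> DV S v f ((x + a *\<^sub>R v) + t *\<^sub>R w) - DV S v f ((x + a *\<^sub>R v) + 0 *\<^sub>R w)
      = (t - 0) * DV S w (DV S v f) ((x + a *\<^sub>R v) + z *\<^sub>R w)"
  proof (rule MVT2[OF t])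
    fix s assume "0 \<le> s" "s \<le> t"
    then show "((\<lambda>s. DV S v f (x + a *\<^sub>R v + s *\<^sub>R w)) has_real_derivative
        DV S w (DV S v f) (x + a *\<^sub>R v + s *\<^sub>R w)) (at s)"
      using I[of a s] a by (intro DERIV_line smooth_in_DV f) auto
  qed
  then obtain b where "0 < b" "b < t"
    "DV S v f ((x + a *\<^sub>R v) + t *\<^sub>R w) - DV S v f ((x + a *\<^sub>R v) + 0 *\<^sub>R w)
      = t * DV S w (DV S v f) ((x + a *\<^sub>R v) + b *\<^sub>R w)" by auto
  with a show ?thesis
    by (intro exI[of _ a] exI[of _ b]) (simp add: \<phi>_def power2_eq_square algebra_simps)
qed

lemma DV_commute_interior:
  assumes f: "smooth_in S f" and x: "x \<in> interior S"
  shows "DV S v (DV S w f) x = DV S w (DV S v f) x"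
proof (rule ccontr)
  let ?A = "DV S v (DV S w f)" and ?B = "DV S w (DV S v f)"
  assume ne: "?A x \<noteq> ?B x"
  define \<epsilon> where "\<epsilon> = \<bar>?A x - ?B x\<bar> / 2"
  have \<epsilon>: "\<epsilon> > 0" using ne by (simp add: \<epsilon>_def)
  have "isCont ?A x" "isCont ?B x"
    using smooth_in_continuous_on[OF smooth_in_DV[OF smooth_in_DV[OF f]]] x
    by (meson continuous_on_interior)+
  then obtain d1 d2 where d: "d1 > 0" "d2 > 0"
    "\<And>y. dist y x < d1 \<Longrightarrow> dist (?A y) (?A x) < \<epsilon>" "\<And>y. dist y x < d2 \<Longrightarrow> dist (?B y) (?B x) < \<epsilon>"
    using \<epsilon> unfolding continuous_at_eps_delta by metis
  obtain e where e: "e > 0" "ball x e \<subseteq> interior S"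
    using x by (meson open_interior openE)
  \<comment> \<open>With this \<open>t\<close> all points of the parallelogram spanned by
    \<open>t v\<close> and \<open>t w\<close> at \<open>x\<close> stay within \<open>r\<close>,
    inside the domain and where both mixed derivatives vary by less than \<open>\<epsilon>\<close>.
    The summand 1 in \<open>M\<close> covers \<open>v = w = 0\<close>.\<close>
  define r where "r = min e (min d1 d2)"
  define M where "M = norm v + norm w + 1"
  define t where "t = r / (2 * M)"
  have r: "r > 0" using e d by (simp add: r_def)
  have nn: "M > 0" unfolding M_def by (smt (verit) norm_ge_zero)
  have t: "t > 0" using r nn by (simp add: t_def)
  have near: "dist (x + a *\<^sub>R v + b *\<^sub>R w) x < r" if "0 \<le> a" "a \<le> t" "0 \<le> b" "b \<le> t" for a b
  proof -
    have "norm (a *\<^sub>R v + b *\<^sub>R w) \<le> a * norm v + b * norm w"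
      using that norm_triangle_ineq[of "a *\<^sub>R v" "b *\<^sub>R w"] by simp
    also have "\<dots> \<le> t * norm v + t * norm w" using that by (intro add_mono mult_right_mono) auto
    also have "\<dots> \<le> t * M" using t by (simp add: M_def algebra_simps)
    also have "\<dots> < r" using r nn by (simp add: t_def field_simps)
    finally show ?thesis by (simp add: dist_norm add.assoc)
  qed
  have I: "x + a *\<^sub>R v + b *\<^sub>R w \<in> interior S" if "0 \<le> a" "a \<le> t" "0 \<le> b" "b \<le> t" for a b
    using near[OF that] e by (auto simp: r_def dist_commute)
  then have I': "x + a *\<^sub>R w + b *\<^sub>R v \<in> interior S" if "0 \<le> a" "a \<le> t" "0 \<le> b" "b \<le> t" for a b
    using that by (metis add.assoc add.commute)
  obtain a b where ab: "0 < a" "a < t" "0 < b" "b < t"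
    "f (x + t *\<^sub>R v + t *\<^sub>R w) - f (x + t *\<^sub>R v) - f (x + t *\<^sub>R w) + f x
      = t\<^sup>2 * ?B (x + a *\<^sub>R v + b *\<^sub>R w)"
    using second_difference[OF f t I] by blast
  obtain a' b' where ab': "0 < a'" "a' < t" "0 < b'" "b' < t"
    "f (x + t *\<^sub>R w + t *\<^sub>R v) - f (x + t *\<^sub>R w) - f (x + t *\<^sub>R v) + f x
      = t\<^sup>2 * ?A (x + a' *\<^sub>R w + b' *\<^sub>R v)"
    using second_difference[OF f t I'] by blast
  have "t\<^sup>2 * ?B (x + a *\<^sub>R v + b *\<^sub>R w) = t\<^sup>2 * ?A (x + a' *\<^sub>R w + b' *\<^sub>R v)"
    using ab(5) ab'(5) by (simp add: algebra_simps)
  then have "?B (x + a *\<^sub>R v + b *\<^sub>R w) = ?A (x + a' *\<^sub>R w + b' *\<^sub>R v)"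
    using t by simp
  moreover have "dist (x + a *\<^sub>R v + b *\<^sub>R w) x < d2"
    using near[of a b] ab by (simp add: r_def)
  moreover have "dist (x + a' *\<^sub>R w + b' *\<^sub>R v) x < d1"
    using near[of b' a'] ab' by (simp add: r_def algebra_simps)
  ultimately show False
    using d(3)[of "x + a' *\<^sub>R w + b' *\<^sub>R v"] d(4)[of "x + a *\<^sub>R v + b *\<^sub>R w"]
    unfolding dist_real_def \<epsilon>_def by (smt (verit) field_sum_of_halves)
qed

text \<open>A convex set with interior points lies in the closure of its interior.\<close>

lemma eq_on_interior_imp:
  fixes g h :: "'a \<Rightarrow> real"
  assumes "continuous_on S g" "continuous_on S h" "\<And>x. x \<in> interior S \<Longrightarrow> g x = h x" "x \<in> S"
  shows "g x = h x"
proof -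
  have "closedin (top_of_set S) {y \<in> S. g y - h y = 0}"
    using continuous_closedin_preimage_constant[of S "\<lambda>y. g y - h y" 0] assms(1,2)
    by (simp add: continuous_on_diff)
  then obtain T where T: "closed T" "{y \<in> S. g y - h y = 0} = S \<inter> T"
    by (auto simp: closedin_closed)
  have "interior S \<subseteq> T"
    using T(2) assms(3) interior_subset[of S] by auto
  then have "closure (interior S) \<subseteq> T" using T(1) by (rule closure_minimal)
  moreover have "x \<in> closure (interior S)"
    using convex_closure_interior[OF convex_S interior_S] assms(4) closure_subset by blast
  ultimately show ?thesis using T(2) assms(4) by auto
qed

lemma DV_commute:
  assumes "smooth_in S f" "x \<in> S"
  shows "DV S v (DV S w f) x = DV S w (DV S v f) x"
proof (rule eq_on_interior_imp)
  show "continuous_on S (DV S v (DV S w f))" "continuous_on S (DV S w (DV S v f))"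
    by (intro smooth_in_continuous_on smooth_in_DV assms)+
qed (use assms DV_commute_interior in auto)

lemma constant_if_DV_zero:
  assumes f: "smooth_in S f" and z: "\<And>v x. x \<in> S \<Longrightarrow> DV S v f x = 0" and "x \<in> S" "y \<in> S"
  shows "f x = f y"
proof -
  have "(f has_derivative (\<lambda>h. 0)) (at x within S)" if "x \<in> S" for x
    using smooth_in_has_derivative[OF f that] z[OF that] by simp
  from has_derivative_zero_constant[OF convex_S this] show ?thesis
    using assms(3,4) by metis
qed

lemma DV_DV_cong: "(\<And>y. y \<in> S \<Longrightarrow> f y = g y) \<Longrightarrow> x \<in> S \<Longrightarrow> DV S u (DV S v f) x = DV S u (DV S v g) x"
  by (intro DV_cong) auto

lemma lap_cong: "(\<And>y. y \<in> S \<Longrightarrow> f y = g y) \<Longrightarrow> x \<in> S \<Longrightarrow> lap S f x = lap S g x"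
  unfolding lap_def by (intro sum.cong refl DV_DV_cong)

lemma lap_UNIV_eq: "smooth_in UNIV f \<Longrightarrow> x \<in> S \<Longrightarrow> lap S f x = lap UNIV f x"
proof -
  assume a: "smooth_in UNIV f" "x \<in> S"
  have "DV S b (DV S b f) x = DV UNIV b (DV UNIV b f) x" for b
    using DV_cong[of S "DV S b f" "DV UNIV b f" x b] DV_UNIV_eq[OF a(1)] DV_UNIV_eq[OF smooth_in_DV[OF a(1)]] a(2)
    by simp
  then show ?thesis by (simp add: lap_def)
qed

lemma lap_add: "smooth_in S f \<Longrightarrow> smooth_in S g \<Longrightarrow> x \<in> S \<Longrightarrow> lap S (\<lambda>x. f x + g x) x = lap S f x + lap S g x"
proof -
  assume a: "smooth_in S f" "smooth_in S g" "x \<in> S"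
  have "DV S b (DV S b (\<lambda>x. f x + g x)) x = DV S b (\<lambda>x. DV S b f x + DV S b g x) x" for b
    using a by (intro DV_cong) (simp_all add: DV_add)
  with a show ?thesis by (simp add: lap_def DV_add smooth_in_DV sum.distrib)
qed

lemma lap_mult:
  assumes "smooth_in S f" "smooth_in S g" "x \<in> S"
  shows "lap S (\<lambda>x. f x * g x) x
    = f x * lap S g x + lap S f x * g x + 2 * (\<Sum>b\<in>Basis. DV S b f x * DV S b g x)"
proof -
  have "DV S b (DV S b (\<lambda>x. f x * g x)) x = DV S b (\<lambda>x. f x * DV S b g x + DV S b f x * g x) x" for b
    using assms by (intro DV_cong) (simp_all add: DV_mult)
  with assms show ?thesis
    by (simp add: lap_def DV_add DV_mult smooth_in_DV sum.distrib sum_distrib_left sum_distrib_right algebra_simps)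
qed

lemma lap_const [simp]: "x \<in> S \<Longrightarrow> lap S (\<lambda>_. c) x = 0"
proof -
  assume x: "x \<in> S"
  have "DV S b (DV S b (\<lambda>_. c)) x = DV S b (\<lambda>_. 0) x" for b
    using x by (intro DV_cong) simp_all
  then show ?thesis using x by (simp add: lap_def)
qed

lemma lap_cmult: "smooth_in S f \<Longrightarrow> x \<in> S \<Longrightarrow> lap S (\<lambda>x. c * f x) x = c * lap S f x"
  by (simp add: lap_mult)

lemma lap_diff: "smooth_in S f \<Longrightarrow> smooth_in S g \<Longrightarrow> x \<in> S \<Longrightarrow> lap S (\<lambda>x. f x - g x) x = lap S f x - lap S g x"
  using lap_add[of f "\<lambda>x. (-1) * g x" x] lap_cmult[of g x "-1"] by simp

lemma lap_sum: "finite I \<Longrightarrow> (\<And>i. i \<in> I \<Longrightarrow> smooth_in S (f i)) \<Longrightarrow> x \<in> S \<Longrightarrow>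
    lap S (\<lambda>x. \<Sum>i\<in>I. f i x) x = (\<Sum>i\<in>I. lap S (f i) x)"
  by (induction I rule: finite_induct) (simp_all add: lap_add)

lemma lap_inner: "x \<in> S \<Longrightarrow> lap S (\<lambda>x. x \<bullet> a) x = 0"
proof -
  assume x: "x \<in> S"
  have "DV S b (DV S b (\<lambda>x. x \<bullet> a)) x = DV S b (\<lambda>_. b \<bullet> a) x" for b
    using x by (intro DV_cong) (simp_all add: DV_inner)
  then show ?thesis using x by (simp add: lap_def)
qed

lemma lap_inner_self: "x \<in> S \<Longrightarrow> lap S (\<lambda>x. x \<bullet> x) x = 2 * real DIM('a)"
proof -
  assume x: "x \<in> S"
  have "DV S b (DV S b (\<lambda>x. x \<bullet> x)) x = DV S b (\<lambda>x. 2 * (x \<bullet> b)) x" for b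
    using x by (intro DV_cong) (simp_all add: DV_inner_self inner_commute)
  with x show ?thesis by (simp add: lap_def DV_cmult DV_inner)
qed

lemma lap_DV: "smooth_in S f \<Longrightarrow> x \<in> S \<Longrightarrow> lap S (DV S v f) x = DV S v (lap S f) x"
proof -
  assume a: "smooth_in S f" "x \<in> S"
  have "DV S b (DV S b (DV S v f)) x = DV S v (DV S b (DV S b f)) x" for b
    using a DV_cong[of S "DV S b (DV S v f)" "DV S v (DV S b f)" x b]
    by (simp add: DV_commute smooth_in_DV)
  then show ?thesis using a by (simp add: lap_def[abs_def] DV_sum smooth_in_DV)
qed

lemma radial_Basis: "smooth_in S f \<Longrightarrow> x \<in> S \<Longrightarrow> radial S f x = (\<Sum>b\<in>Basis. (x \<bullet> b) * DV S b f x)"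
  unfolding radial_def by (rule DV_Basis)

lemma smooth_in_radial [simp]: "smooth_in S f \<Longrightarrow> smooth_in S (radial S f)"
  using smooth_in_cong[of S "radial S f" "\<lambda>x. \<Sum>b\<in>Basis. (x \<bullet> b) * DV S b f x"]
  by (simp add: radial_Basis smooth_in_DV)

text \<open>The commutator of a constant-direction derivative with the radial derivative is that
  derivative again; every shift of degree by one below comes from here.\<close>

lemma DV_radial:
  assumes f: "smooth_in S f" and x: "x \<in> S"
  shows "DV S v (radial S f) x = DV S v f x + radial S (DV S v f) x"
proof -
  have "DV S v (radial S f) x = DV S v (\<lambda>x. \<Sum>b\<in>Basis. (x \<bullet> b) * DV S b f x) x"
    using f x by (intro DV_cong radial_Basis)
  also have "\<dots> = (\<Sum>b\<in>Basis. (x \<bullet> b) * DV S v (DV S b f) x + (v \<bullet> b) * DV S b f x)"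
    using f x by (simp add: DV_sum DV_mult DV_inner smooth_in_DV)
  also have "\<dots> = (\<Sum>b\<in>Basis. (x \<bullet> b) * DV S b (DV S v f) x) + (\<Sum>b\<in>Basis. (v \<bullet> b) * DV S b f x)"
    using f x by (simp add: sum.distrib DV_commute[of f x v])
  finally show ?thesis
    using f x by (simp add: radial_Basis[OF smooth_in_DV[OF f]] DV_Basis[OF f x, of v])
qed

lemma radial_zero: "smooth_in S f \<Longrightarrow> 0 \<in> S \<Longrightarrow> radial S f 0 = 0"
  using linear_0[OF linear_DV] by (simp add: radial_def)

text \<open>Passes homogeneity from the derivatives back to the function: all derivatives of
  \<open>R f - (k + 1) f\<close> vanish, so it is constant, and its value at the origin is
  0.\<close>

lemma radial_homogeneous_if_DV:
  assumes f: "smooth_in S f" "f 0 = 0" and S: "0 \<in> S" "x \<in> S"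
    and hom: "\<And>v y. y \<in> S \<Longrightarrow> radial S (DV S v f) y = real k * DV S v f y"
  shows "radial S f x = real (Suc k) * f x"
proof -
  let ?G = "\<lambda>x. radial S f x - Suc k * f x"
  have "?G x = ?G 0"
  proof (rule constant_if_DV_zero[where f = ?G])
    show "DV S v ?G y = 0" if "y \<in> S" for v y
    proof -
      have "DV S v ?G y = DV S v (radial S f) y - DV S v (\<lambda>x. Suc k * f x) y"
        using f that by (intro DV_diff) simp_all
      also have "\<dots> = DV S v f y + radial S (DV S v f) y - Suc k * DV S v f y"
        by (simp only: DV_radial[OF f(1) that] DV_cmult[OF f(1) that])
      also have "\<dots> = 0" using hom[OF that, of v] by (simp add: algebra_simps)
      finally show ?thesis .
    qed
  qed (use f S in auto)
  then show ?thesis using radial_zero[OF f(1) S(1)] f(2) by simp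
qed

lemma DERIV_ray:
  assumes f: "smooth_in S f" and x: "x \<in> S" "0 \<in> S" and t: "0 \<le> t" "t \<le> 1"
  shows "((\<lambda>t. f (t *\<^sub>R x)) has_real_derivative DV S x f (t *\<^sub>R x)) (at t within {0..1})"
proof -
  have sub: "(\<lambda>t. t *\<^sub>R x) ` {0..1} \<subseteq> S"
  proof clarsimp
    fix t :: real assume "0 \<le> t" "t \<le> 1"
    then have "(1 - t) *\<^sub>R 0 + t *\<^sub>R x \<in> S"
      by (intro convexD[OF convex_S x(2,1)]) auto
    then show "t *\<^sub>R x \<in> S" by simp
  qed
  then have tx: "t *\<^sub>R x \<in> S" using t by (simp add: image_subset_iff)
  have "((\<lambda>t. t *\<^sub>R x) has_derivative (\<lambda>h. h *\<^sub>R x)) (at t within {0..1})"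
    by (auto intro!: derivative_eq_intros)
  then have "((\<lambda>t. f (t *\<^sub>R x)) has_derivative (\<lambda>h. DV S (h *\<^sub>R x) f (t *\<^sub>R x))) (at t within {0..1})"
    using has_derivative_subset[OF smooth_in_has_derivative[OF f tx] sub]
    by (rule has_derivative_in_compose)
  moreover have "DV S (h *\<^sub>R x) f (t *\<^sub>R x) = DV S x f (t *\<^sub>R x) * h" for h
    using linear_cmul[OF linear_DV[OF f tx], of h x] by simp
  ultimately show ?thesis by (simp add: has_field_derivative_def)
qed

end

interpretation whole_space: convex_body "UNIV :: 'a::euclidean_space set"
  by unfold_locales auto

interpretation unit_ball: convex_body "cball 0 1 :: 'a::euclidean_space set"
  by unfold_locales (auto simp: interior_cball)

subsection \<open>Harmonic functions on the unit ball\<close>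

abbreviation disc :: "'a::euclidean_space set" where "disc \<equiv> cball 0 1"

lemma scaleR_disc: "x \<in> disc \<Longrightarrow> 0 \<le> t \<Longrightarrow> t \<le> 1 \<Longrightarrow> t *\<^sub>R x \<in> disc"
  by (simp add: mult_le_one)

text \<open>Adding \<open>\<epsilon>\<close> times the squared norm makes the Laplacian strictly
  positive. At an interior maximum some second derivative along a coordinate axis would then be
  positive.\<close>

lemma max_principle:
  fixes q :: "'a::euclidean_space \<Rightarrow> real"
  assumes q: "smooth_in disc q" and harm: "\<And>x. x \<in> disc \<Longrightarrow> lap disc q x = 0"
    and bd: "\<And>x. x \<in> sphere 0 1 \<Longrightarrow> q x \<le> 0" and x0: "x0 \<in> disc"
  shows "q x0 \<le> 0"
proof (rule ccontr)
  assume "\<not> q x0 \<le> 0"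
  then have pos: "q x0 > 0" by simp
  \<comment> \<open>Half of \<open>q x0\<close>, so that on the sphere
    \<open>F \<le> \<epsilon> < q x0 \<le> F x0\<close> and the maximum of \<open>F\<close> lies in
    the interior.\<close>
  define \<epsilon> where "\<epsilon> = q x0 / 2"
  define F where "F x = q x + \<epsilon> * (x \<bullet> x)" for x
  have \<epsilon>: "\<epsilon> > 0" using pos by (simp add: \<epsilon>_def)
  have F: "smooth_in disc F" using q by (simp add: F_def[abs_def])
  have lapF: "lap disc F x = 2 * \<epsilon> * real DIM('a)" if "x \<in> disc" for x
    using q that by (simp add: F_def[abs_def] unit_ball.lap_add unit_ball.lap_cmult harm unit_ball.lap_inner_self)
  obtain y where y: "y \<in> disc" "\<And>x. x \<in> disc \<Longrightarrow> F x \<le> F y"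
    using continuous_attains_sup[OF compact_cball _ smooth_in_continuous_on[OF F]] x0 by blast
  have "F x0 \<ge> q x0" using \<epsilon> by (simp add: F_def)
  then have Fy: "F y \<ge> q x0" using y(2)[OF x0] by simp
  have "norm y \<noteq> 1"
  proof
    assume "norm y = 1"
    then have "F y \<le> \<epsilon>" using bd[of y] by (simp add: F_def dot_square_norm)
    then show False using Fy pos by (simp add: \<epsilon>_def)
  qed
  then have yi: "norm y < 1" using y(1) by simp
  have "0 < lap disc F y" using lapF[OF y(1)] \<epsilon> by simp
  then have "\<not> (\<forall>b\<in>Basis. DV disc b (DV disc b F) y \<le> 0)"
    unfolding lap_def using sum_nonpos[of Basis "\<lambda>b. DV disc b (DV disc b F) y"] by fastforce
  then obtain b :: 'a where b: "b \<in> Basis" "DV disc b (DV disc b F) y > 0" by fastforce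
  have nb: "norm b = 1" using b(1) by simp
  define r where "r = 1 - norm y"
  have r: "r > 0" using yi by (simp add: r_def)
  have int: "y + t *\<^sub>R b \<in> interior disc" if "\<bar>t\<bar> < r" for t
  proof -
    have "norm (y + t *\<^sub>R b) \<le> norm y + \<bar>t\<bar>" using norm_triangle_ineq[of y "t *\<^sub>R b"] nb by simp
    then show ?thesis using that by (simp add: interior_cball r_def)
  qed
  define \<phi> \<psi> where "\<phi> t = F (y + t *\<^sub>R b)" and "\<psi> t = DV disc b F (y + t *\<^sub>R b)" for t :: real
  have d1: "(\<phi> has_real_derivative \<psi> t) (at t)" if "\<bar>t\<bar> < r" for t
    unfolding \<phi>_def[abs_def] \<psi>_def by (intro unit_ball.DERIV_line F int that)
  have d2: "(\<psi> has_real_derivative DV disc b (DV disc b F) (y + 0 *\<^sub>R b)) (at 0)"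
    unfolding \<psi>_def[abs_def] using r by (intro unit_ball.DERIV_line smooth_in_DV F int) simp
  have le: "\<phi> t \<le> \<phi> 0" if "\<bar>t\<bar> < r" for t
    using y(2)[of "y + t *\<^sub>R b"] int[OF that] interior_subset[of disc] by (auto simp: \<phi>_def)
  \<comment> \<open>The slope at the maximum is zero and is increasing there by the choice of
    \<open>b\<close>, so \<open>\<phi>\<close> would grow just to the right of 0.\<close>
  have "\<psi> 0 = 0"
    using r le by (intro DERIV_local_max[OF d1 r]) auto
  moreover obtain d where d: "d > 0" "\<And>h. h > 0 \<Longrightarrow> h < d \<Longrightarrow> \<psi> 0 < \<psi> h"
    using DERIV_pos_inc_right[OF d2] b(2) by auto
  define h where "h = min r d / 2"
  have h: "0 < h" "h < r" "h < d" using r d by (auto simp: h_def)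
  have "\<exists>z. 0 < z \<and> z < h \<and> \<phi> h - \<phi> 0 = (h - 0) * \<psi> z"
    using h by (intro MVT2 d1) auto
  then obtain z where "0 < z" "z < h" "\<phi> h - \<phi> 0 = h * \<psi> z" by auto
  moreover have "\<psi> z > 0" using d(2)[of z] calculation h by simp
  ultimately have "\<phi> h - \<phi> 0 > 0" using h by simp
  with le[of h] h show False by simp
qed

lemma harmonic_unique:
  fixes p q :: "'a::euclidean_space \<Rightarrow> real"
  assumes p: "smooth_in disc p" "\<And>x. x \<in> disc \<Longrightarrow> lap disc p x = 0"
    and q: "smooth_in disc q" "\<And>x. x \<in> disc \<Longrightarrow> lap disc q x = 0"
    and bd: "\<And>x. x \<in> sphere 0 1 \<Longrightarrow> p x = q x" and x: "x \<in> disc"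
  shows "p x = q x"
proof -
  have "f x - g x \<le> 0"
    if "smooth_in disc f" "smooth_in disc g" "\<And>y. y \<in> disc \<Longrightarrow> lap disc f y = 0"
      "\<And>y. y \<in> disc \<Longrightarrow> lap disc g y = 0" "\<And>y. y \<in> sphere 0 1 \<Longrightarrow> f y = g y"
    for f g :: "'a \<Rightarrow> real"
  proof (rule max_principle[where q = "\<lambda>x. f x - g x"])
    show "lap disc (\<lambda>x. f x - g x) y = 0" if "y \<in> disc" for y
      using unit_ball.lap_diff[OF \<open>smooth_in disc f\<close> \<open>smooth_in disc g\<close> that] that
        \<open>\<And>y. y \<in> disc \<Longrightarrow> lap disc f y = 0\<close> \<open>\<And>y. y \<in> disc \<Longrightarrow> lap disc g y = 0\<close> by simp
  qed (use that x in auto)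
  from this[of p q] this[of q p] show ?thesis using p q bd by fastforce
qed

text \<open>
  With \<open>R\<close> the radial derivative, \<open>ray_integral m\<close> inverts \<open>m + 1 + 2 R\<close>; the substitution \<open>t = s\<^sup>2\<close>
  makes the weight a polynomial for all \<open>m\<close>.
\<close>

definition ray_integral :: "nat \<Rightarrow> ('a::euclidean_space \<Rightarrow> real) \<Rightarrow> 'a \<Rightarrow> real" where
  "ray_integral m g x = integral {0..1} (\<lambda>s. s ^ m * g (s\<^sup>2 *\<^sub>R x))"

lemma square_scaleR_disc: "x \<in> disc \<Longrightarrow> s \<in> {0..1} \<Longrightarrow> s\<^sup>2 *\<^sub>R x \<in> disc"
  by (intro scaleR_disc) (auto simp: power_le_one)

lemma continuous_on_ray_integrand:
  assumes "smooth_in disc g" "x \<in> disc"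
  shows "continuous_on {0..1} (\<lambda>s. s ^ m * g (s\<^sup>2 *\<^sub>R x))"
  using square_scaleR_disc[OF assms(2)]
  by (intro continuous_intros continuous_on_compose2[OF smooth_in_continuous_on[OF assms(1)]]) auto

text \<open>Differentiation under the integral sign, valid up to the boundary since the ball is
  convex and shrinks into itself. The inner factor \<open>s\<^sup>2\<close> of the chain rule raises
  the weight from \<open>m\<close> to \<open>m + 2\<close>.\<close>

lemma ray_integral_has_derivative:
  fixes g :: "'a::euclidean_space \<Rightarrow> real"
  assumes g: "smooth_in disc g" and x0: "x0 \<in> disc"
  shows "(ray_integral m g has_derivative (\<lambda>v. ray_integral (m + 2) (DV disc v g) x0)) (at x0 within disc)"
proof -
  \<comment> \<open>The derivative of the integrand as a bounded linear map, the form in which the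
    parameter-integral rule takes it.\<close>
  define fx where "fx x s = Blinfun (\<lambda>v. s ^ (m + 2) * DV disc v g (s\<^sup>2 *\<^sub>R x))" for x and s :: real
  have fx: "blinfun_apply (fx x s) = (\<lambda>v. s ^ (m + 2) * DV disc v g (s\<^sup>2 *\<^sub>R x))"
    if "x \<in> disc" "s \<in> {0..1}" for x s
  proof -
    have "linear (\<lambda>v. DV disc v g (s\<^sup>2 *\<^sub>R x))" by (intro linear_DV g square_scaleR_disc that)
    then have "bounded_linear (\<lambda>v. s ^ (m + 2) * DV disc v g (s\<^sup>2 *\<^sub>R x))"
      by (intro bounded_linear_intros linear_conv_bounded_linear[THEN iffD1])
    then show ?thesis unfolding fx_def by (rule bounded_linear_Blinfun_apply)
  qed
  have der: "((\<lambda>x. s ^ m * g (s\<^sup>2 *\<^sub>R x)) has_derivative blinfun_apply (fx x s)) (at x within disc)"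
    if x: "x \<in> disc" and s: "s \<in> cbox 0 1" for x s
  proof -
    have s': "s \<in> {0..1}" using s by simp
    have "(\<lambda>x. s\<^sup>2 *\<^sub>R x) ` disc \<subseteq> (disc :: 'a set)" using square_scaleR_disc[OF _ s'] by auto
    then have "(g has_derivative (\<lambda>v. DV disc v g (s\<^sup>2 *\<^sub>R x))) (at (s\<^sup>2 *\<^sub>R x) within (\<lambda>x. s\<^sup>2 *\<^sub>R x) ` disc)"
      using smooth_in_has_derivative[OF g square_scaleR_disc[OF x s']] by (rule has_derivative_subset[rotated])
    moreover have "((\<lambda>x. s\<^sup>2 *\<^sub>R x) has_derivative (\<lambda>v. s\<^sup>2 *\<^sub>R v)) (at x within disc)"
      by (auto intro!: derivative_eq_intros)
    ultimately have "((\<lambda>x. g (s\<^sup>2 *\<^sub>R x)) has_derivative (\<lambda>v. DV disc (s\<^sup>2 *\<^sub>R v) g (s\<^sup>2 *\<^sub>R x))) (at x within disc)"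
      by (rule has_derivative_in_compose[rotated])
    then have "((\<lambda>x. s ^ m * g (s\<^sup>2 *\<^sub>R x)) has_derivative (\<lambda>v. s ^ m * DV disc (s\<^sup>2 *\<^sub>R v) g (s\<^sup>2 *\<^sub>R x))) (at x within disc)"
      by (rule has_derivative_mult_right)
    moreover have "s ^ m * DV disc (s\<^sup>2 *\<^sub>R v) g (s\<^sup>2 *\<^sub>R x) = blinfun_apply (fx x s) v" for v
      using linear_cmul[OF linear_DV[OF g square_scaleR_disc[OF x s']], of "s\<^sup>2" v]
      by (simp add: fx[OF x s'] power_add power2_eq_square)
    ultimately show ?thesis by simp
  qed
  have cont: "continuous_on (disc \<times> cbox 0 1) (\<lambda>(x, s). fx x s)"
  proof (rule continuous_on_blinfun_componentwise)
    fix b :: 'a assume "b \<in> Basis"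
    have sub: "(\<lambda>p. (snd p)\<^sup>2 *\<^sub>R fst p) ` (disc \<times> cbox 0 1) \<subseteq> (disc :: 'a set)"
    proof clarify
      fix x :: 'a and s :: real assume "x \<in> disc" "s \<in> cbox 0 1"
      then show "(snd (x, s))\<^sup>2 *\<^sub>R fst (x, s) \<in> disc"
        using square_scaleR_disc[of x s] by simp
    qed
    have "continuous_on (disc \<times> cbox 0 1) (\<lambda>p. snd p ^ (m + 2) * DV disc b g ((snd p)\<^sup>2 *\<^sub>R fst p))"
      by (intro continuous_intros
          continuous_on_compose2[OF smooth_in_continuous_on[OF smooth_in_DV[OF g]] _ sub])
    then show "continuous_on (disc \<times> cbox 0 1) (\<lambda>p. blinfun_apply (case p of (x, s) \<Rightarrow> fx x s) b)"
      by (rule continuous_on_eq) (auto simp: fx)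
  qed
  have "((\<lambda>x. integral (cbox 0 1) (\<lambda>s. s ^ m * g (s\<^sup>2 *\<^sub>R x))) has_derivative
      blinfun_apply (integral (cbox 0 1) (fx x0))) (at x0 within disc)"
    using continuous_on_ray_integrand[OF g, of _ m]
    by (intro leibniz_rule[where fx=fx] der cont x0 convex_cball)
      (auto intro: integrable_continuous_interval simp del: power_Suc)
  moreover have "blinfun_apply (integral (cbox 0 1) (fx x0)) = (\<lambda>v. ray_integral (m + 2) (DV disc v g) x0)"
  proof
    fix v
    have "continuous_on (cbox 0 1) ((\<lambda>(x, s). fx x s) \<circ> (\<lambda>s. (x0, s)))"
      using x0 by (intro continuous_on_compose continuous_intros continuous_on_subset[OF cont]) auto
    then have "fx x0 integrable_on cbox 0 1"
      by (intro integrable_continuous) (simp add: o_def)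
    then have "blinfun_apply (integral (cbox 0 1) (fx x0)) v = integral (cbox 0 1) (\<lambda>s. blinfun_apply (fx x0 s) v)"
      by (rule blinfun_apply_integral)
    also have "\<dots> = integral {0..1} (\<lambda>s. s ^ (m + 2) * DV disc v g (s\<^sup>2 *\<^sub>R x0))"
      by (simp only: box_real, intro integral_cong) (simp add: fx[OF x0])
    finally show "blinfun_apply (integral (cbox 0 1) (fx x0)) v = ray_integral (m + 2) (DV disc v g) x0"
      by (simp only: ray_integral_def)
  qed
  ultimately show ?thesis by (simp only: ray_integral_def[abs_def] box_real)
qed

lemma DV_ray_integral:
  "smooth_in disc g \<Longrightarrow> x \<in> disc \<Longrightarrow> DV disc v (ray_integral m g) x = ray_integral (m + 2) (DV disc v g) x"
  by (rule unit_ball.DV_eqI[OF ray_integral_has_derivative])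

lemma smooth_in_ray_integral: "smooth_in disc g \<Longrightarrow> smooth_in disc (ray_integral m g)"
proof -
  have "C_in k disc (ray_integral m g)" if "smooth_in disc g" for k
    using that
  proof (induction k arbitrary: m g)
    case 0
    show ?case
      unfolding C_in.simps(1)
      by (rule has_derivative_continuous_on[OF ray_integral_has_derivative[OF 0]])
  next
    case (Suc k)
    have "ray_integral m g differentiable (at x within disc)" if "x \<in> disc" for x
      by (rule Derivative.differentiableI[OF ray_integral_has_derivative[OF Suc.prems that]])
    moreover have "C_in k disc (DV disc v (ray_integral m g)) \<longleftrightarrow> C_in k disc (ray_integral (m + 2) (DV disc v g))" for v
      by (rule C_in_cong) (rule DV_ray_integral[OF Suc.prems])
    moreover have "C_in k disc (ray_integral (m + 2) (DV disc v g))" for v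
      by (rule Suc.IH) (rule smooth_in_DV[OF Suc.prems])
    ultimately show ?case by (subst C_in.simps(2)) blast
  qed
  then show "smooth_in disc g \<Longrightarrow> smooth_in disc (ray_integral m g)" by (simp add: smooth_in_def)
qed

lemma ray_integral_sum:
  assumes "finite I" "\<And>i. i \<in> I \<Longrightarrow> smooth_in disc (g i)" "x \<in> disc"
  shows "ray_integral m (\<lambda>x. \<Sum>i\<in>I. g i x) x = (\<Sum>i\<in>I. ray_integral m (g i) x)"
  unfolding ray_integral_def sum_distrib_left
  using assms by (intro integral_sum integrable_continuous_interval continuous_on_ray_integrand)

lemma ray_integral_zero:
  assumes "\<And>x. x \<in> disc \<Longrightarrow> g x = 0" "x \<in> disc"
  shows "ray_integral m g x = 0"
proof -
  have "ray_integral m g x = integral {0..1} (\<lambda>s::real. 0)"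
    unfolding ray_integral_def
  proof (rule integral_cong)
    show "s ^ m * g (s\<^sup>2 *\<^sub>R x) = 0" if "s \<in> {0..1}" for s
      using assms(1)[OF square_scaleR_disc[OF assms(2) that]] by simp
  qed
  then show ?thesis by simp
qed

text \<open>Each of the two derivatives raises the weight by 2. In particular the ray integral of a
  harmonic function is harmonic.\<close>

lemma lap_ray_integral:
  assumes g: "smooth_in disc g" and x: "x \<in> disc"
  shows "lap disc (ray_integral m g) x = ray_integral (m + 2 + 2) (lap disc g) x"
proof -
  have "DV disc b (DV disc b (ray_integral m g)) x = ray_integral (m + 2 + 2) (DV disc b (DV disc b g)) x" for b
  proof -
    have "DV disc b (DV disc b (ray_integral m g)) x = DV disc b (ray_integral (m + 2) (DV disc b g)) x"
      using g x by (intro DV_cong DV_ray_integral)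
    also have "\<dots> = ray_integral (m + 2 + 2) (DV disc b (DV disc b g)) x"
      by (rule DV_ray_integral[OF smooth_in_DV[OF g] x])
    finally show ?thesis .
  qed
  then show ?thesis
    using g x by (simp add: lap_def[abs_def] ray_integral_sum smooth_in_DV)
qed

lemma ray_integral_inverse:
  assumes g: "smooth_in disc g" and x: "x \<in> disc"
  shows "(real m + 1) * ray_integral m g x + 2 * radial disc (ray_integral m g) x = g x"
proof -
  \<comment> \<open>The fundamental theorem of calculus is applied to this primitive: it is
    \<open>g x\<close> at \<open>s = 1\<close>, and the factor \<open>s ^ (m + 1)\<close> makes it 0
    at \<open>s = 0\<close>.\<close>
  let ?f = "\<lambda>s. s ^ (m + 1) * g (s\<^sup>2 *\<^sub>R x)"
  let ?f' = "\<lambda>s. (real m + 1) * (s ^ m * g (s\<^sup>2 *\<^sub>R x)) + 2 * (s ^ (m + 2) * DV disc x g (s\<^sup>2 *\<^sub>R x))"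
  have "(?f has_vector_derivative ?f' s) (at s within {0..1})" if s: "s \<in> {0..1}" for s
  proof -
    have s2: "s\<^sup>2 \<in> {0..1}" "(\<lambda>s. s\<^sup>2) ` {0..1} \<subseteq> {0..1::real}" using s by (auto simp: power_le_one)
    have "((\<lambda>t. g (t *\<^sub>R x)) has_real_derivative DV disc x g (s\<^sup>2 *\<^sub>R x)) (at (s\<^sup>2) within (\<lambda>s. s\<^sup>2) ` {0..1})"
      using s2 x by (intro DERIV_subset[OF unit_ball.DERIV_ray[OF g]]) auto
    moreover have "((\<lambda>s. s\<^sup>2) has_real_derivative 2 * s) (at s within {0..1})"
      by (auto intro!: derivative_eq_intros)
    ultimately have "((\<lambda>t. g (t *\<^sub>R x)) \<circ> (\<lambda>s. s\<^sup>2) has_real_derivative DV disc x g (s\<^sup>2 *\<^sub>R x) * (2 * s)) (at s within {0..1})"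
      by (rule DERIV_image_chain)
    then have "((\<lambda>s. g (s\<^sup>2 *\<^sub>R x)) has_real_derivative DV disc x g (s\<^sup>2 *\<^sub>R x) * (2 * s)) (at s within {0..1})"
      by (simp add: o_def)
    moreover have "((\<lambda>s. s ^ (m + 1)) has_real_derivative (real m + 1) * s ^ m) (at s within {0..1})"
      using DERIV_pow[of "m + 1" s "{0..1}"] by (simp add: add.commute)
    ultimately have "(?f has_real_derivative s ^ (m + 1) * (DV disc x g (s\<^sup>2 *\<^sub>R x) * (2 * s)) + (real m + 1) * s ^ m * g (s\<^sup>2 *\<^sub>R x)) (at s within {0..1})"
      by (rule DERIV_mult'[rotated])
    then show ?thesis
      by (simp add: has_real_derivative_iff_has_vector_derivative algebra_simps power2_eq_square)
  qed
  then have "(?f' has_integral (?f 1 - ?f 0)) {0..1}"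
    by (intro fundamental_theorem_of_calculus) auto
  then have "integral {0..1} ?f' = g x" by (simp add: integral_unique)
  moreover have "integral {0..1} ?f' = (real m + 1) * ray_integral m g x + 2 * ray_integral (m + 2) (DV disc x g) x"
  proof -
    note int = integrable_continuous_interval[OF continuous_on_ray_integrand[OF g x]]
      integrable_continuous_interval[OF continuous_on_ray_integrand[OF smooth_in_DV[OF g] x]]
    show ?thesis
      unfolding ray_integral_def
      by (subst integral_add) (intro integrable_on_mult_right int, intro integrable_on_mult_right int, simp)
  qed
  ultimately show ?thesis by (simp add: radial_def DV_ray_integral[OF g x])
qed

section \<open>Linear systems for the radial derivative\<close>

lemma radial_system_negative:
  fixes g h :: "'a::euclidean_space \<Rightarrow> real"
  assumes g: "smooth_in disc g" and h: "smooth_in disc h"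
    and rg: "\<And>x. x \<in> disc \<Longrightarrow> radial disc g x = a * g x + b * h x"
    and rh: "\<And>x. x \<in> disc \<Longrightarrow> radial disc h x = c * g x + d * h x"
    and neg: "a + 1 + \<bar>b\<bar> + \<bar>c\<bar> \<le> 0" "d + 1 + \<bar>b\<bar> + \<bar>c\<bar> \<le> 0" and x: "x \<in> disc"
  shows "g x = 0 \<and> h x = 0"
proof -
  \<comment> \<open>The hypothesis \<open>neg\<close> is diagonal dominance: the mixed terms are at
    most \<open>\<bar>b\<bar> + \<bar>c\<bar>\<close> times the square sum, which leaves a margin of
    1 on the diagonal.\<close>
  have form: "X * (a * X + b * Y) + Y * (c * X + d * Y) \<le> - (X\<^sup>2 + Y\<^sup>2)" for X Y
  proof -
    have "2 * (\<bar>X\<bar> * \<bar>Y\<bar>) \<le> X\<^sup>2 + Y\<^sup>2"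
      using zero_le_power2[of "\<bar>X\<bar> - \<bar>Y\<bar>"] by (simp add: power2_diff)
    moreover have "(b + c) * (X * Y) \<le> (\<bar>b\<bar> + \<bar>c\<bar>) * (\<bar>X\<bar> * \<bar>Y\<bar>)"
    proof -
      have "(b + c) * (X * Y) \<le> \<bar>b + c\<bar> * \<bar>X * Y\<bar>" by (metis abs_ge_self abs_mult)
      also have "\<dots> \<le> (\<bar>b\<bar> + \<bar>c\<bar>) * \<bar>X * Y\<bar>" by (intro mult_right_mono abs_triangle_ineq) simp
      finally show ?thesis by (simp add: abs_mult)
    qed
    moreover have "(\<bar>b\<bar> + \<bar>c\<bar>) * (\<bar>X\<bar> * \<bar>Y\<bar>) \<le> (\<bar>b\<bar> + \<bar>c\<bar>) * (X\<^sup>2 + Y\<^sup>2)"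
      using calculation(1) by (intro mult_left_mono) (smt (verit) mult_nonneg_nonneg abs_ge_zero, simp)
    moreover have "a * X\<^sup>2 \<le> (- 1 - \<bar>b\<bar> - \<bar>c\<bar>) * X\<^sup>2" "d * Y\<^sup>2 \<le> (- 1 - \<bar>b\<bar> - \<bar>c\<bar>) * Y\<^sup>2"
      using neg by (auto intro!: mult_right_mono)
    ultimately show ?thesis by (simp add: algebra_simps power2_eq_square)
  qed
  define N where "N t = (g (t *\<^sub>R x))\<^sup>2 + (h (t *\<^sub>R x))\<^sup>2" for t
  define N' where "N' t = 2 * (g (t *\<^sub>R x) * DV disc x g (t *\<^sub>R x) + h (t *\<^sub>R x) * DV disc x h (t *\<^sub>R x))" for t
  have der: "(N has_real_derivative N' t) (at t within {0..1})" if "0 \<le> t" "t \<le> 1" for t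
    unfolding N_def[abs_def] N'_def using that x
    by (auto intro!: derivative_eq_intros unit_ball.DERIV_ray g h)
  have scale: "radial disc f (t *\<^sub>R x) = t * DV disc x f (t *\<^sub>R x)"
    if "smooth_in disc f" "0 \<le> t" "t \<le> 1" for f t
    using linear_cmul[OF linear_DV[OF that(1) scaleR_disc[OF x that(2,3)]]] by (simp add: radial_def)
  \<comment> \<open>The system controls the radial derivative at \<open>t x\<close>, which is
    \<open>t\<close> times the derivative along the ray. The sign of \<open>N'\<close> is therefore
    known only for \<open>t > 0\<close>, where the mean value theorem uses it.\<close>
  have tN': "t * N' t \<le> 0" if t: "0 \<le> t" "t \<le> 1" for t
  proof -
    let ?g = "g (t *\<^sub>R x)" and ?h = "h (t *\<^sub>R x)"
    have "t * N' t = 2 * (?g * (a * ?g + b * ?h) + ?h * (c * ?g + d * ?h))"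
      using scale[OF g t] scale[OF h t] rg[OF scaleR_disc[OF x t]] rh[OF scaleR_disc[OF x t]]
      by (simp add: N'_def algebra_simps)
    also have "\<dots> \<le> 2 * (- (?g\<^sup>2 + ?h\<^sup>2))" by (intro mult_left_mono form) simp
    also have "\<dots> \<le> 0" by simp
    finally show ?thesis .
  qed
  have "N 1 \<le> N 0"
  proof -
    have "continuous_on {0..1} N"
      using der by (intro DERIV_continuous_on) auto
    moreover have "(N has_derivative (\<lambda>h. N' t * h)) (at t)" if "0 < t" "t < 1" for t
      using der[of t] that at_within_Icc_at[of 0 t 1] by (simp add: has_field_derivative_def)
    ultimately obtain z where z: "0 < z" "z < 1" "N 1 - N 0 = N' z * (1 - 0)"
      using mvt[of 0 1 N "\<lambda>t h. N' t * h"] by auto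
    then show ?thesis using tN'[of z] by (auto simp: mult_le_0_iff)
  qed
  moreover have "N 0 = 0"
  proof -
    \<comment> \<open>At the origin the radial derivatives vanish, so \<open>form\<close> bounds the
      square sum there by 0.\<close>
    have "radial disc g 0 = 0" "radial disc h 0 = 0"
      using unit_ball.radial_zero[OF g] unit_ball.radial_zero[OF h] by simp_all
    then have "(g 0)\<^sup>2 + (h 0)\<^sup>2 \<le> 0"
      using form[of "g 0" "h 0"] rg[of 0] rh[of 0] by simp
    then show ?thesis unfolding N_def by (smt (verit) scaleR_zero_left zero_le_power2)
  qed
  ultimately have "(g x)\<^sup>2 + (h x)\<^sup>2 \<le> 0" by (simp add: N_def)
  then show ?thesis by (simp add: sum_power2_le_zero_iff)
qed

text \<open>By the commutator in \<open>DV_radial\<close> only the diagonal coefficient drops by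
  one. Exchanging the roles of \<open>g\<close> and \<open>h\<close> gives the other row.\<close>

lemma radial_system_DV:
  assumes g: "smooth_in disc g" and h: "smooth_in disc h"
    and rg: "\<And>x. x \<in> disc \<Longrightarrow> radial disc g x = a * g x + b * h x" and x: "x \<in> disc"
  shows "radial disc (DV disc v g) x = (a - 1) * DV disc v g x + b * DV disc v h x"
proof -
  have "DV disc v (radial disc g) x = DV disc v (\<lambda>x. a * g x + b * h x) x"
    using x rg by (intro DV_cong) auto
  then show ?thesis
    using g h x by (simp add: unit_ball.DV_radial unit_ball.DV_add unit_ball.DV_cmult algebra_simps)
qed

text \<open>The determinants are those of the matrices met after \<open>i\<close> differentiations.\<close>

lemma radial_system_trivial:
  fixes g h :: "'a::euclidean_space \<Rightarrow> real"
  assumes g: "smooth_in disc g" and h: "smooth_in disc h"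
    and rg: "\<And>x. x \<in> disc \<Longrightarrow> radial disc g x = a * g x + b * h x"
    and rh: "\<And>x. x \<in> disc \<Longrightarrow> radial disc h x = c * g x + d * h x"
    and det: "\<And>i::nat. (a - i) * (d - i) - b * c \<noteq> 0" and x: "x \<in> disc"
  shows "g x = 0 \<and> h x = 0"
proof -
  \<comment> \<open>The number of differentiations after which the lowered matrix satisfies the
    dominance condition of \<open>radial_system_negative\<close>.\<close>
  obtain m :: nat where "\<bar>a\<bar> + \<bar>d\<bar> + 1 + \<bar>b\<bar> + \<bar>c\<bar> \<le> m" by (meson real_arch_simple)
  then have "a - m + 1 + \<bar>b\<bar> + \<bar>c\<bar> \<le> 0" "d - m + 1 + \<bar>b\<bar> + \<bar>c\<bar> \<le> 0" by linarith+
  then show ?thesis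
    using g h rg rh det x
  proof (induction m arbitrary: a d g h x)
    case 0
    then show ?case by (intro radial_system_negative[of g h a b c d]) simp_all
  next
    case (Suc m)
    have "DV disc v g y = 0 \<and> DV disc v h y = 0" if y: "y \<in> disc" for v y
    proof (rule Suc.IH[of "a - 1" "d - 1"])
      show "a - 1 - real m + 1 + \<bar>b\<bar> + \<bar>c\<bar> \<le> 0" "d - 1 - real m + 1 + \<bar>b\<bar> + \<bar>c\<bar> \<le> 0"
        using Suc.prems(1,2) by auto
      show "radial disc (DV disc v g) x = (a - 1) * DV disc v g x + b * DV disc v h x" if "x \<in> disc" for x
        using Suc.prems that by (intro radial_system_DV)
      show "radial disc (DV disc v h) x = c * DV disc v g x + (d - 1) * DV disc v h x" if "x \<in> disc" for x
        using radial_system_DV[of h g d c x v] Suc.prems that by (simp add: add.commute)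
      show "(a - 1 - real i) * (d - 1 - real i) - b * c \<noteq> 0" for i
        using Suc.prems(7)[of "Suc i"] by (simp add: algebra_simps)
    qed (use Suc.prems y in \<open>auto intro: smooth_in_DV\<close>)
    then have "radial disc g x = 0" "radial disc h x = 0"
      using Suc.prems(8) by (auto simp: radial_def)
    then have e: "a * g x + b * h x = 0" "c * g x + d * h x = 0"
      using Suc.prems(5,6,8) by auto
    \<comment> \<open>Cramer's rule: the derivatives vanish, hence so do the radial derivatives, and
      the matrix itself is invertible by \<open>det\<close> at \<open>i = 0\<close>.\<close>
    have "(a * d - b * c) * g x = d * (a * g x + b * h x) - b * (c * g x + d * h x)"
      "(a * d - b * c) * h x = a * (c * g x + d * h x) - c * (a * g x + b * h x)"
      by (simp_all add: algebra_simps)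
    then show ?case using e Suc.prems(7)[of 0] by simp
  qed
qed

text \<open>Only the degree \<open>k\<close> may be singular. For \<open>k = 0\<close> the
  derivatives solve a system without singular degree, so they vanish and both functions have degree
  0. Otherwise the derivatives solve a system with exceptional degree \<open>k - 1\<close>, and
  their homogeneity lifts back because both functions vanish at the origin.\<close>

lemma radial_system_homogeneous:
  fixes g h :: "'a::euclidean_space \<Rightarrow> real" and a b c d :: real and k :: nat
  assumes g: "smooth_in disc g" and h: "smooth_in disc h"
    and rg: "\<And>x. x \<in> disc \<Longrightarrow> radial disc g x = a * g x + b * h x"
    and rh: "\<And>x. x \<in> disc \<Longrightarrow> radial disc h x = c * g x + d * h x"
    and det: "\<And>i::nat. i \<noteq> k \<Longrightarrow> (a - i) * (d - i) - b * c \<noteq> 0" and x: "x \<in> disc"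
  shows "radial disc g x = k * g x \<and> radial disc h x = k * h x"
  using assms
proof (induction k arbitrary: a d g h x)
  case (0 a d g h x)
  have "DV disc v g y = 0 \<and> DV disc v h y = 0" if y: "y \<in> disc" for v y
  proof (rule radial_system_trivial[of "DV disc v g" "DV disc v h" "a - 1" b c "d - 1"])
    show "radial disc (DV disc v g) x = (a - 1) * DV disc v g x + b * DV disc v h x" if "x \<in> disc" for x
      using 0 that by (intro radial_system_DV)
    show "radial disc (DV disc v h) x = c * DV disc v g x + (d - 1) * DV disc v h x" if "x \<in> disc" for x
      using radial_system_DV[of h g d c x v] 0 that by (simp add: add.commute)
    show "(a - 1 - real i) * (d - 1 - real i) - b * c \<noteq> 0" for i
      using 0(5)[of "Suc i"] by (simp add: algebra_simps)
  qed (use 0 y in \<open>auto intro: smooth_in_DV\<close>)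
  then show ?case using 0(6) by (auto simp: radial_def)
next
  case (Suc k a d g h x)
  have hom: "radial disc (DV disc v g) y = k * DV disc v g y \<and> radial disc (DV disc v h) y = k * DV disc v h y"
    if y: "y \<in> disc" for v y
  proof (rule Suc.IH[of "DV disc v g" "DV disc v h" "a - 1" "d - 1"])
    show "radial disc (DV disc v g) x = (a - 1) * DV disc v g x + b * DV disc v h x" if "x \<in> disc" for x
      using Suc.prems that by (intro radial_system_DV)
    show "radial disc (DV disc v h) x = c * DV disc v g x + (d - 1) * DV disc v h x" if "x \<in> disc" for x
      using radial_system_DV[of h g d c x v] Suc.prems that by (simp add: add.commute)
    show "(a - 1 - real i) * (d - 1 - real i) - b * c \<noteq> 0" if "i \<noteq> k" for i
      using Suc.prems(5)[of "Suc i"] that by (simp add: algebra_simps)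
  qed (use Suc.prems y in \<open>auto intro: smooth_in_DV\<close>)
  \<comment> \<open>Degree 0 differs from the exceptional degree \<open>Suc k\<close>, so the matrix
    is invertible and the values at the origin are 0.\<close>
  have e: "a * g 0 + b * h 0 = 0" "c * g 0 + d * h 0 = 0"
    using Suc.prems(3,4)[of 0] unit_ball.radial_zero[OF Suc.prems(1)] unit_ball.radial_zero[OF Suc.prems(2)] by auto
  have "(a * d - b * c) * g 0 = d * (a * g 0 + b * h 0) - b * (c * g 0 + d * h 0)"
    "(a * d - b * c) * h 0 = a * (c * g 0 + d * h 0) - c * (a * g 0 + b * h 0)"
    by (simp_all add: algebra_simps)
  then have z: "g 0 = 0" "h 0 = 0" using e Suc.prems(5)[of 0] by simp_all
  show ?case
    using unit_ball.radial_homogeneous_if_DV[OF Suc.prems(1) z(1) _ Suc.prems(6)]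
      unit_ball.radial_homogeneous_if_DV[OF Suc.prems(2) z(2) _ Suc.prems(6)] hom by simp
qed

subsection \<open>Homogeneous polynomials\<close>

definition exponents :: "nat \<Rightarrow> ('a::euclidean_space \<Rightarrow> nat) set" where
  "exponents k = {e \<in> Basis \<rightarrow>\<^sub>E {..k}. sum e Basis = k}"

definition monomial_fun :: "('a::euclidean_space \<Rightarrow> nat) \<Rightarrow> 'a \<Rightarrow> real" where
  "monomial_fun e x = (\<Prod>b\<in>Basis. (x \<bullet> b) ^ e b)"

lemma homogeneous_polynomial_alt:
  "homogeneous_polynomial k f \<longleftrightarrow> (\<exists>c. \<forall>x. f x = (\<Sum>e\<in>exponents k. c e * monomial_fun e x))"
  by (simp add: homogeneous_polynomial_def exponents_def monomial_fun_def)

lemma exponents_iff: "e \<in> exponents k \<longleftrightarrow> e \<in> extensional Basis \<and> sum e Basis = k"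
proof -
  have "e b \<le> sum e Basis" if "b \<in> Basis" for b
    using that by (intro member_le_sum) auto
  then show ?thesis by (auto simp: exponents_def PiE_iff)
qed

lemma finite_exponents [simp]: "finite (exponents k)"
  unfolding exponents_def by (rule finite_subset[of _ "Basis \<rightarrow>\<^sub>E {..k}"]) (auto intro: finite_PiE)

lemma homogeneous_polynomial_add:
  assumes "homogeneous_polynomial k f" "homogeneous_polynomial k g"
  shows "homogeneous_polynomial k (\<lambda>x. f x + g x)"
proof -
  from assms obtain c d where "\<And>x. f x = (\<Sum>e\<in>exponents k. c e * monomial_fun e x)"
    "\<And>x. g x = (\<Sum>e\<in>exponents k. d e * monomial_fun e x)"
    unfolding homogeneous_polynomial_alt by blast
  then show ?thesis
    unfolding homogeneous_polynomial_alt
    by (intro exI[of _ "\<lambda>e. c e + d e"]) (simp add: sum.distrib algebra_simps)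
qed

lemma homogeneous_polynomial_cmult:
  assumes "homogeneous_polynomial k f"
  shows "homogeneous_polynomial k (\<lambda>x. a * f x)"
proof -
  from assms obtain c where "\<And>x. f x = (\<Sum>e\<in>exponents k. c e * monomial_fun e x)"
    unfolding homogeneous_polynomial_alt by blast
  then show ?thesis
    unfolding homogeneous_polynomial_alt
    by (intro exI[of _ "\<lambda>e. a * c e"]) (simp add: sum_distrib_left algebra_simps)
qed

lemma homogeneous_polynomial_diff:
  "homogeneous_polynomial k f \<Longrightarrow> homogeneous_polynomial k g \<Longrightarrow> homogeneous_polynomial k (\<lambda>x. f x - g x)"
  using homogeneous_polynomial_add[of k f "\<lambda>x. (-1) * g x"] homogeneous_polynomial_cmult[of k g "-1"] by simp

lemma homogeneous_polynomial_zero: "homogeneous_polynomial k (\<lambda>x. 0)"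
  unfolding homogeneous_polynomial_alt by (intro exI[of _ "\<lambda>e. 0"]) simp

lemma homogeneous_polynomial_sum:
  "(\<And>i. i \<in> I \<Longrightarrow> homogeneous_polynomial k (f i)) \<Longrightarrow> homogeneous_polynomial k (\<lambda>x. \<Sum>i\<in>I. f i x)"
  by (induction I rule: infinite_finite_induct)
    (simp_all add: homogeneous_polynomial_zero homogeneous_polynomial_add)

lemma homogeneous_polynomial_const: "homogeneous_polynomial 0 (\<lambda>x::'a::euclidean_space. a)"
proof -
  have "exponents 0 = {restrict (\<lambda>_. 0) (Basis :: 'a set)}"
  proof (rule set_eqI)
    fix e :: "'a \<Rightarrow> nat"
    have "e \<in> exponents 0 \<longleftrightarrow> e \<in> extensional Basis \<and> (\<forall>b\<in>Basis. e b = 0)"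
      by (simp add: exponents_iff)
    also have "\<dots> \<longleftrightarrow> e = restrict (\<lambda>_. 0) Basis"
      by (auto simp: extensional_def fun_eq_iff restrict_def)
    finally show "e \<in> exponents 0 \<longleftrightarrow> e \<in> {restrict (\<lambda>_. 0) Basis}" by simp
  qed
  then show ?thesis
    unfolding homogeneous_polynomial_alt by (intro exI[of _ "\<lambda>e. a"]) (simp add: monomial_fun_def)
qed

text \<open>Raising the exponent at \<open>b\<close> is a bijection from the exponents of degree
  \<open>k\<close> onto those of degree \<open>k + 1\<close> that are positive at
  \<open>b\<close>.\<close>

lemma homogeneous_polynomial_inner_mult:
  fixes f :: "'a::euclidean_space \<Rightarrow> real"
  assumes "homogeneous_polynomial k f" and b: "b \<in> Basis"
  shows "homogeneous_polynomial (Suc k) (\<lambda>x. (x \<bullet> b) * f x)"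
proof -
  from assms obtain c where c: "\<And>x. f x = (\<Sum>e\<in>exponents k. c e * monomial_fun e x)"
    unfolding homogeneous_polynomial_alt by blast
  define up where "up e = e(b := Suc (e b))" for e :: "'a \<Rightarrow> nat"
  define down where "down e = e(b := e b - 1)" for e :: "'a \<Rightarrow> nat"
  have sum_upd: "sum (e(b := m)) Basis = m + sum e (Basis - {b})" for e :: "'a \<Rightarrow> nat" and m
    using b by (subst sum.remove[of _ b]) auto
  have sum_rem: "sum e Basis = e b + sum e (Basis - {b})" for e :: "'a \<Rightarrow> nat"
    using b by (subst sum.remove[of _ b]) auto
  have ext: "e(b := m) \<in> extensional Basis" if "e \<in> extensional Basis" for e :: "'a \<Rightarrow> nat" and m
    using that b by (auto simp: extensional_def)
  have up: "up e \<in> exponents (Suc k)" if "e \<in> exponents k" for e :: "'a \<Rightarrow> nat"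
    using that by (simp add: exponents_iff up_def ext sum_upd sum_rem[of e] del: fun_upd_apply)
  have down: "down e \<in> exponents k" if "e \<in> exponents (Suc k)" "e b > 0" for e
    using that by (simp add: exponents_iff down_def ext sum_upd sum_rem[of e] del: fun_upd_apply)
  have mono: "monomial_fun (up e) x = (x \<bullet> b) * monomial_fun e x" for e x
  proof -
    have "monomial_fun (up e) x = (x \<bullet> b) ^ Suc (e b) * (\<Prod>b'\<in>Basis - {b}. (x \<bullet> b') ^ e b')"
      unfolding monomial_fun_def using b by (subst prod.remove[of _ b]) (auto simp: up_def)
    also have "\<dots> = (x \<bullet> b) * monomial_fun e x"
      unfolding monomial_fun_def using b by (subst (2) prod.remove[of _ b]) auto
    finally show ?thesis .
  qed
  \<comment> \<open>Monomials without the factor \<open>x \<bullet> b\<close> get coefficient 0;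
    this also keeps \<open>down\<close> away from the truncated \<open>0 - 1\<close>.\<close>
  define d where "d e = (if e b > 0 then c (down e) else 0)" for e
  have "(x \<bullet> b) * f x = (\<Sum>e\<in>exponents (Suc k). d e * monomial_fun e x)" for x
  proof -
    have "(\<Sum>e\<in>exponents (Suc k). d e * monomial_fun e x)
        = (\<Sum>e\<in>{e \<in> exponents (Suc k). e b > 0}. d e * monomial_fun e x)"
      by (intro sum.mono_neutral_right) (auto simp: d_def)
    also have "\<dots> = (\<Sum>e\<in>exponents k. c e * ((x \<bullet> b) * monomial_fun e x))"
    proof (rule sum.reindex_bij_witness[of _ up down])
      fix e assume "e \<in> {e \<in> exponents (Suc k). e b > 0}"
      then have e: "e \<in> exponents (Suc k)" "e b > 0" by auto
      then show ud: "up (down e) = e" by (simp add: up_def down_def fun_eq_iff)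
      show "down e \<in> exponents k" using down e by blast
      show "c (down e) * ((x \<bullet> b) * monomial_fun (down e) x) = d e * monomial_fun e x"
        using mono[of "down e" x] ud e by (simp add: d_def)
    next
      fix e :: "'a \<Rightarrow> nat" assume "e \<in> exponents k"
      then show "up e \<in> {e \<in> exponents (Suc k). e b > 0}" using up by (simp add: up_def)
      show "down (up e) = e" by (simp add: up_def down_def fun_eq_iff)
    qed
    also have "\<dots> = (x \<bullet> b) * f x"
      by (simp add: c sum_distrib_left algebra_simps)
    finally show ?thesis by simp
  qed
  then show ?thesis unfolding homogeneous_polynomial_alt by blast
qed

text \<open>The converse of Euler's theorem, by induction on the degree: the partial derivatives
  satisfy Euler's equation one degree lower, and \<open>f\<close> is recovered as
  \<open>1 / (k + 1)\<close> times the sum of \<open>x_b\<close> times its partial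
  derivatives.\<close>

lemma (in convex_body) Euler_homogeneous_polynomial:
  assumes f: "smooth_in S f" and euler: "\<And>x. x \<in> S \<Longrightarrow> radial S f x = k * f x" and zero: "0 \<in> S"
  shows "\<exists>P. homogeneous_polynomial k P \<and> (\<forall>x\<in>S. f x = P x)"
  using f euler
proof (induction k arbitrary: f)
  case 0
  have "f x = f 0" if x: "x \<in> S" for x
  proof -
    have der: "((\<lambda>t. f (t *\<^sub>R x)) has_real_derivative DV S x f (t *\<^sub>R x)) (at t within {0..1})"
      if "0 \<le> t" "t \<le> 1" for t
      by (rule DERIV_ray[OF 0(1) x zero that])
    have tx: "t *\<^sub>R x \<in> S" if "0 \<le> t" "t \<le> 1" for t
      using convexD[OF convex_S zero x, of "1 - t" t] that by simp
    \<comment> \<open>The factor \<open>t\<close> relating the radial derivative to the derivative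
      along the ray is cancelled, hence \<open>t > 0\<close>.\<close>
    have "DV S x f (t *\<^sub>R x) = 0" if t: "0 < t" "t < 1" for t
      using 0(2)[OF tx, of t] linear_cmul[OF linear_DV[OF 0(1) tx], of t t x] t by (simp add: radial_def)
    then have "((\<lambda>t. f (t *\<^sub>R x)) has_derivative (\<lambda>h. 0)) (at t)" if "0 < t" "t < 1" for t
      using der[of t] that at_within_Icc_at[of 0 t 1] by (simp add: has_field_derivative_def lambda_zero)
    moreover have "continuous_on {0..1} (\<lambda>t. f (t *\<^sub>R x))"
      using der by (intro DERIV_continuous_on) auto
    ultimately obtain z where "f (1 *\<^sub>R x) - f (0 *\<^sub>R x) = 0"
      using mvt[of 0 1 "\<lambda>t. f (t *\<^sub>R x)" "\<lambda>t h. 0"] by auto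
    then show ?thesis by simp
  qed
  then show ?case
    by (intro exI[of _ "\<lambda>_. f 0"]) (simp add: homogeneous_polynomial_const)
next
  case (Suc k)
  have "\<exists>P. homogeneous_polynomial k P \<and> (\<forall>x\<in>S. DV S b f x = P x)" for b
  proof (rule Suc.IH)
    show "radial S (DV S b f) x = k * DV S b f x" if x: "x \<in> S" for x
    proof -
      have "DV S b (radial S f) x = DV S b (\<lambda>x. Suc k * f x) x"
        using x Suc.prems(2) by (intro DV_cong)
      then show ?thesis
        using DV_radial[OF Suc.prems(1) x, of b] DV_cmult[OF Suc.prems(1) x, of b "Suc k"]
        by (simp add: algebra_simps)
    qed
  qed (rule smooth_in_DV[OF Suc.prems(1)])
  then obtain P where P: "\<And>b. homogeneous_polynomial k (P b)" "\<And>b x. x \<in> S \<Longrightarrow> DV S b f x = P b x"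
    by metis
  have "f x = 1 / Suc k * (\<Sum>b\<in>Basis. (x \<bullet> b) * P b x)" if x: "x \<in> S" for x
  proof -
    have "Suc k * f x = (\<Sum>b\<in>Basis. (x \<bullet> b) * P b x)"
      using Suc.prems(2)[OF x] radial_Basis[OF Suc.prems(1) x] P(2)[OF x] by simp
    then show ?thesis by (simp add: field_simps)
  qed
  moreover have "homogeneous_polynomial (Suc k) (\<lambda>x. 1 / Suc k * (\<Sum>b\<in>Basis. (x \<bullet> b) * P b x))"
    by (intro homogeneous_polynomial_cmult homogeneous_polynomial_sum homogeneous_polynomial_inner_mult P)
  ultimately show ?case by (intro exI conjI) auto
qed

lemma homogeneous_polynomial_scaleR:
  assumes "homogeneous_polynomial k f" shows "f (t *\<^sub>R x) = t ^ k * f x"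
proof -
  from assms obtain c where c: "\<And>x. f x = (\<Sum>e\<in>exponents k. c e * monomial_fun e x)"
    unfolding homogeneous_polynomial_alt by blast
  have "monomial_fun e (t *\<^sub>R x) = t ^ k * monomial_fun e x" if "e \<in> exponents k" for e
  proof -
    have "(\<Prod>b\<in>Basis. t ^ e b) = t ^ k"
      using that by (auto simp: exponents_iff power_sum[symmetric])
    then show ?thesis by (simp add: monomial_fun_def power_mult_distrib prod.distrib)
  qed
  then show ?thesis by (simp add: c sum_distrib_left algebra_simps)
qed

lemma smooth_in_homogeneous_polynomial:
  assumes "homogeneous_polynomial k f" shows "smooth_in UNIV f"
proof -
  from assms obtain c where "f = (\<lambda>x. \<Sum>e\<in>exponents k. c e * monomial_fun e x)"
    unfolding homogeneous_polynomial_alt by blast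
  then show ?thesis by (simp add: monomial_fun_def)
qed

text \<open>Lets homogeneous polynomials be treated as smooth solutions of Euler's equation, without
  coefficients.\<close>

lemma homogeneous_polynomial_iff:
  "homogeneous_polynomial k f \<longleftrightarrow> smooth_in UNIV f \<and> (\<forall>x. radial UNIV f x = k * f x)"
proof
  assume f: "homogeneous_polynomial k f"
  have "radial UNIV f x = k * f x" for x
  proof -
    have "((\<lambda>s. f (0 + s *\<^sub>R x)) has_real_derivative DV UNIV x f (0 + 1 *\<^sub>R x)) (at 1)"
      by (rule whole_space.DERIV_line) (simp_all add: smooth_in_homogeneous_polynomial[OF f])
    then have 1: "((\<lambda>s. s ^ k * f x) has_real_derivative DV UNIV x f x) (at 1)"
      by (simp add: homogeneous_polynomial_scaleR[OF f])
    have "((\<lambda>s. s ^ k * f x) has_real_derivative (real k * 1 ^ (k - Suc 0)) * f x) (at 1)"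
      by (rule DERIV_cmult_right[OF DERIV_pow])
    from DERIV_unique[OF 1 this] show ?thesis by (simp add: radial_def)
  qed
  with f show "smooth_in UNIV f \<and> (\<forall>x. radial UNIV f x = k * f x)"
    by (simp add: smooth_in_homogeneous_polynomial)
next
  assume "smooth_in UNIV f \<and> (\<forall>x. radial UNIV f x = k * f x)"
  then obtain P where "homogeneous_polynomial k P" "\<forall>x\<in>UNIV. f x = P x"
    using whole_space.Euler_homogeneous_polynomial[of f k] by auto
  then show "homogeneous_polynomial k f" by (simp add: fun_eq_iff[symmetric])
qed

subsection \<open>Eigenfunctions on the ball\<close>

text \<open>Clearing the denominator gives a quadratic equation in \<open>k\<close>, the same one as
  the determinant of the radial system in \<open>eigenfunction_structure\<close>.\<close>

lemma nu1_eq_iff: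
  assumes "n \<ge> 1" "k \<ge> 1"
  shows "nu1 k n = \<mu> \<longleftrightarrow>
    2 * (real k)\<^sup>2 + (real n - 3) * real k = (\<mu> - (real n + 1)) * (2 * real k + real n - 1)"
proof -
  have D: "real n + 2 * real k - 1 > 0" using assms by simp
  have "nu1 k n = \<mu> \<longleftrightarrow> (real k + real n - 1) * (real n + 2 * real k + 1) = \<mu> * (real n + 2 * real k - 1)"
    unfolding nu1_def using D by (simp add: divide_eq_eq)
  then show ?thesis by (simp add: algebra_simps power2_eq_square)
qed

text \<open>Two different roots \<open>j\<close>, \<open>k\<close> of this quadratic would satisfy
  \<open>2 c = 2 (j + k) + n - 3\<close> by Vieta. With \<open>j\<close> and \<open>n\<close> at
  least 1 this forces \<open>c \<ge> k\<close>, against the quadratic equation for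
  \<open>k\<close>.\<close>

lemma nu1_inj:
  assumes n: "n \<ge> 1" and jk: "j \<ge> 1" "k \<ge> 1" and eq: "nu1 j n = nu1 k n"
  shows "j = k"
proof (rule ccontr)
  assume "j \<noteq> k"
  define c where "c = nu1 k n - (real n + 1)"
  have k: "2 * (real k)\<^sup>2 + (real n - 3) * real k = c * (2 * real k + real n - 1)"
    using nu1_eq_iff[OF n jk(2), of "nu1 k n"] by (simp add: c_def)
  have j: "2 * (real j)\<^sup>2 + (real n - 3) * real j = c * (2 * real j + real n - 1)"
    using nu1_eq_iff[OF n jk(1), of "nu1 k n"] eq by (simp add: c_def)
  have "(real j - real k) * (2 * (real j + real k) + real n - 3 - 2 * c) = 0"
    using j k by (simp add: algebra_simps power2_eq_square)
  then have c: "2 * c = 2 * (real j + real k) + real n - 3" using \<open>j \<noteq> k\<close> by simp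
  have "2 * real k \<le> 2 * c" using c n jk by simp
  then have "real k * (2 * real k + real n - 1) \<le> c * (2 * real k + real n - 1)"
    using n jk by (intro mult_right_mono) auto
  then have "real k * 2 \<le> 0" using k by (simp add: algebra_simps power2_eq_square)
  then show False using jk by simp
qed

text \<open>
  \<open>u\<close> corrects \<open>x q\<close> to a harmonic field with the same boundary values: the hypothesis on \<open>u\<close> cancels
  \<open>\<Delta> (x\<^sub>b q) = 2 \<partial>\<^sub>b q\<close>.
\<close>

lemma (in convex_body) harmonic_field:
  fixes u :: "'a \<Rightarrow> 'a \<Rightarrow> real" and q :: "'a \<Rightarrow> real"
  assumes q: "smooth_in S q" "\<And>x. x \<in> S \<Longrightarrow> lap S q x = 0"
    and u: "\<And>b. b \<in> Basis \<Longrightarrow> smooth_in S (u b)" "\<And>b x. b \<in> Basis \<Longrightarrow> x \<in> S \<Longrightarrow> lap S (u b) x = 0"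
      "\<And>b x. b \<in> Basis \<Longrightarrow> x \<in> S \<Longrightarrow> real DIM('a) * u b x + 2 * radial S (u b) x = DV S b q x"
    and x: "x \<in> S"
  defines "V \<equiv> \<lambda>b x. (x \<bullet> b) * q x + (1 - x \<bullet> x) * u b x"
  shows "b \<in> Basis \<Longrightarrow> lap S (V b) x = 0"
    and "(\<Sum>b\<in>Basis. DV S b (V b) x) = real DIM('a) * q x + radial S q x
        - 2 * (\<Sum>b\<in>Basis. (x \<bullet> b) * u b x) + (1 - x \<bullet> x) * (\<Sum>b\<in>Basis. DV S b (u b) x)"
proof -
  have DVr: "DV S v (\<lambda>x. 1 - x \<bullet> x) x = - 2 * (v \<bullet> x)" if "x \<in> S" for v x
    using that by (simp add: DV_diff DV_inner_self)
  show "lap S (V b) x = 0" if b: "b \<in> Basis"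
  proof -
    have "lap S (\<lambda>x. (x \<bullet> b) * q x) x = 2 * (\<Sum>c\<in>Basis. (b \<bullet> c) * DV S c q x)"
      using q x by (simp add: lap_mult lap_inner DV_inner inner_commute)
    then have 1: "lap S (\<lambda>x. (x \<bullet> b) * q x) x = 2 * DV S b q x"
      using DV_Basis[OF q(1) x, of b] by simp
    have "lap S (\<lambda>x. (1 - x \<bullet> x) * u b x) x
        = - 2 * real DIM('a) * u b x + 2 * (\<Sum>c\<in>Basis. (- 2 * (c \<bullet> x)) * DV S c (u b) x)"
      using u(1,2)[OF b] x by (simp add: lap_mult lap_diff lap_inner_self DVr)
    also have "(\<Sum>c\<in>Basis. (- 2 * (c \<bullet> x)) * DV S c (u b) x) = - 2 * radial S (u b) x"
      using radial_Basis[OF u(1)[OF b] x] by (simp add: sum_distrib_left inner_commute mult.assoc)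
    finally have 2: "lap S (\<lambda>x. (1 - x \<bullet> x) * u b x) x = - 2 * DV S b q x"
      using u(3)[OF b x] by simp
    show ?thesis
      using 1 2 q u(1)[OF b] x by (simp add: V_def lap_add)
  qed
  have "DV S b (V b) x = q x + (x \<bullet> b) * DV S b q x - 2 * ((x \<bullet> b) * u b x) + (1 - x \<bullet> x) * DV S b (u b) x"
    if b: "b \<in> Basis" for b
    using q u(1)[OF b] x b DVr[OF x, of b]
    by (simp add: V_def DV_add DV_mult DV_inner inner_commute)
  then show "(\<Sum>b\<in>Basis. DV S b (V b) x) = real DIM('a) * q x + radial S q x
        - 2 * (\<Sum>b\<in>Basis. (x \<bullet> b) * u b x) + (1 - x \<bullet> x) * (\<Sum>b\<in>Basis. DV S b (u b) x)"
    by (simp add: sum.distrib sum_subtractf sum_distrib_left radial_Basis[OF q(1) x])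
qed

text \<open>The two claims separate the constant from the rest: at the origin the system gives
  \<open>c q(0) = 0\<close>, while the first derivatives solve the system lowered by one, whose
  singular degrees correspond exactly to the \<open>k\<close> with
  \<open>nu1 k n = \<mu>\<close>.\<close>

theorem eigenfunction_structure:
  fixes q :: "'a::euclidean_space \<Rightarrow> real" and W :: "'a \<Rightarrow> 'a"
  assumes n: "n \<ge> 1" "DIM('a) = n + 1"
    and q: "smooth_in disc q" "\<And>x. x \<in> disc \<Longrightarrow> lap disc q x = 0"
    and W: "\<And>b. b \<in> Basis \<Longrightarrow> smooth_in disc (\<lambda>x. W x \<bullet> b)"
      "\<And>b x. b \<in> Basis \<Longrightarrow> x \<in> disc \<Longrightarrow> lap disc (\<lambda>x. W x \<bullet> b) x = 0"
    and bd: "\<And>x. x \<in> sphere 0 1 \<Longrightarrow> W x = q x *\<^sub>R x"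
    and div: "\<And>x. x \<in> disc \<Longrightarrow> (\<Sum>b\<in>Basis. DV disc b (\<lambda>x. W x \<bullet> b) x) = \<mu> * q x"
  shows "(\<mu> - (real n + 1)) * q 0 = 0"
    and "(\<exists>k\<ge>1. nu1 k n = \<mu> \<and> (\<forall>x\<in>disc. radial disc (\<lambda>x. q x - q 0) x = k * (q x - q 0)))
        \<or> (\<forall>x\<in>disc. q x = q 0)"
proof -
  define c where "c = \<mu> - (real n + 1)"
  \<comment> \<open>The weight is \<open>n\<close> because \<open>ray_integral n\<close> inverts
    \<open>n + 1 + 2 R\<close> and the dimension is \<open>n + 1\<close>.\<close>
  define u where "u b = ray_integral n (DV disc b q)" for b
  define h where "h x = (\<Sum>b\<in>Basis. (x \<bullet> b) * u b x)" for x
  have us: "smooth_in disc (u b)" for b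
    unfolding u_def by (intro smooth_in_ray_integral smooth_in_DV q)
  have hs: "smooth_in disc h" using us by (simp add: h_def[abs_def])
  have ul: "lap disc (u b) x = 0" if x: "x \<in> disc" for b x
  proof -
    have "lap disc (DV disc b q) y = 0" if y: "y \<in> disc" for y
    proof -
      have "lap disc (DV disc b q) y = DV disc b (\<lambda>_. 0) y"
        using unit_ball.lap_DV[OF q(1) y] DV_cong[of disc "lap disc q" "\<lambda>_. 0" y b] q(2) y by auto
      then show ?thesis using y by simp
    qed
    then show ?thesis
      using lap_ray_integral[OF smooth_in_DV[OF q(1)] x, of n b] ray_integral_zero[of "lap disc (DV disc b q)" x] x
      by (simp add: u_def)
  qed
  have ur: "real DIM('a) * u b x + 2 * radial disc (u b) x = DV disc b q x" if "x \<in> disc" for b x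
    using ray_integral_inverse[OF smooth_in_DV[OF q(1)] that, of n b] by (simp add: u_def n add.commute)
  have udiv: "(\<Sum>b\<in>Basis. DV disc b (u b) x) = 0" if x: "x \<in> disc" for x
  proof -
    have "(\<Sum>b\<in>Basis. DV disc b (u b) x) = (\<Sum>b\<in>Basis. ray_integral (n + 2) (DV disc b (DV disc b q)) x)"
      by (simp only: u_def DV_ray_integral[OF smooth_in_DV[OF q(1)] x])
    also have "\<dots> = ray_integral (n + 2) (lap disc q) x"
      unfolding lap_def[abs_def] using x
      by (intro ray_integral_sum[symmetric] smooth_in_DV q finite_Basis)
    also have "\<dots> = 0" by (rule ray_integral_zero[OF q(2) x])
    finally show ?thesis .
  qed
  note field = unit_ball.harmonic_field[of q u, OF q us ul ur]
  \<comment> \<open>Both fields are harmonic and agree on the sphere, where the correction term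
    vanishes.\<close>
  have WV: "W x \<bullet> b = (x \<bullet> b) * q x + (1 - x \<bullet> x) * u b x" if x: "x \<in> disc" and b: "b \<in> Basis" for x b
  proof (rule harmonic_unique[OF W(1,2)[OF b] _ _ _ x])
    show "smooth_in disc (\<lambda>x. (x \<bullet> b) * q x + (1 - x \<bullet> x) * u b x)" using q us by simp
    show "lap disc (\<lambda>x. (x \<bullet> b) * q x + (1 - x \<bullet> x) * u b x) y = 0" if "y \<in> disc" for y
      using field(1) that b by blast
    show "W y \<bullet> b = (y \<bullet> b) * q y + (1 - y \<bullet> y) * u b y" if "y \<in> sphere 0 1" for y
      using bd[OF that] that by (simp add: dot_square_norm)
  qed auto
  \<comment> \<open>The divergence of the explicit field, set equal to \<open>\<mu> q\<close>. The
    term with \<open>1 - x \<bullet> x\<close> drops out because \<open>u\<close> is divergence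
    free.\<close>
  have rq: "radial disc q x = c * q x + 2 * h x" if x: "x \<in> disc" for x
  proof -
    have "\<mu> * q x = (\<Sum>b\<in>Basis. DV disc b (\<lambda>x. (x \<bullet> b) * q x + (1 - x \<bullet> x) * u b x) x)"
      using div[OF x] DV_cong[OF WV x] by simp
    also have "\<dots> = (real n + 1) * q x + radial disc q x - 2 * h x"
      using field(2)[OF _ _ _ x] udiv[OF x] by (simp add: h_def n)
    finally show ?thesis by (simp add: c_def algebra_simps)
  qed
  \<comment> \<open>Differentiating \<open>h\<close> radially and inserting the equation for
    \<open>u\<close> gives \<open>2 R h = R q - (n - 1) h\<close>; \<open>rq\<close> then eliminates
    \<open>R q\<close>.\<close>
  have rh: "radial disc h x = (c / 2) * q x + ((3 - real n) / 2) * h x" if x: "x \<in> disc" for x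
  proof -
    have "radial disc h x = (\<Sum>b\<in>Basis. (x \<bullet> b) * (u b x + radial disc (u b) x))"
      using us x by (simp add: h_def[abs_def] radial_def unit_ball.DV_sum unit_ball.DV_mult unit_ball.DV_inner algebra_simps)
    then have "2 * radial disc h x = (\<Sum>b\<in>Basis. (x \<bullet> b) * (2 * u b x + 2 * radial disc (u b) x))"
      by (simp add: sum_distrib_left algebra_simps)
    also have "\<dots> = (\<Sum>b\<in>Basis. (x \<bullet> b) * DV disc b q x - (real n - 1) * ((x \<bullet> b) * u b x))"
    proof (rule sum.cong)
      fix b
      have e: "2 * radial disc (u b) x = DV disc b q x - (real n + 1) * u b x"
        using ur[OF x, of b] by (simp add: n algebra_simps)
      show "(x \<bullet> b) * (2 * u b x + 2 * radial disc (u b) x)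
          = (x \<bullet> b) * DV disc b q x - (real n - 1) * ((x \<bullet> b) * u b x)"
        unfolding e by (simp add: algebra_simps)
    qed simp
    also have "\<dots> = radial disc q x - (real n - 1) * h x"
      by (simp add: sum_subtractf sum_distrib_left[symmetric] unit_ball.radial_Basis[OF q(1) x] h_def)
    finally show ?thesis using rq[OF x] by (simp add: field_simps)
  qed
  have "radial disc q 0 = 0" using unit_ball.radial_zero[OF q(1)] by simp
  then show "(\<mu> - (real n + 1)) * q 0 = 0" using rq[of 0] by (simp add: h_def c_def)
  \<comment> \<open>The matrix already lowered once, for the derivatives. Their degree
    \<open>i\<close> is degree \<open>Suc i\<close> of \<open>q\<close>, hence the shift in
    \<open>nu1\<close>.\<close>
  have det: "(c - 1 - real i) * ((3 - real n) / 2 - 1 - real i) - 2 * (c / 2) = 0 \<longleftrightarrow> nu1 (Suc i) n = \<mu>" for i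
    unfolding nu1_eq_iff[OF n(1), of "Suc i", simplified] c_def[symmetric]
    by (simp add: field_simps power2_eq_square)
  have sys: "radial disc (DV disc v q) x = (c - 1) * DV disc v q x + 2 * DV disc v h x"
    "radial disc (DV disc v h) x = c / 2 * DV disc v q x + ((3 - real n) / 2 - 1) * DV disc v h x"
    if "x \<in> disc" for v x
    using radial_system_DV[OF q(1) hs rq that, of v]
      radial_system_DV[OF hs q(1), of "(3 - real n) / 2" "c / 2" x v] rh that by (simp_all add: add.commute)
  show "(\<exists>k\<ge>1. nu1 k n = \<mu> \<and> (\<forall>x\<in>disc. radial disc (\<lambda>x. q x - q 0) x = k * (q x - q 0)))
        \<or> (\<forall>x\<in>disc. q x = q 0)"
  proof (cases "\<exists>k\<ge>1. nu1 k n = \<mu>")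
    case True
    then obtain k where k: "nu1 (Suc k) n = \<mu>" by (metis Suc_le_D One_nat_def)
    let ?p = "\<lambda>x. q x - q 0"
    have p: "smooth_in disc ?p" using q by simp
    have DVp: "DV disc v ?p x = DV disc v q x" if "x \<in> disc" for v x
      using q that by (simp add: unit_ball.DV_diff)
    have hom: "radial disc (DV disc v q) x = k * DV disc v q x" if x: "x \<in> disc" for v x
    proof -
      have "radial disc (DV disc v q) x = k * DV disc v q x \<and> radial disc (DV disc v h) x = k * DV disc v h x"
      proof (rule radial_system_homogeneous[OF smooth_in_DV[OF q(1)] smooth_in_DV[OF hs] sys])
        show "(c - 1 - real i) * ((3 - real n) / 2 - 1 - real i) - 2 * (c / 2) \<noteq> 0" if "i \<noteq> k" for i
          unfolding det using nu1_inj[OF n(1), of "Suc i" "Suc k"] k that by auto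
      qed (use x in auto)
      then show ?thesis ..
    qed
    have homp: "radial disc (DV disc v ?p) x = k * DV disc v ?p x" if x: "x \<in> disc" for v x
      using hom[OF x] DV_cong[OF DVp x] DVp[OF x] by (simp add: radial_def)
    have "radial disc ?p x = Suc k * ?p x" if x: "x \<in> disc" for x
      using unit_ball.radial_homogeneous_if_DV[OF p _ _ x homp] by simp
    then show ?thesis using k by (intro disjI1 exI[of _ "Suc k"]) auto
  next
    case False
    have "DV disc v q x = 0 \<and> DV disc v h x = 0" if x: "x \<in> disc" for v x
    proof (rule radial_system_trivial[OF smooth_in_DV[OF q(1)] smooth_in_DV[OF hs] sys])
      show "(c - 1 - real i) * ((3 - real n) / 2 - 1 - real i) - 2 * (c / 2) \<noteq> 0" for i
        unfolding det using False by auto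
    qed (use x in auto)
    then have "q x = q 0" if "x \<in> disc" for x
      using unit_ball.constant_if_DV_zero[OF q(1) _ that, of 0] by auto
    then show ?thesis by blast
  qed
qed

subsection \<open>Differential forms\<close>

definition smooth_form :: "'a::real_normed_vector set \<Rightarrow> 'a form \<Rightarrow> bool" where
  "smooth_form S \<omega> \<longleftrightarrow> (\<forall>vs. smooth_in S (\<lambda>x. \<omega> x vs))"

lemma smooth_formD: "smooth_form S \<omega> \<Longrightarrow> smooth_in S (\<lambda>x. \<omega> x vs)"
  by (simp add: smooth_form_def)

lemma form_d_eq: "x \<in> S \<Longrightarrow>
    form_d S \<omega> x vs = (\<Sum>i<length vs. (-1) ^ i * DV S (vs ! i) (\<lambda>y. \<omega> y (omit i vs)) x)"
  by (simp add: form_d_def DV_def)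

lemma codiff_eq: "x \<in> S \<Longrightarrow> codiff S \<omega> x vs = - (\<Sum>b\<in>Basis. DV S b (\<lambda>y. \<omega> y (b # vs)) x)"
  by (simp add: codiff_def DV_def)

lemma form_d_Cons: "x \<in> S \<Longrightarrow> form_d S \<omega> x (v # vs)
    = DV S v (\<lambda>y. \<omega> y vs) x - (\<Sum>i<length vs. (-1) ^ i * DV S (vs ! i) (\<lambda>y. \<omega> y (v # omit i vs)) x)"
  by (simp add: form_d_eq sum.lessThan_Suc_shift sum_negf del: sum.lessThan_Suc)

lemma omit_omit: "i \<le> j \<Longrightarrow> Suc j < length vs \<Longrightarrow> omit j (omit i vs) = omit i (omit (Suc j) vs)"
  by (simp add: drop_take min_def Suc_diff_le)

lemma nth_omit: "j < length vs - 1 \<Longrightarrow> i < length vs \<Longrightarrow> omit i vs ! j = vs ! (if j < i then j else Suc j)"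
  by (auto simp: nth_append)

context convex_body
begin

text \<open>For the flat metric the mixed second derivatives in \<open>d \<delta>\<close> and
  \<open>\<delta> d\<close> cancel by symmetry, and each component keeps only its own Laplacian. The
  minus sign is the convention of the Hodge Laplacian.\<close>

lemma hodge_laplacian_eq:
  assumes w: "smooth_form S \<omega>" and x: "x \<in> S"
  shows "hodge_laplacian S \<omega> x vs = - lap S (\<lambda>y. \<omega> y vs) x"
proof -
  let ?T = "\<lambda>b i. (-1) ^ i * DV S (vs ! i) (DV S b (\<lambda>y. \<omega> y (b # omit i vs))) x"
  have sm: "smooth_in S (\<lambda>y. \<omega> y us)" for us by (rule smooth_formD[OF w])
  have "form_d S (codiff S \<omega>) x vs
      = (\<Sum>i<length vs. (-1) ^ i * DV S (vs ! i) (\<lambda>y. - (\<Sum>b\<in>Basis. DV S b (\<lambda>y. \<omega> y (b # omit i vs)) y)) x)"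
    unfolding form_d_eq[OF x]
    by (intro sum.cong refl arg_cong2[where f = "(*)"] DV_cong codiff_eq x)
  also have "\<dots> = - (\<Sum>i<length vs. \<Sum>b\<in>Basis. ?T b i)"
    using x by (simp add: DV_minus DV_sum smooth_in_DV sm sum_distrib_left sum_negf)
  finally have 1: "form_d S (codiff S \<omega>) x vs = - (\<Sum>b\<in>Basis. \<Sum>i<length vs. ?T b i)"
    by (subst (asm) sum.swap)
  have "codiff S (form_d S \<omega>) x vs
      = - (\<Sum>b\<in>Basis. DV S b (\<lambda>y. DV S b (\<lambda>y. \<omega> y vs) y
            - (\<Sum>i<length vs. (-1) ^ i * DV S (vs ! i) (\<lambda>y. \<omega> y (b # omit i vs)) y)) x)"
    unfolding codiff_eq[OF x]
    by (intro arg_cong[where f = uminus] sum.cong refl DV_cong form_d_Cons x)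
  also have "\<dots> = - (\<Sum>b\<in>Basis. DV S b (DV S b (\<lambda>y. \<omega> y vs)) x - (\<Sum>i<length vs. ?T b i))"
  proof -
    have "DV S b (\<lambda>y. DV S b (\<lambda>y. \<omega> y vs) y
            - (\<Sum>i<length vs. (-1) ^ i * DV S (vs ! i) (\<lambda>y. \<omega> y (b # omit i vs)) y)) x
        = DV S b (DV S b (\<lambda>y. \<omega> y vs)) x
            - (\<Sum>i<length vs. (-1) ^ i * DV S b (DV S (vs ! i) (\<lambda>y. \<omega> y (b # omit i vs))) x)" for b
      using x by (simp add: DV_diff DV_sum DV_cmult smooth_in_DV sm)
    then show ?thesis by (simp only: DV_commute[OF sm x, of _ "vs ! _"])
  qed
  finally have 2: "codiff S (form_d S \<omega>) x vs
      = - lap S (\<lambda>y. \<omega> y vs) x + (\<Sum>b\<in>Basis. \<Sum>i<length vs. ?T b i)"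
    by (simp add: lap_def sum_subtractf)
  show ?thesis using 1 2 by (simp add: hodge_laplacian_def)
qed

lemma form_d_form_d:
  assumes w: "smooth_form S \<omega>" and x: "x \<in> S"
  shows "form_d S (form_d S \<omega>) x vs = 0"
proof -
  let ?m = "length vs"
  let ?F = "\<lambda>(i, j). (-1) ^ i * ((-1) ^ j *
      DV S (vs ! i) (DV S (omit i vs ! j) (\<lambda>y. \<omega> y (omit j (omit i vs)))) x)"
  let ?I = "{..<?m} \<times> {..<?m - 1}"
  \<comment> \<open>The involution that deletes the same two entries in the opposite order. It
    reverses the sign and keeps the mixed derivative.\<close>
  let ?\<tau> = "\<lambda>(i, j). if i \<le> j then (Suc j, i) else (j, i - 1)"
  have sm: "smooth_in S (\<lambda>y. \<omega> y us)" for us by (rule smooth_formD[OF w])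
  have "form_d S (form_d S \<omega>) x vs
      = (\<Sum>i<?m. (-1) ^ i * DV S (vs ! i) (\<lambda>y. \<Sum>j<?m - 1. (-1) ^ j *
          DV S (omit i vs ! j) (\<lambda>y. \<omega> y (omit j (omit i vs))) y) x)"
    unfolding form_d_eq[OF x]
  proof (intro sum.cong refl arg_cong2[where f = "(*)"] DV_cong x)
    fix i y assume "i \<in> {..<?m}" and y: "y \<in> S"
    then have "length (omit i vs) = ?m - 1" using length_omit[of i vs] by simp
    then show "form_d S \<omega> y (omit i vs)
        = (\<Sum>j<?m - 1. (-1) ^ j * DV S (omit i vs ! j) (\<lambda>y. \<omega> y (omit j (omit i vs))) y)"
      by (simp only: form_d_eq[OF y])
  qed
  also have "\<dots> = (\<Sum>i<?m. \<Sum>j<?m - 1. ?F (i, j))"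
    unfolding prod.case sum_distrib_left[symmetric] using x sm
    by (intro sum.cong refl arg_cong2[where f = "(*)"]) (simp add: DV_sum DV_cmult smooth_in_DV)
  also have "\<dots> = sum ?F ?I" by (simp only: prod.case sum.cartesian_product)
  finally have dd: "form_d S (form_d S \<omega>) x vs = sum ?F ?I" .
  have lt: "?F (Suc j, i) = - ?F (i, j)" if "i \<le> j" "Suc j < ?m" for i j
  proof -
    have n1: "omit i vs ! j = vs ! Suc j" using nth_omit[of j vs i] that by simp
    have n2: "omit (Suc j) vs ! i = vs ! i" using nth_omit[of i vs "Suc j"] that by simp
    have sgn: "(-1) ^ Suc j * ((-1) ^ i * D) = - ((-1) ^ i * ((-1) ^ j * D))" for D :: real by simp
    show ?thesis
      unfolding prod.case n1 n2 omit_omit[OF that] sgn DV_commute[OF sm x, of "vs ! Suc j" "vs ! i"] ..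
  qed
  have "sum ?F ?I = (\<Sum>p\<in>?I. - ?F p)"
  proof (rule sum.reindex_bij_witness[of _ ?\<tau> ?\<tau>])
    fix p assume p: "p \<in> ?I"
    obtain i j where ij: "p = (i, j)" by (cases p)
    with p have b: "i < ?m" "j < ?m - 1" by auto
    show "?\<tau> (?\<tau> p) = p" using ij by auto
    then show "?\<tau> (?\<tau> p) = p" .
    show "?\<tau> p \<in> ?I" using b ij by auto
    then show "?\<tau> p \<in> ?I" .
    show "- ?F (?\<tau> p) = ?F p"
    proof (cases "i \<le> j")
      case True
      then show ?thesis using lt[of i j] b ij by simp
    next
      case False
      then have "i = Suc (i - 1)" "j \<le> i - 1" by auto
      then show ?thesis using lt[of j "i - 1"] b ij False by simp
    qed
  qed
  then have "sum ?F ?I = 0" by (simp add: sum_negf del: prod.case split_beta)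
  then show ?thesis using dd by simp
qed

lemma alternating_DV:
  assumes w: "smooth_form S \<omega>" and alt: "\<And>y. y \<in> S \<Longrightarrow> alternating p (\<omega> y)" and x: "x \<in> S"
  shows "alternating p (\<lambda>vs. DV S v (\<lambda>y. \<omega> y vs) x)"
proof (rule alternatingI)
  have sm: "smooth_in S (\<lambda>y. \<omega> y us)" for us by (rule smooth_formD[OF w])
  have zero: "DV S v f x = 0" if "\<And>y. y \<in> S \<Longrightarrow> f y = 0" for f
    using DV_cong[OF that x, where v = v] x by simp
  show "DV S v (\<lambda>y. \<omega> y vs) x = 0" if "length vs \<noteq> p" for vs
    using alternating_length[OF alt that] by (rule zero)
  show "DV S v (\<lambda>y. \<omega> y vs) x = 0" if "\<not> distinct vs" for vs
    using alternating_not_distinct[OF alt that] by (rule zero)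
  show "DV S v (\<lambda>y. \<omega> y (vs[i := a *\<^sub>R u + b *\<^sub>R w])) x
      = a * DV S v (\<lambda>y. \<omega> y (vs[i := u])) x + b * DV S v (\<lambda>y. \<omega> y (vs[i := w])) x"
    if "length vs = p" "i < p" for vs i u w a b
  proof -
    have "DV S v (\<lambda>y. \<omega> y (vs[i := a *\<^sub>R u + b *\<^sub>R w])) x
        = DV S v (\<lambda>y. a * \<omega> y (vs[i := u]) + b * \<omega> y (vs[i := w])) x"
      by (rule DV_cong[OF alternating_update[OF alt that] x])
    then show ?thesis using x by (simp add: DV_add DV_cmult sm)
  qed
qed

lemma alternating_form_d:
  assumes w: "smooth_form S \<omega>" and alt: "\<And>y. y \<in> S \<Longrightarrow> alternating p (\<omega> y)"
  shows "alternating (Suc p) (form_d S \<omega> x)"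
proof (cases "x \<in> S")
  case True
  have "form_d S \<omega> x = (\<lambda>vs. \<Sum>i<length vs. (-1) ^ i * DV S (vs ! i) (\<lambda>y. \<omega> y (omit i vs)) x)"
    by (rule ext) (rule form_d_eq[OF True])
  moreover have "alternating (Suc p) \<dots>"
    by (rule alternating_antisymmetrise[where \<alpha> = "\<lambda>v us. DV S v (\<lambda>y. \<omega> y us) x"])
      (intro linear_DV smooth_formD[OF w] True, intro alternating_DV w alt True)
  ultimately show ?thesis by simp
next
  case False
  then have "form_d S \<omega> x = (\<lambda>_. 0)" by (simp add: form_d_def)
  then show ?thesis by (simp add: alternating_zero)
qed

lemma position_slot:
  assumes alt: "\<And>y. y \<in> S \<Longrightarrow> alternating p (\<omega> y)" and x: "x \<in> S"
  shows "\<omega> x (x # vs) = (\<Sum>b\<in>Basis. (x \<bullet> b) * \<omega> x (b # vs))"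
  by (rule linear_sum_Basis[OF alternating_linear_Cons[OF alt[OF x]]])

text \<open>The product rule for the radial field in the first slot, whose derivative in direction
  \<open>v\<close> is \<open>v\<close>; in the first summand on the right that slot is frozen at
  \<open>x\<close>.\<close>

lemma DV_position_slot:
  assumes w: "smooth_form S \<omega>" and alt: "\<And>y. y \<in> S \<Longrightarrow> alternating p (\<omega> y)" and x: "x \<in> S"
  shows "DV S v (\<lambda>y. \<omega> y (y # vs)) x = DV S v (\<lambda>y. \<omega> y (x # vs)) x + \<omega> x (v # vs)"
proof -
  have sm: "smooth_in S (\<lambda>y. \<omega> y us)" for us by (rule smooth_formD[OF w])
  have "DV S v (\<lambda>y. \<omega> y (y # vs)) x = DV S v (\<lambda>y. \<Sum>b\<in>Basis. (y \<bullet> b) * \<omega> y (b # vs)) x"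
    by (rule DV_cong[OF position_slot[OF alt] x]) auto
  also have "\<dots> = (\<Sum>b\<in>Basis. (x \<bullet> b) * DV S v (\<lambda>y. \<omega> y (b # vs)) x) + (\<Sum>b\<in>Basis. (v \<bullet> b) * \<omega> x (b # vs))"
    using x sm by (simp add: DV_sum DV_mult DV_inner sum.distrib)
  also have "(\<Sum>b\<in>Basis. (v \<bullet> b) * \<omega> x (b # vs)) = \<omega> x (v # vs)"
    by (rule linear_sum_Basis[OF alternating_linear_Cons[OF alt[OF x]], symmetric])
  also have "(\<Sum>b\<in>Basis. (x \<bullet> b) * DV S v (\<lambda>y. \<omega> y (b # vs)) x) = DV S v (\<lambda>y. \<Sum>b\<in>Basis. (x \<bullet> b) * \<omega> y (b # vs)) x"
    using x sm by (simp add: DV_sum DV_cmult)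
  also have "\<dots> = DV S v (\<lambda>y. \<omega> y (x # vs)) x"
    by (rule DV_cong[OF _ x]) (rule linear_sum_Basis[OF alternating_linear_Cons[OF alt], symmetric])
  finally show ?thesis .
qed

text \<open>Cartan's formula: the right-hand side is the Lie derivative along the radial field.\<close>

lemma Cartan_radial:
  assumes w: "smooth_form S \<omega>" and alt: "\<And>y. y \<in> S \<Longrightarrow> alternating p (\<omega> y)" and x: "x \<in> S"
  shows "form_d S (interior_product (\<lambda>x. x) \<omega>) x vs + form_d S \<omega> x (x # vs)
    = radial S (\<lambda>y. \<omega> y vs) x + p * \<omega> x vs"
proof -
  have "form_d S (interior_product (\<lambda>x. x) \<omega>) x vs
      = (\<Sum>i<length vs. (-1) ^ i * (DV S (vs ! i) (\<lambda>y. \<omega> y (x # omit i vs)) x + \<omega> x ((vs ! i) # omit i vs)))"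
    unfolding form_d_eq[OF x] interior_product_def by (simp only: DV_position_slot[OF w alt x])
  also have "\<dots> = (\<Sum>i<length vs. (-1) ^ i * DV S (vs ! i) (\<lambda>y. \<omega> y (x # omit i vs)) x + \<omega> x vs)"
  proof (rule sum.cong)
    fix i assume "i \<in> {..<length vs}"
    then have o: "\<omega> x ((vs ! i) # omit i vs) = (-1) ^ i * \<omega> x vs"
      using alternating_omit[OF alt[OF x]] by blast
    have sgn: "(-1) ^ i * (D + (-1) ^ i * w) = (-1) ^ i * D + w" for D w :: real
      by (simp add: distrib_left mult.assoc[symmetric] power_mult_distrib[symmetric])
    show "(-1) ^ i * (DV S (vs ! i) (\<lambda>y. \<omega> y (x # omit i vs)) x + \<omega> x ((vs ! i) # omit i vs))
        = (-1) ^ i * DV S (vs ! i) (\<lambda>y. \<omega> y (x # omit i vs)) x + \<omega> x vs"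
      unfolding o by (rule sgn)
  qed simp
  also have "\<dots> = (\<Sum>i<length vs. (-1) ^ i * DV S (vs ! i) (\<lambda>y. \<omega> y (x # omit i vs)) x) + p * \<omega> x vs"
    using alternating_length[OF alt[OF x], of vs] by (cases "length vs = p") (simp_all add: sum.distrib)
  finally show ?thesis by (simp add: form_d_Cons[OF x] radial_def)
qed

text \<open>A derivative that hits the radial field produces the value on \<open>b # b # vs\<close>,
  which is 0. The other term changes sign when the first two slots are exchanged.\<close>

lemma codiff_interior_product:
  assumes w: "smooth_form S \<omega>" and alt: "\<And>y. y \<in> S \<Longrightarrow> alternating p (\<omega> y)" and x: "x \<in> S"
  shows "codiff S (interior_product (\<lambda>x. x) \<omega>) x vs = - codiff S \<omega> x (x # vs)"
proof -
  have "DV S b (\<lambda>y. \<omega> y (y # b # vs)) x = - DV S b (\<lambda>y. \<omega> y (b # x # vs)) x" for b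
  proof -
    have "DV S b (\<lambda>y. \<omega> y (x # b # vs)) x = DV S b (\<lambda>y. - \<omega> y (b # x # vs)) x"
      by (rule DV_cong[OF _ x]) (use alternating_swap[OF alt, of _ "[]" x b vs] in simp)
    moreover have "\<omega> x (b # b # vs) = 0"
      by (rule alternating_not_distinct[OF alt[OF x]]) simp
    ultimately show ?thesis
      using DV_position_slot[OF w alt x, of b "b # vs"] x by (simp add: DV_minus smooth_formD[OF w])
  qed
  then show ?thesis by (simp add: codiff_eq[OF x] interior_product_def sum_negf)
qed

end

section \<open>Polynomial forms and contraction with the radial field\<close>

lemma homogeneous_polynomial_DV:
  assumes f: "homogeneous_polynomial k f"
  shows "homogeneous_polynomial (k - 1) (DV UNIV v f)"
proof -
  have s: "smooth_in UNIV f" and r: "\<And>x. radial UNIV f x = k * f x"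
    using f by (auto simp: homogeneous_polynomial_iff)
  show ?thesis
  proof (cases k)
    \<comment> \<open>Here \<open>k - 1\<close> is truncated to 0; the derivative is the zero
      function, which is homogeneous of every degree.\<close>
    case 0
    have "f x = f 0" for x
      using homogeneous_polynomial_scaleR[OF f, of 0 x] 0 by simp
    then have "DV UNIV v f x = DV UNIV v (\<lambda>_. f 0) x" for x
      by (intro DV_cong) auto
    then have "DV UNIV v f = (\<lambda>x. 0)" by (intro ext) simp
    then show ?thesis by (simp add: homogeneous_polynomial_zero)
  next
    case (Suc m)
    have "radial UNIV (DV UNIV v f) x = m * DV UNIV v f x" for x
    proof -
      have "DV UNIV v (radial UNIV f) x = DV UNIV v (\<lambda>x. k * f x) x"
        using r by (intro DV_cong) auto
      then show ?thesis
        using whole_space.DV_radial[OF s UNIV_I, where v=v and x=x] whole_space.DV_cmult[OF s UNIV_I, where v=v and x=x and c=k] Suc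
        by (simp add: algebra_simps)
    qed
    then show ?thesis using Suc s by (simp add: homogeneous_polynomial_iff smooth_in_DV)
  qed
qed

lemma homogeneous_polynomial_eq_zero:
  fixes f :: "'a::euclidean_space \<Rightarrow> real"
  assumes f: "homogeneous_polynomial k f" and z: "\<And>x. x \<in> disc \<Longrightarrow> f x = 0"
  shows "f x = 0"
proof -
  define t where "t = 1 / (norm x + 1)"
  have t: "t > 0" by (simp add: t_def add_nonneg_pos)
  have "norm (t *\<^sub>R x) \<le> 1" using t by (simp add: t_def field_simps add_nonneg_pos)
  then have "t ^ k * f x = 0" using z[of "t *\<^sub>R x"] homogeneous_polynomial_scaleR[OF f, of t x] by simp
  then show ?thesis using t by simp
qed

text \<open>The definition constrains only the coefficients on basis vectors; multilinearity carries
  homogeneity to all argument lists.\<close>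

lemma poly_forms_iff:
  "\<omega> \<in> poly_forms k p \<longleftrightarrow>
    (\<forall>x. alternating p (\<omega> x)) \<and> (\<forall>vs. homogeneous_polynomial k (\<lambda>x. \<omega> x vs))"
proof
  assume w: "\<omega> \<in> poly_forms k p"
  then have alt: "alternating p (\<omega> x)" for x by (simp add: poly_forms_def)
  have "homogeneous_polynomial k (\<lambda>x. \<omega> x (us @ ws))"
    if "set ws \<subseteq> Basis" "length us + length ws = p" for us ws
    using that
  proof (induction us arbitrary: ws rule: rev_induct)
    case Nil
    then show ?case using w by (simp add: poly_forms_def)
  next
    case (snoc u us)
    have "linear (\<lambda>u. \<omega> x (us @ u # ws))" for x
      by (rule alternating_linear_append[OF alt])
    then have "(\<lambda>x. \<omega> x ((us @ [u]) @ ws)) = (\<lambda>x. \<Sum>b\<in>Basis. (u \<bullet> b) * \<omega> x (us @ b # ws))"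
      using linear_sum_Basis by fastforce
    then show ?case
      using snoc by (auto intro!: homogeneous_polynomial_sum homogeneous_polynomial_cmult)
  qed
  from this[of "[]"] have "homogeneous_polynomial k (\<lambda>x. \<omega> x vs)" if "length vs = p" for vs
    using that by simp
  moreover have "(\<lambda>x. \<omega> x vs) = (\<lambda>x. 0)" if "length vs \<noteq> p" for vs
    using alternating_length[OF alt that] by auto
  ultimately show "(\<forall>x. alternating p (\<omega> x)) \<and> (\<forall>vs. homogeneous_polynomial k (\<lambda>x. \<omega> x vs))"
    using alt homogeneous_polynomial_zero by metis
qed (simp add: poly_forms_def)

lemma poly_formsD:
  assumes "\<omega> \<in> poly_forms k p"
  shows "alternating p (\<omega> x)" "homogeneous_polynomial k (\<lambda>x. \<omega> x vs)" "smooth_form UNIV \<omega>"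
    "radial UNIV (\<lambda>x. \<omega> x vs) x = k * \<omega> x vs"
  using assms by (auto simp: poly_forms_iff smooth_form_def homogeneous_polynomial_iff)

lemma form_d_zero [simp]: "form_d UNIV (0 :: 'a::euclidean_space form) = 0"
  by (simp add: fun_eq_iff form_d_eq zero_fun_def)

lemma codiff_zero [simp]: "codiff UNIV (0 :: 'a::euclidean_space form) = 0"
  by (simp add: fun_eq_iff codiff_eq zero_fun_def)

lemma form_d_scale:
  "smooth_form UNIV \<omega> \<Longrightarrow> form_d UNIV (form_scale c \<omega>) = form_scale c (form_d UNIV \<omega>)"
  by (simp add: fun_eq_iff form_d_eq form_scale_def whole_space.DV_cmult smooth_formD sum_distrib_left
      mult.left_commute)

lemma codiff_scale:
  "smooth_form UNIV \<omega> \<Longrightarrow> codiff UNIV (form_scale c \<omega>) = form_scale c (codiff UNIV \<omega>)"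
  by (simp add: fun_eq_iff codiff_eq form_scale_def whole_space.DV_cmult smooth_formD sum_distrib_left)

lemma interior_product_scale:
  "interior_product X (form_scale c \<omega>) = form_scale c (interior_product X \<omega>)"
  by (simp add: interior_product_def form_scale_def)

lemma form_scale_form_scale: "form_scale a (form_scale b \<omega>) = form_scale (a * b) \<omega>"
  by (simp add: form_scale_def mult.assoc)

lemma form_scale_one [simp]: "form_scale 1 \<omega> = \<omega>"
  by (simp add: form_scale_def)

text \<open>Cartan's formula for a closed form. The Lie derivative along the radial field multiplies
  by polynomial degree plus form degree, here \<open>k + Suc p\<close>.\<close>

lemma form_d_interior_product_H1:
  assumes w: "\<omega> \<in> H1_forms k (Suc p)"
  shows "form_d UNIV (interior_product (\<lambda>x. x) \<omega>) = form_scale (real k + real p + 1) \<omega>"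
proof (intro ext)
  fix x vs
  from w have pf: "\<omega> \<in> poly_forms k (Suc p)" and d: "form_d UNIV \<omega> = 0"
    by (auto simp: H1_forms_def H_forms_def)
  show "form_d UNIV (interior_product (\<lambda>x. x) \<omega>) x vs = form_scale (real k + real p + 1) \<omega> x vs"
    using whole_space.Cartan_radial[OF poly_formsD(3)[OF pf] poly_formsD(1)[OF pf], of x vs] d
    by (simp add: poly_formsD(4)[OF pf] form_scale_def algebra_simps)
qed

lemma interior_product_form_d_H2:
  assumes w: "\<eta> \<in> H2_forms k p"
  shows "interior_product (\<lambda>x. x) (form_d UNIV \<eta>) = form_scale (real k + real p) \<eta>"
proof (intro ext)
  fix x vs
  from w have pf: "\<eta> \<in> poly_forms k p" and z: "interior_product (\<lambda>x. x) \<eta> = 0"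
    by (auto simp: H2_forms_def H_forms_def)
  show "interior_product (\<lambda>x. x) (form_d UNIV \<eta>) x vs = form_scale (real k + real p) \<eta> x vs"
    using whole_space.Cartan_radial[OF poly_formsD(3)[OF pf] poly_formsD(1)[OF pf], of x vs] z
    by (simp add: poly_formsD(4)[OF pf] form_scale_def interior_product_def algebra_simps)
qed

text \<open>Coclosedness passes through \<open>codiff_interior_product\<close>. Harmonicity follows
  since \<open>d\<close> of the contraction is a multiple of the coclosed form
  \<open>\<omega>\<close>.\<close>

lemma interior_product_H1_in_H2:
  assumes w: "\<omega> \<in> H1_forms k (Suc p)"
  shows "interior_product (\<lambda>x. x) \<omega> \<in> H2_forms (Suc k) p"
proof -
  let ?\<eta> = "interior_product (\<lambda>x. x) \<omega>"
  from w have pf: "\<omega> \<in> poly_forms k (Suc p)" and cd: "codiff UNIV \<omega> = 0"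
    by (auto simp: H1_forms_def H_forms_def)
  note alt = poly_formsD(1)[OF pf] and sm = poly_formsD(3)[OF pf]
  have "(\<lambda>x. ?\<eta> x vs) = (\<lambda>x. \<Sum>b\<in>Basis. (x \<bullet> b) * \<omega> x (b # vs))" for vs
    by (intro ext) (simp only: interior_product_def whole_space.position_slot[where \<omega> = \<omega>, OF alt UNIV_I])
  then have "homogeneous_polynomial (Suc k) (\<lambda>x. ?\<eta> x vs)" for vs
    using poly_formsD(2)[OF pf] by (auto intro!: homogeneous_polynomial_sum homogeneous_polynomial_inner_mult)
  moreover have "alternating p (?\<eta> x)" for x
    using alternating_Cons[OF alt[of x], of x] by (simp add: interior_product_def)
  ultimately have "?\<eta> \<in> poly_forms (Suc k) p" by (simp add: poly_forms_iff)
  moreover have c: "codiff UNIV ?\<eta> = 0"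
    by (intro ext) (simp add: whole_space.codiff_interior_product[OF sm alt] cd)
  moreover have "hodge_laplacian UNIV ?\<eta> = 0"
    using c cd by (simp add: hodge_laplacian_def form_d_interior_product_H1[OF w] codiff_scale[OF sm])
  moreover have "interior_product (\<lambda>x. x) ?\<eta> = 0"
    by (intro ext) (simp add: interior_product_def alternating_not_distinct[OF alt])
  ultimately show ?thesis by (simp add: H2_forms_def H_forms_def)
qed

lemma form_d_H2_in_H1:
  assumes w: "\<eta> \<in> H2_forms (Suc k) p"
  shows "form_d UNIV \<eta> \<in> H1_forms k (Suc p)"
proof -
  from w have pf: "\<eta> \<in> poly_forms (Suc k) p" and l: "hodge_laplacian UNIV \<eta> = 0" and cd: "codiff UNIV \<eta> = 0"
    by (auto simp: H2_forms_def H_forms_def)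
  note alt = poly_formsD(1)[OF pf] and sm = poly_formsD(3)[OF pf]
  have "homogeneous_polynomial k (\<lambda>x. \<Sum>i<length vs. (-1) ^ i * DV UNIV (vs ! i) (\<lambda>y. \<eta> y (omit i vs)) x)" for vs
    using homogeneous_polynomial_DV[OF poly_formsD(2)[OF pf]]
    by (intro homogeneous_polynomial_sum homogeneous_polynomial_cmult) simp
  then have "homogeneous_polynomial k (\<lambda>x. form_d UNIV \<eta> x vs)" for vs
    by (simp add: form_d_eq)
  moreover have "alternating (Suc p) (form_d UNIV \<eta> x)" for x
    by (rule whole_space.alternating_form_d[OF sm alt])
  ultimately have "form_d UNIV \<eta> \<in> poly_forms k (Suc p)" by (simp add: poly_forms_iff)
  moreover have d: "form_d UNIV (form_d UNIV \<eta>) = 0"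
    by (intro ext) (simp add: whole_space.form_d_form_d[OF sm])
  moreover have c: "codiff UNIV (form_d UNIV \<eta>) = 0"
    using l cd by (simp add: hodge_laplacian_def)
  ultimately show ?thesis
    by (simp add: H1_forms_def H_forms_def hodge_laplacian_def)
qed

lemma subspace_H1_forms: "forms.subspace (H1_forms k p :: 'a::euclidean_space form set)"
proof -
  have eq: "\<omega> \<in> H1_forms k p \<longleftrightarrow> \<omega> \<in> poly_forms k p \<and> codiff UNIV \<omega> = 0 \<and> form_d UNIV \<omega> = 0" for \<omega> :: "'a form"
    by (auto simp: H1_forms_def H_forms_def hodge_laplacian_def)
  show ?thesis
  proof (rule forms.subspaceI)
    show "(0 :: 'a form) \<in> H1_forms k p"
      by (simp add: eq poly_forms_iff homogeneous_polynomial_zero alternating_on_def)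
    fix \<omega> \<eta> :: "'a form" and c
    assume w: "\<omega> \<in> H1_forms k p"
    then have pw: "\<omega> \<in> poly_forms k p" by (simp add: eq)
    have "form_scale c \<omega> \<in> poly_forms k p"
      using poly_formsD(1,2)[OF pw]
      by (simp add: poly_forms_iff form_scale_def homogeneous_polynomial_cmult alternating_scale)
    then show "form_scale c \<omega> \<in> H1_forms k p"
      using w by (simp add: eq form_d_scale codiff_scale poly_formsD(3)[OF pw])
    assume h: "\<eta> \<in> H1_forms k p"
    then have ph: "\<eta> \<in> poly_forms k p" by (simp add: eq)
    have "\<omega> + \<eta> \<in> poly_forms k p"
      using poly_formsD(1,2)[OF pw] poly_formsD(1,2)[OF ph]
      by (simp add: poly_forms_iff plus_fun_def alternating_add homogeneous_polynomial_add)
    moreover have "codiff UNIV (\<omega> + \<eta>) = codiff UNIV \<omega> + codiff UNIV \<eta>"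
      using poly_formsD(3)[OF pw] poly_formsD(3)[OF ph]
      by (intro ext) (simp add: codiff_eq whole_space.DV_add smooth_formD sum.distrib)
    moreover have "form_d UNIV (\<omega> + \<eta>) = form_d UNIV \<omega> + form_d UNIV \<eta>"
      using poly_formsD(3)[OF pw] poly_formsD(3)[OF ph]
      by (intro ext) (simp add: form_d_eq whole_space.DV_add smooth_formD sum.distrib distrib_left)
    ultimately show "\<omega> + \<eta> \<in> H1_forms k p" using w h by (simp add: eq)
  qed
qed

lemma image_interior_product_H1:
  "interior_product (\<lambda>x. x) ` (H1_forms k (Suc p) :: 'a::euclidean_space form set) = H2_forms (Suc k) p"
  (is "?L = ?R")
proof
  show "?L \<subseteq> ?R"
    using interior_product_H1_in_H2 by auto
  show "?R \<subseteq> ?L"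
  proof
    fix \<eta> :: "'a form" assume h: "\<eta> \<in> H2_forms (Suc k) p"
    \<comment> \<open>Reciprocal of the factor by which the contraction of \<open>d \<eta>\<close>
      multiplies \<open>\<eta>\<close>; this makes the scaled \<open>d\<close> a right
      inverse.\<close>
    let ?c = "1 / (real (Suc k) + real p)"
    have "interior_product (\<lambda>x. x) (form_scale ?c (form_d UNIV \<eta>)) = \<eta>"
      by (simp add: interior_product_scale interior_product_form_d_H2[OF h] form_scale_form_scale
          del: of_nat_Suc)
    moreover have "form_scale ?c (form_d UNIV \<eta>) \<in> H1_forms k (Suc p)"
      by (rule forms.subspace_scale[OF subspace_H1_forms form_d_H2_in_H1[OF h]])
    ultimately show "\<eta> \<in> ?L" by (metis imageI)
  qed
qed

lemma inj_on_interior_product_H1: "inj_on (interior_product (\<lambda>x. x)) (H1_forms k (Suc p) :: 'a::euclidean_space form set)"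
proof (rule inj_onI)
  fix \<omega> \<eta> :: "'a form"
  assume w: "\<omega> \<in> H1_forms k (Suc p)" and h: "\<eta> \<in> H1_forms k (Suc p)"
    and "interior_product (\<lambda>x. x) \<omega> = interior_product (\<lambda>x. x) \<eta>"
  then have "form_d UNIV (interior_product (\<lambda>x. x) \<omega>) = form_d UNIV (interior_product (\<lambda>x. x) \<eta>)"
    by (simp only:)
  then have "form_scale (real k + real p + 1) \<omega> = form_scale (real k + real p + 1) \<eta>"
    by (simp only: form_d_interior_product_H1[OF w] form_d_interior_product_H1[OF h])
  then have "form_scale (1 / (real k + real p + 1)) (form_scale (real k + real p + 1) \<omega>)
      = form_scale (1 / (real k + real p + 1)) (form_scale (real k + real p + 1) \<eta>)" by (simp only:)
  then show "\<omega> = \<eta>" by (simp add: form_scale_form_scale add_nonneg_pos)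
qed

text \<open>A basis of \<open>V\<close> is carried to a basis of the image. Infinite bases are
  covered too, with cardinality 0 on both sides.\<close>

lemma dim_image_inj:
  fixes f :: "'a form \<Rightarrow> 'b form"
  assumes add: "\<And>x y. f (x + y) = f x + f y" and scale: "\<And>c x. f (form_scale c x) = form_scale c (f x)"
    and V: "forms.subspace V" and inj: "inj_on f V"
  shows "forms.dim (f ` V) = forms.dim V"
proof -
  interpret f: Vector_Spaces.linear "form_scale :: real \<Rightarrow> 'a form \<Rightarrow> 'a form"
    "form_scale :: real \<Rightarrow> 'b form \<Rightarrow> 'b form" f
    by unfold_locales (simp_all only: add scale)
  obtain B where B: "B \<subseteq> V" "forms.independent B" "V \<subseteq> forms.span B" "card B = forms.dim V"
    by (rule forms.basis_exists)
  have sp: "forms.span B = V"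
    using B(1,3) V by (metis forms.span_minimal subset_antisym)
  have "forms.independent (f ` B)"
    using f.independent_injective_image[OF B(2)] inj sp by simp
  moreover have "forms.span (f ` B) = f ` V" using f.span_image[of B] sp by simp
  moreover have "card (f ` B) = card B"
    by (rule card_image) (rule inj_on_subset[OF inj B(1)])
  ultimately show ?thesis
    using B(4) forms.dim_eq_card[of "f ` B" "f ` V"] by (metis forms.span_span)
qed

lemma M_dim_eq: "M_dim TYPE('a::euclidean_space) (Suc k) p = forms.dim (H1_forms k (Suc p) :: 'a form set)"
proof -
  have "forms.dim (interior_product (\<lambda>x. x) ` H1_forms k (Suc p) :: 'a form set)
      = forms.dim (H1_forms k (Suc p) :: 'a form set)"
    by (rule dim_image_inj[OF _ _ subspace_H1_forms inj_on_interior_product_H1])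
      (simp_all add: interior_product_def form_scale_def plus_fun_def)
  then show ?thesis by (simp add: M_dim_def image_interior_product_H1)
qed

subsection \<open>Forms of codimension one as vector fields\<close>

lemmas linear_vol_Cons = alternating_linear_Cons[OF alternating_vol]

lemma vol_scaleR_Cons: "vol (c *\<^sub>R w # vs) = c * vol (w # vs)"
  using linear_cmul[OF linear_vol_Cons, of c w vs] by simp

definition field_form :: "('a::euclidean_space \<Rightarrow> 'a) \<Rightarrow> 'a form" where
  "field_form W = (\<lambda>x vs. vol (W x # vs))"

lemma field_form_Basis: "field_form W x vs = (\<Sum>b\<in>Basis. (W x \<bullet> b) * vol (b # vs))"
  unfolding field_form_def by (rule linear_sum_Basis[OF linear_vol_Cons])

context convex_body
begin

definition divergence :: "('a \<Rightarrow> 'a) \<Rightarrow> 'a \<Rightarrow> real" where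
  "divergence W x = (\<Sum>b\<in>Basis. DV S b (\<lambda>y. W y \<bullet> b) x)"

context
  fixes W :: "'a \<Rightarrow> 'a"
  assumes W: "\<And>b. b \<in> Basis \<Longrightarrow> smooth_in S (\<lambda>x. W x \<bullet> b)"
begin

lemma smooth_form_field_form: "smooth_form S (field_form W)"
  unfolding smooth_form_def field_form_Basis
  by (intro allI smooth_in_sum smooth_in_mult smooth_in_const W)

lemma DV_field_form:
  "x \<in> S \<Longrightarrow> DV S v (\<lambda>y. field_form W y vs) x = (\<Sum>b\<in>Basis. DV S v (\<lambda>y. W y \<bullet> b) x * vol (b # vs))"
  by (simp add: field_form_Basis DV_sum DV_mult W)

lemma lap_field_form:
  "x \<in> S \<Longrightarrow> lap S (\<lambda>y. field_form W y vs) x = (\<Sum>b\<in>Basis. lap S (\<lambda>y. W y \<bullet> b) x * vol (b # vs))"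
  by (simp add: field_form_Basis lap_sum lap_mult W)

text \<open>The alternating sum is that of \<open>trace_identity\<close> for the Jacobian
  \<open>A\<close> of \<open>W\<close>, whose trace is the divergence.\<close>

lemma form_d_field_form:
  assumes x: "x \<in> S"
  shows "form_d S (field_form W) x vs = divergence W x * vol vs"
proof -
  define A where "A v = (\<Sum>b\<in>Basis. DV S v (\<lambda>y. W y \<bullet> b) x *\<^sub>R b)" for v
  have A: "linear A"
  proof (rule linearI)
    show "A (u + v) = A u + A v" for u v
      unfolding A_def sum.distrib[symmetric]
      by (intro sum.cong refl) (simp add: linear_add[OF linear_DV[OF W x]] scaleR_add_left)
    show "A (c *\<^sub>R v) = c *\<^sub>R A v" for c v
      unfolding A_def scaleR_sum_right
      by (intro sum.cong refl) (simp add: linear_cmul[OF linear_DV[OF W x]])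
  qed
  have Ab: "A v \<bullet> b = DV S v (\<lambda>y. W y \<bullet> b) x" if "b \<in> Basis" for v b
    using that by (simp add: A_def)
  have "DV S v (\<lambda>y. field_form W y us) x = vol (A v # us)" for v us
    using linear_sum_Basis[OF linear_vol_Cons, of "A v" us] by (simp add: DV_field_form[OF x] Ab)
  then have "form_d S (field_form W) x vs = (\<Sum>i<length vs. (-1) ^ i * vol (A (vs ! i) # omit i vs))"
    by (simp add: form_d_eq[OF x])
  also have "\<dots> = divergence W x * vol vs"
    unfolding trace_identity[OF A] divergence_def by (simp add: Ab)
  finally show ?thesis .
qed

lemma codiff_field_form:
  assumes x: "x \<in> S"
  shows "codiff S (field_form W) x vs
    = - (\<Sum>b\<in>Basis. \<Sum>c\<in>Basis. DV S b (\<lambda>y. W y \<bullet> c) x * vol (c # b # vs))"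
  by (simp add: codiff_eq[OF x] DV_field_form[OF x])

end

end

lemma vol_Cons_Cons_swap: "vol (a # b # vs) = - vol (b # a # vs)"
  using alternating_swap[OF alternating_vol, of "[]" a b vs] by simp

lemma vol_Basis_list:
  assumes "distinct bs" "set bs = (Basis :: 'a::euclidean_space set)"
  shows "vol bs \<noteq> 0"
proof -
  have "mset bs = mset (basis_enum :: 'a list)"
    using assms basis_enum by (metis set_eq_iff_mset_eq_distinct)
  from alternating_mset_zero_iff[OF alternating_vol this, of "[]"] show ?thesis
    by (simp add: vol_basis_enum)
qed

lemma vol_Cons_Basis_list:
  assumes "distinct (c # bs)" "set (c # bs) = (Basis :: 'a::euclidean_space set)"
  shows "vol (w # bs) = (w \<bullet> c) * vol (c # bs)"
proof -
  have "vol (w # bs) = (\<Sum>b\<in>Basis. (w \<bullet> b) * vol (b # bs))"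
    by (rule linear_sum_Basis[OF linear_vol_Cons])
  also have "\<dots> = (\<Sum>b\<in>{c}. (w \<bullet> b) * vol (b # bs))"
  proof (intro sum.mono_neutral_right ballI)
    fix b assume "b \<in> Basis - {c}"
    then have "\<not> distinct (b # bs)" using assms by auto
    then show "(w \<bullet> b) * vol (b # bs) = 0"
      using alternating_not_distinct[OF alternating_vol] by (metis mult_zero_right)
  qed (use assms in auto)
  finally show ?thesis by simp
qed

text \<open>Under \<open>W \<mapsto> i\<^sub>W vol\<close> the coclosed forms correspond to the curl-free fields.\<close>

lemma codiff_field_form_eq_zero_iff:
  fixes W :: "'a::euclidean_space \<Rightarrow> 'a"
  assumes W: "\<And>b. b \<in> Basis \<Longrightarrow> smooth_in UNIV (\<lambda>x. W x \<bullet> b)"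
  shows "codiff UNIV (field_form W) = 0 \<longleftrightarrow>
    (\<forall>x. \<forall>b\<in>Basis. \<forall>c\<in>Basis. DV UNIV b (\<lambda>y. W y \<bullet> c) x = DV UNIV c (\<lambda>y. W y \<bullet> b) x)"
    (is "_ \<longleftrightarrow> (\<forall>x. \<forall>b\<in>Basis. \<forall>c\<in>Basis. ?D x b c = ?D x c b)")
proof
  assume z: "codiff UNIV (field_form W) = 0"
  show "\<forall>x. \<forall>b\<in>Basis. \<forall>c\<in>Basis. ?D x b c = ?D x c b"
  proof (intro allI ballI)
    fix x b c :: 'a assume bc: "b \<in> Basis" "c \<in> Basis"
    show "?D x b c = ?D x c b"
    proof (cases "b = c")
      case False
      \<comment> \<open>Completing \<open>b\<close> and \<open>c\<close> to a basis selects one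
        component of the codifferential, in which only the two derivatives of the curl component
        survive.\<close>
      obtain us where us: "distinct us" "set us = (Basis :: 'a set) - {b, c}"
        using finite_distinct_list[of "Basis - {b, c}"] by auto
      define A where "A v = (\<Sum>e\<in>Basis. ?D x v e *\<^sub>R e)" for v
      have A: "A v \<bullet> e = ?D x v e" if "e \<in> Basis" for v e using that by (simp add: A_def)
      have "0 = (\<Sum>v\<in>Basis. vol (A v # v # us))"
        using whole_space.codiff_field_form[OF W, of x us] z linear_sum_Basis[OF linear_vol_Cons, of "A _"]
        by (simp add: A)
      also have "\<dots> = (\<Sum>v\<in>{b, c}. vol (A v # v # us))"
      proof (intro sum.mono_neutral_right ballI)
        fix v assume "v \<in> Basis - {b, c}"
        then have "\<not> distinct (A v # v # us)" using us by auto
        then show "vol (A v # v # us) = 0" by (rule alternating_not_distinct[OF alternating_vol])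
      qed (use bc in auto)
      also have "\<dots> = vol (A b # b # us) + vol (A c # c # us)" using False by simp
      also have "vol (A b # b # us) = ?D x b c * vol (c # b # us)"
        using vol_Cons_Basis_list[of c "b # us" "A b"] us bc False A by auto
      also have "vol (A c # c # us) = ?D x c b * vol (b # c # us)"
        using vol_Cons_Basis_list[of b "c # us" "A c"] us bc False A by auto
      finally have "(?D x b c - ?D x c b) * vol (c # b # us) = 0"
        using vol_Cons_Cons_swap[of b c us] by (auto simp: algebra_simps)
      moreover have "vol (c # b # us) \<noteq> 0"
        using us bc False by (intro vol_Basis_list) auto
      ultimately show ?thesis by simp
    qed simp
  qed
next
  assume sym: "\<forall>x. \<forall>b\<in>Basis. \<forall>c\<in>Basis. ?D x b c = ?D x c b"
  show "codiff UNIV (field_form W) = 0"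
  proof (intro ext)
    fix x vs
    let ?s = "\<Sum>b\<in>Basis. \<Sum>c\<in>Basis. ?D x b c * vol (c # b # vs)"
    \<comment> \<open>A symmetric matrix summed against an expression antisymmetric in
      \<open>b\<close> and \<open>c\<close>: exchanging the indices gives
      \<open>?s = - ?s\<close>.\<close>
    have "?s = (\<Sum>c\<in>Basis. \<Sum>b\<in>Basis. ?D x b c * vol (c # b # vs))" by (rule sum.swap)
    also have "\<dots> = (\<Sum>c\<in>Basis. \<Sum>b\<in>Basis. - (?D x c b * vol (b # c # vs)))"
    proof (intro sum.cong refl)
      fix c b :: 'a assume "c \<in> Basis" "b \<in> Basis"
      then show "?D x b c * vol (c # b # vs) = - (?D x c b * vol (b # c # vs))"
        using sym vol_Cons_Cons_swap[of c b vs] by simp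
    qed
    also have "\<dots> = - ?s" by (simp add: sum_negf)
    finally show "codiff UNIV (field_form W) x vs = 0 x vs"
      using whole_space.codiff_field_form[OF W, of x vs] by simp
  qed
qed

text \<open>Factor and argument list do not depend on \<open>\<alpha>\<close>, so smoothness,
  harmonicity and homogeneity pass from the coefficients of a form to the components of its
  field.\<close>

lemma dual_vector_Basis:
  assumes "b \<in> (Basis :: 'a::euclidean_space set)"
  obtains c us where "\<And>\<alpha>. dual_vector \<alpha> \<bullet> b = c * \<alpha> us"
proof -
  obtain i where "i < DIM('a)" "b = basis_enum ! i"
    using assms basis_enum(2)[where 'a='a] by (metis in_set_conv_nth length_basis_enum)
  then show ?thesis using that dual_vector_inner by metis
qed

section \<open>Forms \<open>f vol\<close> on the sphere and their harmonic extensions\<close>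

definition sphere_density :: "('a::euclidean_space \<Rightarrow> real) \<Rightarrow> 'a form" where
  "sphere_density f = (\<lambda>x vs. if x \<in> sphere 0 1 \<and> set vs \<subseteq> sphere_tangent x then f x * vol (x # vs) else 0)"

lemma sphere_density_cong: "(\<And>x. x \<in> sphere 0 1 \<Longrightarrow> f x = g x) \<Longrightarrow> sphere_density f = sphere_density g"
  by (auto simp: sphere_density_def fun_eq_iff)

lemma sphere_volume_eq: "sphere_volume = sphere_density (\<lambda>_. 1)"
  by (auto simp: sphere_volume_def sphere_density_def sphere_pullback_def interior_product_def
      inner_normal_def euclidean_volume_eq_vol fun_eq_iff)

lemma sphere_density_add: "sphere_density f + sphere_density g = sphere_density (\<lambda>x. f x + g x)"
  by (auto simp: sphere_density_def fun_eq_iff algebra_simps)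

lemma sphere_density_scale: "form_scale c (sphere_density f) = sphere_density (\<lambda>x. c * f x)"
  by (auto simp: sphere_density_def fun_eq_iff form_scale_def)

lemma sphere_density_zero: "sphere_density (\<lambda>_. 0) = 0"
  by (auto simp: sphere_density_def fun_eq_iff)

text \<open>The first slot already holds \<open>x\<close>, so multiples of \<open>x\<close> may be
  subtracted from all later slots.\<close>

lemma vol_tangential_part:
  "vol (x # us @ map (\<lambda>u. u - (u \<bullet> x) *\<^sub>R x) vs) = vol (x # us @ vs)"
proof (induction vs arbitrary: us)
  case (Cons v vs)
  let ?ys = "map (\<lambda>u. u - (u \<bullet> x) *\<^sub>R x) vs"
  have lin: "linear (\<lambda>w. vol ((x # us) @ w # ?ys))"
    by (rule alternating_linear_append[OF alternating_vol])
  have "vol ((x # us) @ x # ?ys) = 0"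
    by (rule alternating_not_distinct[OF alternating_vol]) simp
  then have "vol ((x # us) @ (v - (v \<bullet> x) *\<^sub>R x) # ?ys) = vol ((x # us) @ v # ?ys)"
    by (simp only: linear_diff[OF lin] linear_cmul[OF lin]) simp
  then show ?case using Cons[of "us @ [v]"] by simp
qed simp

text \<open>If the densities differed at \<open>x\<close>, the volume form of the tangent space
  would vanish there; by \<open>vol_tangential_part\<close> so would \<open>vol\<close> on every
  list starting with \<open>x\<close>, forcing \<open>x = 0\<close>.\<close>

lemma sphere_density_eqD:
  assumes eq: "sphere_density f = sphere_density g" and x: "x \<in> sphere 0 1"
  shows "f x = g x"
proof (rule ccontr)
  assume ne: "f x \<noteq> g x"
  have xx: "x \<bullet> x = 1" using x by (simp add: dot_square_norm)
  have "vol (x # us) = 0" for us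
  proof -
    let ?vs = "map (\<lambda>u. u - (u \<bullet> x) *\<^sub>R x) us"
    have "set ?vs \<subseteq> sphere_tangent x"
      by (auto simp: sphere_tangent_def inner_diff_left xx)
    then have "f x * vol (x # ?vs) = g x * vol (x # ?vs)"
      using fun_cong[OF fun_cong[OF eq], of x ?vs] x by (simp add: sphere_density_def)
    then show ?thesis using ne vol_tangential_part[of x "[]" us] by simp
  qed
  then have "x = 0" by (rule vol_Cons_eq_zeroD)
  then show False using x by simp
qed

text \<open>\<open>trace_identity\<close> for the rank-one map
  \<open>v \<mapsto> (x \<bullet> v) w\<close> on the list \<open>x # vs\<close>. The sum drops out
  when \<open>vs\<close> is tangential, or when \<open>vol\<close> vanishes on all lists starting
  with \<open>w\<close>, \<open>x\<close>; these are its two uses.\<close>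

lemma trace_identity_rank_one:
  fixes x w :: "'a::euclidean_space"
  shows "(x \<bullet> x) * vol (w # vs) - (\<Sum>i<length vs. (-1) ^ i * ((x \<bullet> vs ! i) * vol (w # x # omit i vs)))
    = (w \<bullet> x) * vol (x # vs)"
proof -
  let ?A = "\<lambda>v. (x \<bullet> v) *\<^sub>R w"
  have A: "linear ?A" by (intro linearI) (simp_all add: inner_add_right scaleR_add_left)
  have "(\<Sum>i<length (x # vs). (-1) ^ i * vol (?A ((x # vs) ! i) # omit i (x # vs)))
      = (x \<bullet> x) * vol (w # vs) - (\<Sum>i<length vs. (-1) ^ i * ((x \<bullet> vs ! i) * vol (w # x # omit i vs)))"
    by (simp add: sum.lessThan_Suc_shift vol_scaleR_Cons sum_negf del: sum.lessThan_Suc)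
  moreover have "(\<Sum>b\<in>Basis. ?A b \<bullet> b) = w \<bullet> x"
    by (simp add: euclidean_inner[of w x] mult.commute)
  ultimately show ?thesis using trace_identity[OF A, of "x # vs"] by simp
qed

lemma vol_Cons_tangential:
  assumes "norm x = 1" "set vs \<subseteq> sphere_tangent x"
  shows "vol (w # vs) = (w \<bullet> x) * vol (x # vs)"
proof -
  have "x \<bullet> vs ! i = 0" if "i < length vs" for i
    using assms(2) that by (metis (mono_tags) inner_commute mem_Collect_eq nth_mem sphere_tangent_def subsetD)
  then show ?thesis
    using trace_identity_rank_one[of x w vs] assms(1) by (simp add: dot_square_norm)
qed

lemma normal_if_vol_zero:
  assumes x: "norm x = 1" and z: "\<And>vs. vol (w # x # vs) = 0"
  shows "w = (w \<bullet> x) *\<^sub>R x"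
proof -
  have "vol ((w - (w \<bullet> x) *\<^sub>R x) # vs) = 0" for vs
    using trace_identity_rank_one[of x w vs] x z
    by (simp add: linear_diff[OF linear_vol_Cons] vol_scaleR_Cons dot_square_norm)
  from vol_Cons_eq_zeroD[OF this] show ?thesis by simp
qed

text \<open>The Laplace equation holds component by component. The condition
  \<open>i_N \<phi> = 0\<close> says that \<open>W\<close> is normal to the sphere, so its boundary
  values are determined by the density alone.\<close>

lemma harmonic_extension_field:
  fixes \<phi> :: "'a::euclidean_space form"
  assumes n: "DIM('a) = Suc n" and ext: "is_harmonic_extension n \<omega> \<phi>"
  defines "W \<equiv> \<lambda>x. dual_vector (\<phi> x)"
  shows "\<And>x vs. x \<in> disc \<Longrightarrow> \<phi> x vs = field_form W x vs"
    and "\<And>b. b \<in> Basis \<Longrightarrow> smooth_in disc (\<lambda>x. W x \<bullet> b)"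
    and "\<And>b x. b \<in> Basis \<Longrightarrow> x \<in> disc \<Longrightarrow> lap disc (\<lambda>x. W x \<bullet> b) x = 0"
    and "\<And>x. x \<in> sphere 0 1 \<Longrightarrow> W x = (W x \<bullet> x) *\<^sub>R x"
    and "\<omega> = sphere_density (\<lambda>x. W x \<bullet> x)"
proof -
  from ext have bf: "\<phi> \<in> ball_forms n" and hl: "hodge_laplacian disc \<phi> = 0"
    and pb: "sphere_pullback \<phi> = \<omega>"
    and nm: "\<And>x. x \<in> sphere 0 1 \<Longrightarrow> interior_product inner_normal \<phi> x = 0"
    by (auto simp: is_harmonic_extension_def)
  have alt: "alternating n (\<phi> x)" if "x \<in> disc" for x
    using bf that by (simp add: smooth_forms_def)
  have sm: "smooth_form disc \<phi>"
    unfolding smooth_form_def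
  proof
    fix vs
    show "smooth_in disc (\<lambda>x. \<phi> x vs)"
    proof (rule unit_ball.smooth_in_local)
      fix x :: 'a assume x: "x \<in> disc"
      from bspec[OF conjunct2[OF conjunct2[OF bf[unfolded smooth_forms_def mem_Collect_eq]]] x]
      obtain U \<eta> where "open U \<and> x \<in> U \<and> (\<forall>y\<in>U. alternating n (\<eta> y)) \<and>
        (\<forall>vs k. Ck_on k (\<lambda>y. \<eta> y vs) U) \<and>
        (\<forall>y\<in>disc \<inter> U. \<forall>vs. set vs \<subseteq> UNIV \<longrightarrow> \<phi> y vs = \<eta> y vs)"
        by (elim exE)
      then show "\<exists>U g. open U \<and> x \<in> U \<and> (\<forall>k. Ck_on k g U) \<and> (\<forall>y\<in>disc \<inter> U. \<phi> y vs = g y)"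
        by (intro exI[of _ U] exI[of _ "\<lambda>y. \<eta> y vs"]) auto
    qed
  qed
  show rep: "\<phi> x vs = field_form W x vs" if "x \<in> disc" for x vs
    unfolding field_form_def W_def by (rule vol_dual_vector[OF n alt[OF that]])
  show "smooth_in disc (\<lambda>x. W x \<bullet> b)" if b: "b \<in> Basis" for b
  proof -
    from b obtain c us where "\<And>\<alpha>. dual_vector \<alpha> \<bullet> b = c * \<alpha> us" by (rule dual_vector_Basis) blast
    then show ?thesis using smooth_formD[OF sm] by (simp add: W_def)
  qed
  show "lap disc (\<lambda>x. W x \<bullet> b) x = 0" if b: "b \<in> Basis" and x: "x \<in> disc" for b x
  proof -
    from b obtain c us where d: "\<And>\<alpha>. dual_vector \<alpha> \<bullet> b = c * \<alpha> us" by (rule dual_vector_Basis) blast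
    have "lap disc (\<lambda>x. \<phi> x us) x = 0"
      using unit_ball.hodge_laplacian_eq[OF sm x, of us] hl by simp
    then show ?thesis
      using unit_ball.lap_cmult[OF smooth_formD[OF sm] x] by (simp add: W_def d)
  qed
  show "W x = (W x \<bullet> x) *\<^sub>R x" if x: "x \<in> sphere 0 1" for x
  proof (rule normal_if_vol_zero)
    show "norm x = 1" using x by simp
    fix vs
    have "\<phi> x (- x # vs) = 0"
      using fun_cong[OF nm[OF x], of vs] by (simp add: interior_product_def inner_normal_def)
    then have "vol ([W x] @ (- x) # vs) = 0" using rep[of x "- x # vs"] x by (simp add: field_form_def)
    then show "vol (W x # x # vs) = 0"
      using linear_neg[OF alternating_linear_append[OF alternating_vol, of "[W x]" vs], of x] by simp
  qed
  show "\<omega> = sphere_density (\<lambda>x. W x \<bullet> x)"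
    using rep vol_Cons_tangential[of _ _ "W _"]
    by (auto simp: pb[symmetric] sphere_pullback_def sphere_density_def fun_eq_iff field_form_def)
qed

text \<open>Equal densities give equal normal fields on the sphere, and the components are harmonic;
  outside the ball both forms are 0 by convention.\<close>

lemma harmonic_extension_unique:
  fixes \<phi> \<psi> :: "'a::euclidean_space form"
  assumes n: "DIM('a) = Suc n"
    and e1: "is_harmonic_extension n \<omega> \<phi>" and e2: "is_harmonic_extension n \<omega> \<psi>"
  shows "\<phi> = \<psi>"
proof (intro ext)
  fix x vs
  note f1 = harmonic_extension_field[OF n e1] and f2 = harmonic_extension_field[OF n e2]
  show "\<phi> x vs = \<psi> x vs"
  proof (cases "x \<in> disc")
    case True
    have "dual_vector (\<phi> x) \<bullet> b = dual_vector (\<psi> x) \<bullet> b" if b: "b \<in> Basis" for b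
    proof (rule harmonic_unique[OF f1(2,3)[OF b] f2(2,3)[OF b] _ True])
      fix y :: 'a assume y: "y \<in> sphere 0 1"
      have "dual_vector (\<phi> y) \<bullet> y = dual_vector (\<psi> y) \<bullet> y"
        using sphere_density_eqD[OF _ y] f1(5) f2(5) by metis
      then show "dual_vector (\<phi> y) \<bullet> b = dual_vector (\<psi> y) \<bullet> b"
        using f1(4)[OF y] f2(4)[OF y] by metis
    qed
    then have "dual_vector (\<phi> x) = dual_vector (\<psi> x)" by (rule euclidean_eqI)
    then show ?thesis using f1(1)[OF True] f2(1)[OF True] by (simp add: field_form_def)
  next
    case False
    then show ?thesis using e1 e2 by (auto simp: is_harmonic_extension_def smooth_forms_def)
  qed
qed

text \<open>Since the inner normal is \<open>- x\<close>, the operator contracts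
  \<open>d \<phi> = (div W) vol\<close> with \<open>+ x\<close>, whence the density
  \<open>div W\<close> without a sign.\<close>

lemma dn_operator_eq:
  fixes \<phi> :: "'a::euclidean_space form"
  assumes n: "DIM('a) = Suc n" and ex: "is_harmonic_extension n \<omega> \<phi>"
    and rep: "\<And>x vs. x \<in> disc \<Longrightarrow> \<phi> x vs = field_form W x vs"
    and W: "\<And>b. b \<in> Basis \<Longrightarrow> smooth_in disc (\<lambda>x. W x \<bullet> b)"
  shows "dn_operator n \<omega> = sphere_density (unit_ball.divergence W)"
proof -
  have he: "harmonic_extension n \<omega> = \<phi>"
    unfolding harmonic_extension_def
    using ex harmonic_extension_unique[OF n] by (intro the_equality) auto
  have d: "form_d disc \<phi> x vs = unit_ball.divergence W x * vol vs" if x: "x \<in> disc" for x vs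
  proof -
    have "form_d disc \<phi> x vs = form_d disc (field_form W) x vs"
      unfolding form_d_eq[OF x]
      by (intro sum.cong refl arg_cong2[where f = "(*)"] DV_cong rep x)
    then show ?thesis using unit_ball.form_d_field_form[OF W x] by simp
  qed
  have neg: "vol (- x # vs) = - vol (x # vs)" for x :: 'a and vs
    using linear_neg[OF linear_vol_Cons] by blast
  show ?thesis
    unfolding dn_operator_def he
  proof (intro ext)
    fix x vs
    show "sphere_pullback (- interior_product inner_normal (form_d disc \<phi>)) x vs
        = sphere_density (unit_ball.divergence W) x vs"
      by (simp add: sphere_pullback_def sphere_density_def interior_product_def inner_normal_def d neg)
  qed
qed

lemma sphere_density_in_sphere_forms:
  fixes f :: "'a::euclidean_space \<Rightarrow> real"
  assumes n: "DIM('a) = Suc n" and f: "smooth_in UNIV f"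
  shows "sphere_density f \<in> sphere_forms n"
proof -
  define \<eta> where "\<eta> y vs = f y * vol (y # vs)" for y :: 'a and vs
  have alt: "alternating n (\<eta> y)" for y
    unfolding \<eta>_def[abs_def] using alternating_vol[where 'a='a] n
    by (intro alternating_scale alternating_Cons) simp
  have "alternating_on n (sphere_tangent x) (sphere_density f x)" if x: "x \<in> sphere 0 1" for x
  proof -
    have eq: "sphere_density f x vs = (if set vs \<subseteq> sphere_tangent x then \<eta> x vs else 0)" for vs
      using x by (simp add: sphere_density_def \<eta>_def)
    have upd: "set (vs[i := u]) \<subseteq> sphere_tangent x" if "set vs \<subseteq> sphere_tangent x" "u \<in> sphere_tangent x" for vs i u
      using that set_update_subset_insert[of vs i u] by blast
    have comb: "a *\<^sub>R u + b *\<^sub>R w \<in> sphere_tangent x" if "u \<in> sphere_tangent x" "w \<in> sphere_tangent x" for a b u w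
      using that by (simp add: sphere_tangent_def inner_add_left)
    show ?thesis
      unfolding alternating_on_def eq
      using alternating_length[OF alt] alternating_update[OF alt] alternating_not_distinct[OF alt]
      by (auto simp: upd comb)
  qed
  moreover have "\<forall>vs k. Ck_on k (\<lambda>y. \<eta> y vs) UNIV"
  proof -
    have "smooth_in UNIV (\<lambda>y. \<eta> y vs)" for vs
    proof -
      have "(\<lambda>y. \<eta> y vs) = (\<lambda>y. f y * (\<Sum>b\<in>Basis. (y \<bullet> b) * vol (b # vs)))"
        unfolding \<eta>_def using linear_sum_Basis[OF linear_vol_Cons] by metis
      then show ?thesis using f by simp
    qed
    then show ?thesis by (simp add: smooth_in_def C_in_UNIV)
  qed
  ultimately show ?thesis
    using alt unfolding smooth_forms_def
    by (auto simp: sphere_density_def \<eta>_def fun_eq_iff intro!: exI[of _ UNIV] exI[of _ \<eta>])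
qed

text \<open>Provides the extensions for polynomial data. On the sphere \<open>W\<close> is a
  multiple of \<open>x\<close>, so contracting with the normal repeats \<open>x\<close> inside
  \<open>vol\<close>, and restriction leaves the density \<open>f\<close>.\<close>

lemma is_harmonic_extension_field:
  fixes W :: "'a::euclidean_space \<Rightarrow> 'a"
  assumes n: "DIM('a) = Suc n" and W: "\<And>b. b \<in> Basis \<Longrightarrow> smooth_in UNIV (\<lambda>x. W x \<bullet> b)"
    and harm: "\<And>b x. b \<in> Basis \<Longrightarrow> lap UNIV (\<lambda>x. W x \<bullet> b) x = 0"
    and bd: "\<And>x. x \<in> sphere 0 1 \<Longrightarrow> W x = f x *\<^sub>R x"
  shows "is_harmonic_extension n (sphere_density f) (\<lambda>x vs. if x \<in> disc then field_form W x vs else 0)"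
    (is "is_harmonic_extension _ _ ?\<phi>")
proof -
  have alt: "alternating n (field_form W x)" for x
    unfolding field_form_def using alternating_vol[where 'a='a] n by (intro alternating_Cons) simp
  have sm: "smooth_form UNIV (field_form W)" by (rule whole_space.smooth_form_field_form[OF W])
  then have Ck: "Ck_on k (\<lambda>y. field_form W y vs) UNIV" for k vs
    by (simp add: smooth_form_def smooth_in_def C_in_UNIV)
  have smd: "smooth_in disc (\<lambda>y. field_form W y vs)" for vs
    by (rule unit_ball.smooth_in_UNIV_imp[OF smooth_formD[OF sm]])
  have phi: "smooth_form disc ?\<phi>"
    unfolding smooth_form_def
  proof
    fix vs
    show "smooth_in disc (\<lambda>x. ?\<phi> x vs)"
      using smooth_in_cong[of disc "\<lambda>x. ?\<phi> x vs" "\<lambda>y. field_form W y vs"] smd by simp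
  qed
  have "?\<phi> \<in> ball_forms n"
    unfolding smooth_forms_def using alt Ck
    by (auto simp: alternating_zero fun_eq_iff intro!: exI[of _ UNIV] exI[of _ "field_form W"])
  moreover have "hodge_laplacian disc ?\<phi> = 0"
  proof (intro ext)
    fix x vs
    show "hodge_laplacian disc ?\<phi> x vs = 0 x vs"
    proof (cases "x \<in> disc")
      case True
      have "lap disc (\<lambda>y. ?\<phi> y vs) x = lap disc (\<lambda>y. field_form W y vs) x"
        using True by (intro unit_ball.lap_cong) auto
      also have "\<dots> = 0"
        using unit_ball.lap_UNIV_eq[OF smooth_formD[OF sm] True] whole_space.lap_field_form[OF W, of x vs] harm
        by simp
      finally show ?thesis using unit_ball.hodge_laplacian_eq[OF phi True] by simp
    next
      case False
      then show ?thesis by (simp add: hodge_laplacian_def form_d_def codiff_def)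
    qed
  qed
  moreover have "sphere_pullback ?\<phi> = sphere_density f"
  proof (intro ext)
    fix x vs
    show "sphere_pullback ?\<phi> x vs = sphere_density f x vs"
      using bd[of x] by (auto simp: sphere_pullback_def sphere_density_def field_form_def vol_scaleR_Cons)
  qed
  moreover have "interior_product inner_normal ?\<phi> x = 0" if x: "x \<in> sphere 0 1" for x
  proof
    fix vs
    have "vol (x # x # vs) = 0" by (rule alternating_not_distinct[OF alternating_vol]) simp
    then have "vol (x # (- x) # vs) = 0"
      using linear_neg[OF alternating_linear_append[OF alternating_vol, of "[x]" vs], of x] by simp
    then show "interior_product inner_normal ?\<phi> x vs = 0 vs"
      using bd[OF x] x by (simp add: interior_product_def inner_normal_def field_form_def vol_scaleR_Cons)
  qed
  ultimately show ?thesis by (simp add: is_harmonic_extension_def)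
qed

subsection \<open>Eigenspaces\<close>

definition harmonic_polynomials :: "nat \<Rightarrow> ('a::euclidean_space \<Rightarrow> real) set" where
  "harmonic_polynomials k = {p. homogeneous_polynomial k p \<and> (\<forall>x. lap UNIV p x = 0)}"

lemma harmonic_polynomialsD:
  assumes "p \<in> harmonic_polynomials k"
  shows "homogeneous_polynomial k p" "smooth_in UNIV p" "radial UNIV p x = k * p x" "lap UNIV p x = 0"
  using assms by (auto simp: harmonic_polynomials_def homogeneous_polynomial_iff)

lemma zero_harmonic_polynomial: "(\<lambda>_. 0) \<in> harmonic_polynomials k"
  by (simp add: harmonic_polynomials_def homogeneous_polynomial_zero)

lemma homogeneous_polynomial_lap: "homogeneous_polynomial k p \<Longrightarrow> homogeneous_polynomial (k - 1 - 1) (lap UNIV p)"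
  unfolding lap_def[abs_def] by (intro homogeneous_polynomial_sum homogeneous_polynomial_DV)

lemma lap_DV_harmonic:
  assumes "p \<in> harmonic_polynomials k" shows "lap UNIV (DV UNIV v p) x = 0"
proof -
  have "lap UNIV (DV UNIV v p) x = DV UNIV v (lap UNIV p) x"
    by (rule whole_space.lap_DV[OF harmonic_polynomialsD(2)[OF assms]]) simp
  also have "\<dots> = DV UNIV v (\<lambda>_. 0) x"
    by (rule DV_cong) (simp_all add: harmonic_polynomialsD(4)[OF assms])
  finally show ?thesis by simp
qed

lemma homogeneous_polynomial_eq_sphere:
  assumes p: "homogeneous_polynomial k p" and q: "homogeneous_polynomial k q" and k: "k \<ge> 1"
    and eq: "\<And>x. x \<in> sphere 0 1 \<Longrightarrow> p x = q x"
  shows "p x = q x"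
proof -
  let ?u = "if x = 0 then x else x /\<^sub>R norm x"
  have x: "x = norm x *\<^sub>R ?u" by simp
  have "p x = norm x ^ k * p ?u" "q x = norm x ^ k * q ?u"
    using homogeneous_polynomial_scaleR[OF p, of "norm x" ?u] homogeneous_polynomial_scaleR[OF q, of "norm x" ?u] x
    by simp_all
  then show ?thesis using eq[of ?u] k by (cases "x = 0") (auto simp: power_0_left)
qed

text \<open>For polynomial data \<open>u\<close> is a multiple of the gradient of \<open>p\<close>.
  The constant \<open>a\<close> has no gradient and contributes only the field \<open>a x\<close>,
  of divergence \<open>(n + 1) a\<close>.\<close>

lemma dn_operator_harmonic_polynomial:
  fixes p :: "'a::euclidean_space \<Rightarrow> real"
  assumes n: "n \<ge> 1" "DIM('a) = Suc n" and k: "k \<ge> 1" and p: "p \<in> harmonic_polynomials k"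
  shows "sphere_density (\<lambda>x. a + p x) \<in> dn_domain n"
    and "dn_operator n (sphere_density (\<lambda>x. a + p x)) = sphere_density (\<lambda>x. (real n + 1) * a + nu1 k n * p x)"
proof -
  note ps = harmonic_polynomialsD(2)[OF p]
  \<comment> \<open>The operator \<open>n + 1 + 2 R\<close> acts on the partial derivatives of
    \<open>p\<close>, of degree \<open>k - 1\<close>, as multiplication by
    \<open>n + 1 + 2 (k - 1)\<close>.\<close>
  define D where "D = real n + 2 * real k - 1"
  have D: "D > 0" using n k by (simp add: D_def)
  define u where "u b x = 1 / D * DV UNIV b p x" for b x
  define q where "q x = a + p x" for x
  define W where "W x = q x *\<^sub>R x + ((1 - x \<bullet> x) * (1 / D)) *\<^sub>R (\<Sum>b\<in>Basis. DV UNIV b p x *\<^sub>R b)" for x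
  have Wb: "W x \<bullet> b = (x \<bullet> b) * q x + (1 - x \<bullet> x) * u b x" if "b \<in> Basis" for x b
    using that by (simp add: W_def u_def inner_add_left)
  have qs: "smooth_in UNIV q" using ps by (simp add: q_def[abs_def])
  have DVq: "DV UNIV v q x = DV UNIV v p x" for v x
    using ps by (simp add: q_def[abs_def] whole_space.DV_add)
  have ql: "lap UNIV q x = 0" for x
    using ps harmonic_polynomialsD(4)[OF p] by (simp add: q_def[abs_def] whole_space.lap_add)
  have us: "smooth_in UNIV (u b)" for b
    unfolding u_def[abs_def] by (intro whole_space.smooth_in_mult whole_space.smooth_in_const smooth_in_DV ps)
  have ul: "lap UNIV (u b) x = 0" for b x
  proof -
    have "lap UNIV (u b) x = 1 / D * lap UNIV (DV UNIV b p) x"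
      unfolding u_def[abs_def] by (rule whole_space.lap_cmult[OF smooth_in_DV[OF ps] UNIV_I])
    then show ?thesis by (simp add: lap_DV_harmonic[OF p])
  qed
  have ur: "real DIM('a) * u b x + 2 * radial UNIV (u b) x = DV UNIV b q x" for b x
  proof -
    have "radial UNIV (DV UNIV b p) x = real (k - 1) * DV UNIV b p x"
      using homogeneous_polynomial_DV[OF harmonic_polynomialsD(1)[OF p]] by (simp add: homogeneous_polynomial_iff)
    moreover have "radial UNIV (u b) x = 1 / D * radial UNIV (DV UNIV b p) x"
      unfolding radial_def u_def[abs_def] by (rule whole_space.DV_cmult[OF smooth_in_DV[OF ps] UNIV_I])
    ultimately have "radial UNIV (u b) x = (real k - 1) * u b x"
      using k by (simp add: u_def of_nat_diff)
    then have "real DIM('a) * u b x + 2 * radial UNIV (u b) x = D * u b x"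
      by (simp add: D_def n algebra_simps)
    then show ?thesis using D by (simp add: u_def DVq)
  qed
  note field = whole_space.harmonic_field[of q u, OF qs ql us ul ur UNIV_I]
  have Ws: "smooth_in UNIV (\<lambda>x. W x \<bullet> b)" if b: "b \<in> Basis" for b
    using qs us by (simp add: Wb[OF b])
  have Wl: "lap UNIV (\<lambda>x. W x \<bullet> b) x = 0" if b: "b \<in> Basis" for b x
    using field(1)[OF b] by (simp add: Wb[OF b])
  have bd: "W x = q x *\<^sub>R x" if "x \<in> sphere 0 1" for x
    using that by (simp add: W_def dot_square_norm)
  let ?\<phi> = "\<lambda>x vs. if x \<in> disc then field_form W x vs else 0"
  have ext: "is_harmonic_extension n (sphere_density q) ?\<phi>"
    by (rule is_harmonic_extension_field[OF n(2) Ws Wl bd])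
  have "\<exists>!\<phi>. is_harmonic_extension n (sphere_density q) \<phi>"
    using ext harmonic_extension_unique[OF n(2)] by blast
  then show "sphere_density (\<lambda>x. a + p x) \<in> dn_domain n"
    using sphere_density_in_sphere_forms[OF n(2) qs] by (simp add: dn_domain_def q_def[abs_def])
  have div: "unit_ball.divergence W x = (real n + 1) * a + nu1 k n * p x" if x: "x \<in> sphere 0 1" for x
  proof -
    have xd: "x \<in> disc" and xx: "x \<bullet> x = 1" using x by (auto simp: dot_square_norm)
    have "unit_ball.divergence W x
        = (\<Sum>b\<in>Basis. DV UNIV b (\<lambda>x. (x \<bullet> b) * q x + (1 - x \<bullet> x) * u b x) x)"
      unfolding unit_ball.divergence_def
    proof (intro sum.cong refl)
      fix b :: 'a assume b: "b \<in> Basis"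
      have "DV disc b (\<lambda>x. W x \<bullet> b) x = DV UNIV b (\<lambda>x. W x \<bullet> b) x"
        by (rule unit_ball.DV_UNIV_eq[OF Ws[OF b] xd])
      also have "\<dots> = DV UNIV b (\<lambda>x. (x \<bullet> b) * q x + (1 - x \<bullet> x) * u b x) x"
        by (rule DV_cong) (simp_all only: Wb[OF b] UNIV_I)
      finally show "DV disc b (\<lambda>x. W x \<bullet> b) x = DV UNIV b (\<lambda>x. (x \<bullet> b) * q x + (1 - x \<bullet> x) * u b x) x" .
    qed
    also have "\<dots> = (real n + 1) * q x + radial UNIV q x - 2 * (\<Sum>b\<in>Basis. (x \<bullet> b) * u b x)"
      using field(2)[of x] by (simp add: n xx add.commute)
    also have "radial UNIV q x = k * p x"
      using harmonic_polynomialsD(3)[OF p] by (simp add: radial_def DVq)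
    also have "(\<Sum>b\<in>Basis. (x \<bullet> b) * u b x) = 1 / D * (k * p x)"
      using harmonic_polynomialsD(3)[OF p, of x] whole_space.radial_Basis[OF ps, of x]
      by (simp add: u_def sum_divide_distrib[symmetric])
    also have "(real n + 1) * q x + k * p x - 2 * (1 / D * (k * p x)) = (real n + 1) * a + nu1 k n * p x"
    proof -
      \<comment> \<open>On the sphere the divergence contributes \<open>n + 1\<close> from
        \<open>q\<close>, \<open>k\<close> from \<open>R q\<close> and \<open>- 2 k / D\<close> from
        \<open>x \<bullet> u\<close>; their sum is \<open>nu1 k n\<close>.\<close>
      have e: "nu1 k n = real n + 1 + k - 2 * k / D"
        using D by (simp add: nu1_def D_def field_simps)
      show ?thesis unfolding e q_def by (simp add: algebra_simps)
    qed
    finally show ?thesis .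
  qed
  have "dn_operator n (sphere_density q) = sphere_density (unit_ball.divergence W)"
    using unit_ball.smooth_in_UNIV_imp[OF Ws] by (intro dn_operator_eq[OF n(2) ext]) auto
  also have "\<dots> = sphere_density (\<lambda>x. (real n + 1) * a + nu1 k n * p x)"
    by (rule sphere_density_cong[OF div])
  finally show "dn_operator n (sphere_density (\<lambda>x. a + p x)) = sphere_density (\<lambda>x. (real n + 1) * a + nu1 k n * p x)"
    by (simp add: q_def[abs_def])
qed

lemma dn_eigenspace_cases:
  fixes \<omega> :: "'a::euclidean_space form"
  assumes n: "n \<ge> 1" "DIM('a) = Suc n" and \<omega>: "\<omega> \<in> dn_eigenspace n \<mu>"
  obtains a where "a * (\<mu> - (real n + 1)) = 0" "\<omega> = sphere_density (\<lambda>_. a)"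
  | a k p where "a * (\<mu> - (real n + 1)) = 0" "k \<ge> 1" "nu1 k n = \<mu>" "p \<in> harmonic_polynomials k"
      "\<omega> = sphere_density (\<lambda>x. a + p x)"
proof -
  from \<omega> obtain \<phi> where ext: "is_harmonic_extension n \<omega> \<phi>" and T: "dn_operator n \<omega> = form_scale \<mu> \<omega>"
    by (auto simp: dn_eigenspace_def dn_domain_def)
  define W where "W x = dual_vector (\<phi> x)" for x
  note W = harmonic_extension_field[OF n(2) ext, folded W_def]
  define g where "g = unit_ball.divergence W"
  have gs: "smooth_in disc g"
    unfolding g_def unit_ball.divergence_def[abs_def] by (intro unit_ball.smooth_in_sum smooth_in_DV W(2))
  have gl: "lap disc g x = 0" if x: "x \<in> disc" for x
  proof -
    have "lap disc (DV disc b (\<lambda>y. W y \<bullet> b)) x = 0" if b: "b \<in> Basis" for b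
    proof -
      have "lap disc (DV disc b (\<lambda>y. W y \<bullet> b)) x = DV disc b (lap disc (\<lambda>y. W y \<bullet> b)) x"
        by (rule unit_ball.lap_DV[OF W(2)[OF b] x])
      also have "\<dots> = DV disc b (\<lambda>_. 0) x" by (rule DV_cong[OF W(3)[OF b] x])
      finally show ?thesis using x by simp
    qed
    then show ?thesis
      using x by (simp add: g_def unit_ball.divergence_def[abs_def] unit_ball.lap_sum smooth_in_DV W(2))
  qed
  have "sphere_density g = sphere_density (\<lambda>x. \<mu> * (W x \<bullet> x))"
    using dn_operator_eq[OF n(2) ext W(1,2)] T W(5) by (simp add: g_def sphere_density_scale)
  then have bd: "g x = \<mu> * (W x \<bullet> x)" if "x \<in> sphere 0 1" for x
    by (rule sphere_density_eqD[OF _ that])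
  define f where "f x = (\<Sum>b\<in>Basis. (x \<bullet> b) * (W x \<bullet> b))" for x
  have f: "f x = W x \<bullet> x" for x by (simp add: f_def euclidean_inner[of "W x" x] mult.commute)
  have fs: "smooth_in disc f" using W(2) by (simp add: f_def[abs_def])
  have fl: "lap disc f x = 2 * g x" if x: "x \<in> disc" for x
  proof -
    have "lap disc (\<lambda>x. (x \<bullet> b) * (W x \<bullet> b)) x = 2 * DV disc b (\<lambda>x. W x \<bullet> b) x" if b: "b \<in> Basis" for b
    proof -
      have "lap disc (\<lambda>x. (x \<bullet> b) * (W x \<bullet> b)) x = 2 * (\<Sum>c\<in>Basis. (b \<bullet> c) * DV disc c (\<lambda>x. W x \<bullet> b) x)"
        using W(2,3)[OF b] x by (simp add: unit_ball.lap_mult unit_ball.lap_inner unit_ball.DV_inner inner_commute)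
      then show ?thesis using DV_Basis[OF W(2)[OF b] x, of b] by simp
    qed
    then show ?thesis
      using x by (simp add: f_def[abs_def] unit_ball.lap_sum W(2) g_def unit_ball.divergence_def sum_distrib_left)
  qed
  \<comment> \<open>The harmonic extension of the boundary density: \<open>g / \<mu>\<close>, or \<open>W \<bullet> x\<close> when \<open>\<mu> = 0\<close> forces \<open>div W = 0\<close>.\<close>
  obtain q where qs: "smooth_in disc q" and ql: "\<And>x. x \<in> disc \<Longrightarrow> lap disc q x = 0"
    and qb: "\<And>x. x \<in> sphere 0 1 \<Longrightarrow> q x = W x \<bullet> x" and qg: "\<And>x. x \<in> disc \<Longrightarrow> g x = \<mu> * q x"
  proof (cases "\<mu> = 0")
    case False
    show ?thesis
    proof (rule that[of "\<lambda>x. 1 / \<mu> * g x"])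
      show "lap disc (\<lambda>x. 1 / \<mu> * g x) x = 0" if "x \<in> disc" for x
        unfolding unit_ball.lap_cmult[OF gs that] gl[OF that] by simp
    qed (use gs bd False in auto)
  next
    case True
    have "g x = 0" if "x \<in> disc" for x
      using harmonic_unique[OF gs gl, of "\<lambda>_. 0"] bd that True by simp
    then show ?thesis
      using that[of f] fs fl f True by simp
  qed
  have Wq: "W x = q x *\<^sub>R x" if "x \<in> sphere 0 1" for x
    using W(4)[OF that] qb[OF that] by simp
  have div: "(\<Sum>b\<in>Basis. DV disc b (\<lambda>x. W x \<bullet> b) x) = \<mu> * q x" if "x \<in> disc" for x
    using qg[OF that] by (simp add: g_def unit_ball.divergence_def)
  have dim: "DIM('a) = n + 1" using n by simp
  have a: "q 0 * (\<mu> - (real n + 1)) = 0"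
    using eigenfunction_structure(1)[OF n(1) dim qs ql W(2,3) Wq div] by (simp add: mult.commute)
  have \<omega>q: "\<omega> = sphere_density q"
    unfolding W(5) by (rule sphere_density_cong) (simp add: qb)
  consider "\<forall>x\<in>disc. q x = q 0"
    | k where "k \<ge> 1" "nu1 k n = \<mu>" "\<forall>x\<in>disc. radial disc (\<lambda>x. q x - q 0) x = k * (q x - q 0)"
    using eigenfunction_structure(2)[OF n(1) dim qs ql W(2,3) Wq div] by blast
  then show thesis
  proof cases
    case 1
    then have "\<omega> = sphere_density (\<lambda>_. q 0)"
      unfolding \<omega>q
    proof (intro sphere_density_cong)
      show "q x = q 0" if "x \<in> sphere 0 1" for x
        using 1 that sphere_cball[of 0 1] by blast
    qed
    then show thesis using that(1) a by blast
  next
    case 2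
    have ps: "smooth_in disc (\<lambda>x. q x - q 0)" using qs by simp
    obtain P where P: "homogeneous_polynomial k P" "\<And>x. x \<in> disc \<Longrightarrow> q x - q 0 = P x"
      using unit_ball.Euler_homogeneous_polynomial[OF ps, of k] 2(3) by auto
    have "lap UNIV P x = 0" if "x \<in> disc" for x
    proof -
      have "lap UNIV P x = lap disc P x"
        by (rule unit_ball.lap_UNIV_eq[OF smooth_in_homogeneous_polynomial[OF P(1)] that, symmetric])
      also have "\<dots> = lap disc (\<lambda>x. q x - q 0) x"
        using P(2) that by (intro unit_ball.lap_cong) auto
      also have "\<dots> = 0" using qs ql[OF that] that by (simp add: unit_ball.lap_diff)
      finally show ?thesis .
    qed
    \<comment> \<open>Harmonicity is known only on the ball; the Laplacian of \<open>P\<close> is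
      itself a homogeneous polynomial, so it vanishes everywhere.\<close>
    then have "P \<in> harmonic_polynomials k"
      using P(1) homogeneous_polynomial_eq_zero[OF homogeneous_polynomial_lap[OF P(1)]]
      by (simp add: harmonic_polynomials_def)
    moreover have "\<omega> = sphere_density (\<lambda>x. q 0 + P x)"
      unfolding \<omega>q
    proof (intro sphere_density_cong)
      show "q x = q 0 + P x" if "x \<in> sphere 0 1" for x
        using P(2)[of x] that by simp
    qed
    ultimately show thesis using that(2) a 2 by blast
  qed
qed

text \<open>A form in \<open>H1_forms (k - 1) n\<close> is \<open>i\<^sub>W vol\<close> with \<open>W = \<nabla> p / k\<close>, where \<open>p = W \<bullet> x\<close>.\<close>

lemma H1_forms_gradient:
  fixes \<omega> :: "'a::euclidean_space form"
  assumes n: "DIM('a) = Suc n" and w: "\<omega> \<in> H1_forms k n"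
  obtains p where "p \<in> harmonic_polynomials (Suc k)" "sphere_pullback \<omega> = sphere_density p"
    "\<omega> = field_form (\<lambda>x. (1 / Suc k) *\<^sub>R (\<Sum>b\<in>Basis. DV UNIV b p x *\<^sub>R b))"
proof -
  from w have pf: "\<omega> \<in> poly_forms k n" and cd: "codiff UNIV \<omega> = 0" and d: "form_d UNIV \<omega> = 0"
    and hl: "hodge_laplacian UNIV \<omega> = 0"
    by (auto simp: H1_forms_def H_forms_def)
  note alt = poly_formsD(1)[OF pf] and sm = poly_formsD(3)[OF pf]
  define W where "W x = dual_vector (\<omega> x)" for x
  have rep: "\<omega> = field_form W"
    unfolding field_form_def W_def by (intro ext) (rule vol_dual_vector[OF n alt])
  have W: "homogeneous_polynomial k (\<lambda>x. W x \<bullet> b) \<and> lap UNIV (\<lambda>x. W x \<bullet> b) x = 0" if b: "b \<in> Basis" for b x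
  proof -
    from b obtain c us where e: "\<And>\<alpha>. dual_vector \<alpha> \<bullet> b = c * \<alpha> us" by (rule dual_vector_Basis) blast
    have "lap UNIV (\<lambda>y. \<omega> y us) x = 0"
      using whole_space.hodge_laplacian_eq[OF sm, of x us] hl by simp
    then show ?thesis
      using poly_formsD(2)[OF pf] whole_space.lap_cmult[OF smooth_formD[OF sm] UNIV_I]
      by (simp add: W_def e homogeneous_polynomial_cmult)
  qed
  then have Ws: "smooth_in UNIV (\<lambda>x. W x \<bullet> b)" and Wr: "radial UNIV (\<lambda>x. W x \<bullet> b) x = k * (W x \<bullet> b)"
    if "b \<in> Basis" for b x using that by (auto simp: homogeneous_polynomial_iff)
  have curl: "DV UNIV b (\<lambda>y. W y \<bullet> c) x = DV UNIV c (\<lambda>y. W y \<bullet> b) x" if "b \<in> Basis" "c \<in> Basis" for b c x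
    using codiff_field_form_eq_zero_iff[OF Ws] cd that unfolding rep by blast
  have div: "whole_space.divergence W x = 0" for x
    using whole_space.form_d_field_form[OF Ws UNIV_I, of x basis_enum] d by (simp add: rep vol_basis_enum)
  define p where "p x = (\<Sum>b\<in>Basis. (x \<bullet> b) * (W x \<bullet> b))" for x
  have px: "p x = W x \<bullet> x" for x by (simp add: p_def euclidean_inner[of "W x" x] mult.commute)
  have hp: "homogeneous_polynomial (Suc k) p"
    unfolding p_def[abs_def] using W by (intro homogeneous_polynomial_sum homogeneous_polynomial_inner_mult) auto
  \<comment> \<open>Curl-freeness exchanges the indices in the sum, which becomes the radial
    derivative of \<open>W \<bullet> c\<close>; Euler's equation then gives the factor
    \<open>k + 1\<close>.\<close>
  have grad: "DV UNIV c p x = Suc k * (W x \<bullet> c)" if c: "c \<in> Basis" for c x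
  proof -
    have "DV UNIV c p x = (\<Sum>b\<in>Basis. (x \<bullet> b) * DV UNIV c (\<lambda>y. W y \<bullet> b) x) + (\<Sum>b\<in>Basis. (c \<bullet> b) * (W x \<bullet> b))"
      unfolding p_def[abs_def] using Ws
      by (simp add: whole_space.DV_sum whole_space.DV_mult whole_space.DV_inner sum.distrib)
    also have "(\<Sum>b\<in>Basis. (c \<bullet> b) * (W x \<bullet> b)) = W x \<bullet> c"
      by (simp add: euclidean_inner[of "W x" c] mult.commute)
    also have "(\<Sum>b\<in>Basis. (x \<bullet> b) * DV UNIV c (\<lambda>y. W y \<bullet> b) x) = radial UNIV (\<lambda>y. W y \<bullet> c) x"
      unfolding whole_space.radial_Basis[OF Ws[OF c] UNIV_I]
      by (intro sum.cong refl arg_cong2[where f = "(*)"] curl c)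
    finally show ?thesis by (simp add: Wr[OF c] algebra_simps)
  qed
  have "lap UNIV p x = 0" for x
  proof -
    have "DV UNIV b (DV UNIV b p) x = Suc k * DV UNIV b (\<lambda>y. W y \<bullet> b) x" if b: "b \<in> Basis" for b
      using DV_cong[of UNIV "DV UNIV b p" "\<lambda>x. Suc k * (W x \<bullet> b)" x b] grad[OF b]
        whole_space.DV_cmult[OF Ws[OF b] UNIV_I, where v = b and x = x and c = "Suc k"] by simp
    then show ?thesis
      using div[of x] by (simp add: lap_def whole_space.divergence_def sum_distrib_left[symmetric])
  qed
  then have "p \<in> harmonic_polynomials (Suc k)" using hp by (simp add: harmonic_polynomials_def)
  moreover have "sphere_pullback \<omega> = sphere_density p"
  proof (intro ext)
    fix x vs
    show "sphere_pullback \<omega> x vs = sphere_density p x vs"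
      using vol_Cons_tangential[of x vs "W x"]
      by (auto simp: sphere_pullback_def sphere_density_def rep field_form_def px)
  qed
  moreover have "(1 / Suc k) *\<^sub>R (\<Sum>b\<in>Basis. DV UNIV b p x *\<^sub>R b) = W x" for x
  proof (rule euclidean_eqI)
    fix b :: 'a assume b: "b \<in> Basis"
    then have "(\<Sum>b\<in>Basis. DV UNIV b p x *\<^sub>R b) \<bullet> b = Suc k * (W x \<bullet> b)"
      using grad[OF b] by simp
    then show "((1 / Suc k) *\<^sub>R (\<Sum>b\<in>Basis. DV UNIV b p x *\<^sub>R b)) \<bullet> b = W x \<bullet> b"
      by (simp del: of_nat_Suc)
  qed
  ultimately show thesis using that rep by simp
qed

text \<open>The gradient form is closed because \<open>p\<close> is harmonic and coclosed because
  its Hessian is symmetric. Division by \<open>Suc k\<close> makes \<open>W \<bullet> x = p\<close>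
  by Euler's equation.\<close>

lemma gradient_in_H1_forms:
  fixes p :: "'a::euclidean_space \<Rightarrow> real"
  assumes n: "DIM('a) = Suc n" and p: "p \<in> harmonic_polynomials (Suc k)"
  shows "\<exists>\<omega>\<in>H1_forms k n. sphere_pullback \<omega> = sphere_density p"
proof
  note ps = harmonic_polynomialsD(2)[OF p]
  define W where "W x = (\<Sum>b\<in>Basis. (DV UNIV b p x / Suc k) *\<^sub>R b)" for x
  have Wb: "W x \<bullet> b = DV UNIV b p x / Suc k" if "b \<in> Basis" for x b
    using that by (simp add: W_def)
  have Ws: "smooth_in UNIV (\<lambda>x. W x \<bullet> b)" if b: "b \<in> Basis" for b
    unfolding Wb[OF b] by (intro whole_space.smooth_in_divide smooth_in_DV ps)
  have DVW: "DV UNIV v (\<lambda>x. W x \<bullet> b) x = DV UNIV v (DV UNIV b p) x / Suc k" if b: "b \<in> Basis" for v b x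
    unfolding Wb[OF b] by (rule whole_space.DV_divide[OF smooth_in_DV[OF ps] UNIV_I])
  have alt: "alternating n (field_form W x)" for x
    unfolding field_form_def using alternating_vol[where 'a='a] n by (intro alternating_Cons) simp
  have "homogeneous_polynomial k (\<lambda>x. field_form W x vs)" for vs
  proof -
    have "homogeneous_polynomial k (\<lambda>x. \<Sum>b\<in>Basis. (vol (b # vs) / Suc k) * DV UNIV b p x)"
      using homogeneous_polynomial_DV[OF harmonic_polynomialsD(1)[OF p]]
      by (intro homogeneous_polynomial_sum homogeneous_polynomial_cmult) simp
    then show ?thesis by (simp add: field_form_Basis Wb mult.commute del: of_nat_Suc)
  qed
  then have "field_form W \<in> poly_forms k n" using alt by (simp add: poly_forms_iff)
  moreover have c: "codiff UNIV (field_form W) = 0"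
    using whole_space.DV_commute[OF ps UNIV_I]
    by (simp add: codiff_field_form_eq_zero_iff[where W = W, OF Ws] DVW)
  moreover have d: "form_d UNIV (field_form W) = 0"
  proof -
    have "whole_space.divergence W x = 0" for x
      using harmonic_polynomialsD(4)[OF p, of x]
      by (simp add: whole_space.divergence_def DVW lap_def sum_divide_distrib[symmetric] del: of_nat_Suc)
    then show ?thesis
      by (intro ext) (simp add: whole_space.form_d_field_form[OF Ws UNIV_I])
  qed
  ultimately show "field_form W \<in> H1_forms k n"
    by (simp add: H1_forms_def H_forms_def hodge_laplacian_def)
  have Wx: "W x \<bullet> x = p x" for x
  proof -
    have "W x \<bullet> x = radial UNIV p x / Suc k"
      unfolding whole_space.radial_Basis[OF ps UNIV_I]
      by (simp add: euclidean_inner[of "W x" x] Wb sum_divide_distrib mult.commute del: of_nat_Suc)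
    then show ?thesis by (simp add: harmonic_polynomialsD(3)[OF p] del: of_nat_Suc)
  qed
  show "sphere_pullback (field_form W) = sphere_density p"
  proof (intro ext)
    fix x vs
    show "sphere_pullback (field_form W) x vs = sphere_density p x vs"
      using vol_Cons_tangential[of x vs "W x"]
      by (auto simp: sphere_pullback_def sphere_density_def field_form_def Wx)
  qed
qed

section \<open>Restriction to the sphere and dimensions\<close>

lemma sphere_pullback_H1_forms:
  assumes "DIM('a::euclidean_space) = Suc n"
  shows "sphere_pullback ` (H1_forms k n :: 'a form set) = sphere_density ` harmonic_polynomials (Suc k)"
proof (intro set_eqI iffI)
  fix \<omega> :: "'a form"
  assume "\<omega> \<in> sphere_pullback ` H1_forms k n"
  then obtain \<eta> where \<eta>: "\<eta> \<in> H1_forms k n" "\<omega> = sphere_pullback \<eta>" by blast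
  from H1_forms_gradient[OF assms \<eta>(1)]
  obtain p where "p \<in> harmonic_polynomials (Suc k)" "sphere_pullback \<eta> = sphere_density p" .
  with \<eta>(2) show "\<omega> \<in> sphere_density ` harmonic_polynomials (Suc k)" by simp
next
  fix \<omega> :: "'a form"
  assume "\<omega> \<in> sphere_density ` harmonic_polynomials (Suc k)"
  then obtain p where p: "p \<in> harmonic_polynomials (Suc k)" "\<omega> = sphere_density p" by blast
  from gradient_in_H1_forms[OF assms p(1)] p(2) show "\<omega> \<in> sphere_pullback ` H1_forms k n"
    by (auto intro: rev_image_eqI)
qed

text \<open>The restriction determines \<open>p\<close> on the sphere, homogeneity determines it
  everywhere, and the form is built from the gradient of \<open>p\<close>.\<close>

lemma inj_on_sphere_pullback_H1_forms:
  assumes n: "DIM('a::euclidean_space) = Suc n"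
  shows "inj_on sphere_pullback (H1_forms k n :: 'a form set)"
proof (rule inj_onI)
  fix \<omega> \<eta> :: "'a form"
  assume "\<omega> \<in> H1_forms k n" "\<eta> \<in> H1_forms k n" and eq: "sphere_pullback \<omega> = sphere_pullback \<eta>"
  from H1_forms_gradient[OF n this(1)] obtain p where p: "p \<in> harmonic_polynomials (Suc k)"
    "sphere_pullback \<omega> = sphere_density p"
    "\<omega> = field_form (\<lambda>x. (1 / Suc k) *\<^sub>R (\<Sum>b\<in>Basis. DV UNIV b p x *\<^sub>R b))" .
  from H1_forms_gradient[OF n \<open>\<eta> \<in> H1_forms k n\<close>] obtain q where q: "q \<in> harmonic_polynomials (Suc k)"
    "sphere_pullback \<eta> = sphere_density q"
    "\<eta> = field_form (\<lambda>x. (1 / Suc k) *\<^sub>R (\<Sum>b\<in>Basis. DV UNIV b q x *\<^sub>R b))" .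
  have "p x = q x" for x
  proof (rule homogeneous_polynomial_eq_sphere[OF harmonic_polynomialsD(1)[OF p(1)] harmonic_polynomialsD(1)[OF q(1)]])
    show "p y = q y" if "y \<in> sphere 0 1" for y
      using sphere_density_eqD[OF _ that] eq p(2) q(2) by metis
  qed simp
  then have "p = q" by (rule ext)
  then show "\<omega> = \<eta>" using p(3) q(3) by simp
qed

lemma sphere_pullback_add: "sphere_pullback (\<omega> + \<eta>) = sphere_pullback \<omega> + sphere_pullback \<eta>"
  by (auto simp: sphere_pullback_def fun_eq_iff)

lemma sphere_pullback_scale: "sphere_pullback (form_scale c \<omega>) = form_scale c (sphere_pullback \<omega>)"
  by (auto simp: sphere_pullback_def form_scale_def fun_eq_iff)

lemma subspace_image_sphere_pullback:
  fixes V :: "'a::euclidean_space form set"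
  assumes V: "forms.subspace V" shows "forms.subspace (sphere_pullback ` V)"
proof (rule forms.subspaceI)
  have "sphere_pullback (0 :: 'a form) = 0" by (auto simp: sphere_pullback_def fun_eq_iff)
  then show "0 \<in> sphere_pullback ` V" using forms.subspace_0[OF V] by (metis imageI)
  fix \<omega> \<eta> and c :: real
  assume w: "\<omega> \<in> sphere_pullback ` V"
  then show "form_scale c \<omega> \<in> sphere_pullback ` V"
    using forms.subspace_scale[OF V] by (auto simp: sphere_pullback_scale[symmetric])
  assume "\<eta> \<in> sphere_pullback ` V"
  with w show "\<omega> + \<eta> \<in> sphere_pullback ` V"
    using forms.subspace_add[OF V] by (auto simp: sphere_pullback_add[symmetric])
qed

lemma dim_sphere_pullback_H1_forms:
  assumes "DIM('a::euclidean_space) = Suc (Suc p)"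
  shows "forms.dim (sphere_pullback ` H1_forms k (Suc p) :: 'a form set) = M_dim TYPE('a) (Suc k) p"
  unfolding M_dim_eq
  by (rule dim_image_inj[OF sphere_pullback_add sphere_pullback_scale subspace_H1_forms
        inj_on_sphere_pullback_H1_forms[OF assms]])

text \<open>Real and imaginary part of \<open>(x \<bullet> a + \<i> x \<bullet> b)\<^sup>k\<close>, with the Cauchy-Riemann equations as induction invariant.\<close>

lemma planar_harmonic_polynomials:
  fixes a b :: "'a::euclidean_space"
  assumes ab: "a \<in> Basis" "b \<in> Basis" "a \<noteq> b"
  shows "\<exists>p q. p \<in> harmonic_polynomials k \<and> q \<in> harmonic_polynomials k \<and> p a = 1 \<and> q a = 0 \<and>
    (\<forall>x. DV UNIV a p x = DV UNIV b q x \<and> DV UNIV b p x = - DV UNIV a q x)"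
proof (induction k)
  case 0
  show ?case
    by (rule exI[of _ "\<lambda>_. 1"], rule exI[of _ "\<lambda>_. 0"])
      (simp add: harmonic_polynomials_def homogeneous_polynomial_const)
next
  case (Suc k)
  then obtain p q where p: "p \<in> harmonic_polynomials k" and q: "q \<in> harmonic_polynomials k"
    and v: "p a = 1" "q a = 0"
    and CR: "\<And>x. DV UNIV a p x = DV UNIV b q x" "\<And>x. DV UNIV b p x = - DV UNIV a q x" by blast
  note ps = harmonic_polynomialsD(2)[OF p] and qs = harmonic_polynomialsD(2)[OF q]
  define p' q' where "p' x = (x \<bullet> a) * p x - (x \<bullet> b) * q x" and "q' x = (x \<bullet> b) * p x + (x \<bullet> a) * q x" for x
  have hom: "homogeneous_polynomial (Suc k) p'" "homogeneous_polynomial (Suc k) q'"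
    unfolding p'_def[abs_def] q'_def[abs_def] using ab harmonic_polynomialsD(1)[OF p] harmonic_polynomialsD(1)[OF q]
    by (intro homogeneous_polynomial_diff homogeneous_polynomial_add homogeneous_polynomial_inner_mult; simp)+
  have lm: "lap UNIV (\<lambda>x. (x \<bullet> c) * f x) x = 2 * DV UNIV c f x"
    if "f \<in> harmonic_polynomials k" "c \<in> Basis" for f c and x :: 'a
  proof -
    note fs = harmonic_polynomialsD(2)[OF that(1)]
    have "lap UNIV (\<lambda>x. (x \<bullet> c) * f x) x = 2 * (\<Sum>e\<in>Basis. (c \<bullet> e) * DV UNIV e f x)"
      using fs harmonic_polynomialsD(4)[OF that(1)]
      by (simp add: whole_space.lap_mult whole_space.lap_inner whole_space.DV_inner inner_commute)
    then show ?thesis using DV_Basis[OF fs UNIV_I, of c x] by simp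
  qed
  \<comment> \<open>Each Laplacian is twice a combination of first derivatives that the
    Cauchy-Riemann equations cancel.\<close>
  have "lap UNIV p' x = 0" "lap UNIV q' x = 0" for x
    using lm[OF p ab(1)] lm[OF p ab(2)] lm[OF q ab(1)] lm[OF q ab(2)] ps qs CR[of x]
    by (simp_all add: p'_def[abs_def] q'_def[abs_def] whole_space.lap_diff whole_space.lap_add)
  then have "p' \<in> harmonic_polynomials (Suc k)" "q' \<in> harmonic_polynomials (Suc k)"
    using hom by (auto simp: harmonic_polynomials_def)
  \<comment> \<open>The value 1 at the unit vector \<open>a\<close> later shows that the restriction
    to the sphere is not zero.\<close>
  moreover have "p' a = 1" "q' a = 0"
    using v ab by (auto simp: p'_def q'_def inner_Basis)
  moreover have "DV UNIV a p' x = DV UNIV b q' x" "DV UNIV b p' x = - DV UNIV a q' x" for x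
    using CR[of x] ps qs ab
    by (simp_all add: p'_def[abs_def] q'_def[abs_def] whole_space.DV_diff whole_space.DV_add
        whole_space.DV_mult whole_space.DV_inner inner_Basis)
  ultimately show ?case by blast
qed

text \<open>Shows that every \<open>nu1 k n\<close> is really attained; the planar construction
  takes two different coordinates.\<close>

lemma nonzero_harmonic_polynomial:
  assumes "DIM('a::euclidean_space) \<ge> 2"
  shows "\<exists>p\<in>harmonic_polynomials k. sphere_density p \<noteq> (0 :: 'a form)"
proof -
  obtain a :: 'a where a: "a \<in> Basis" using nonempty_Basis by blast
  have "(Basis :: 'a set) \<noteq> {a}"
  proof
    assume "(Basis :: 'a set) = {a}"
    then have "DIM('a) = card {a}" by (rule arg_cong)
    then show False using assms by simp
  qed
  then obtain b where b: "b \<in> Basis" "b \<noteq> a" using a by auto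
  from planar_harmonic_polynomials[OF a b(1) b(2)[symmetric]] obtain p
    where p: "p \<in> harmonic_polynomials k" "p a = 1" by metis
  have "sphere_density p \<noteq> sphere_density (\<lambda>_. 0)"
    using sphere_density_eqD[of p "\<lambda>_. 0" a] p(2) a by auto
  then show ?thesis using p(1) by (auto simp: sphere_density_zero)
qed

section \<open>The spectrum and its eigenspaces\<close>

lemma span_sphere_volume: "forms.span {sphere_volume} = range (\<lambda>a. sphere_density (\<lambda>_. a))"
  by (simp add: forms.span_singleton sphere_volume_eq sphere_density_scale)

lemma sphere_volume_nonzero: "sphere_volume \<noteq> (0 :: 'a::euclidean_space form)"
proof
  assume "sphere_volume = (0 :: 'a form)"
  then have "sphere_density (\<lambda>_. 1) = sphere_density (\<lambda>_::'a. 0)"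
    by (simp add: sphere_volume_eq sphere_density_zero)
  moreover obtain b :: 'a where "b \<in> Basis" using nonempty_Basis by blast
  ultimately show False using sphere_density_eqD[of "\<lambda>_. 1" "\<lambda>_. 0" b] by simp
qed

text \<open>The alternative \<open>p = (\<lambda>_. 0)\<close> serves the multiples of the volume
  form, for which \<open>k\<close> is a dummy degree unrelated to \<open>\<mu>\<close>.\<close>

lemma dn_eigenspaceI:
  fixes p :: "'a::euclidean_space \<Rightarrow> real"
  assumes n: "n \<ge> 1" "DIM('a) = Suc n" and k: "k \<ge> 1" and p: "p \<in> harmonic_polynomials k"
    and a: "a * (\<mu> - (real n + 1)) = 0" and pk: "p = (\<lambda>_. 0) \<or> nu1 k n = \<mu>"
  shows "sphere_density (\<lambda>x. a + p x) \<in> dn_eigenspace n \<mu>"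
proof -
  have "(real n + 1) * a + nu1 k n * p x = \<mu> * (a + p x)" for x
    using a pk by (auto simp: algebra_simps)
  then show ?thesis
    using dn_operator_harmonic_polynomial[OF n k p, of a]
    by (simp add: dn_eigenspace_def sphere_density_scale)
qed

text \<open>A harmonic polynomial that is constant on the sphere takes that constant at the origin,
  where it is 0 because its degree is positive.\<close>

lemma span_sphere_volume_inter:
  assumes k: "k \<ge> 1"
  shows "forms.span {sphere_volume} \<inter> sphere_density ` harmonic_polynomials k = {0 :: 'a::euclidean_space form}"
proof (intro set_eqI iffI)
  fix \<omega> :: "'a form"
  assume "\<omega> \<in> forms.span {sphere_volume} \<inter> sphere_density ` harmonic_polynomials k"
  then obtain a p where w: "\<omega> = sphere_density (\<lambda>_. a)" "\<omega> = sphere_density p"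
    and p: "p \<in> harmonic_polynomials k"
    unfolding span_sphere_volume by blast
  note ps = harmonic_polynomialsD(2)[OF p]
  have "p 0 = a"
  proof (rule harmonic_unique[of p "\<lambda>_. a"])
    show "smooth_in disc p" by (rule unit_ball.smooth_in_UNIV_imp[OF ps])
    show "lap disc p x = 0" if "x \<in> disc" for x
      using unit_ball.lap_UNIV_eq[OF ps that] harmonic_polynomialsD(4)[OF p] by simp
    show "p x = a" if "x \<in> sphere 0 1" for x
      using sphere_density_eqD[OF _ that, of p "\<lambda>_. a"] w by simp
  qed simp_all
  moreover have "p 0 = 0"
    using homogeneous_polynomial_scaleR[OF harmonic_polynomialsD(1)[OF p], of 0 0] k by (simp add: power_0_left)
  ultimately show "\<omega> \<in> {0}" using w by (simp add: sphere_density_zero)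
next
  fix \<omega> :: "'a form" assume "\<omega> \<in> {0}"
  then have "\<omega> = sphere_density (\<lambda>_. 0)" by (simp add: sphere_density_zero)
  then show "\<omega> \<in> forms.span {sphere_volume} \<inter> sphere_density ` harmonic_polynomials k"
    using zero_harmonic_polynomial by (auto simp: span_sphere_volume)
qed

lemma dn_eigenspace_eq_harmonic:
  assumes n: "n \<ge> 1" "DIM('a::euclidean_space) = Suc n" and k: "k \<ge> 1" and ne: "nu1 k n \<noteq> real n + 1"
  shows "dn_eigenspace n (nu1 k n) = (sphere_density ` harmonic_polynomials k :: 'a form set)"
proof (intro set_eqI iffI)
  fix \<omega> :: "'a form"
  assume "\<omega> \<in> dn_eigenspace n (nu1 k n)"
  from n this show "\<omega> \<in> sphere_density ` harmonic_polynomials k"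
  proof (cases rule: dn_eigenspace_cases)
    case (1 a)
    then show ?thesis using ne zero_harmonic_polynomial by (auto intro: rev_image_eqI)
  next
    case (2 a j p)
    then have "j = k" using nu1_inj[OF n(1) _ k] by blast
    then show ?thesis using 2 ne by simp
  qed
next
  fix \<omega> :: "'a form"
  assume "\<omega> \<in> sphere_density ` harmonic_polynomials k"
  then show "\<omega> \<in> dn_eigenspace n (nu1 k n)"
    using dn_eigenspaceI[OF n k, of _ 0 "nu1 k n"] by auto
qed

lemma dn_eigenspace_eq_volume:
  assumes n: "n \<ge> 1" "DIM('a::euclidean_space) = Suc n" and ne: "\<And>k. k \<ge> 1 \<Longrightarrow> nu1 k n \<noteq> real n + 1"
  shows "dn_eigenspace n (real n + 1) = (forms.span {sphere_volume} :: 'a form set)"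
proof (intro set_eqI iffI)
  fix \<omega> :: "'a form"
  assume "\<omega> \<in> dn_eigenspace n (real n + 1)"
  from n this show "\<omega> \<in> forms.span {sphere_volume}"
  proof (cases rule: dn_eigenspace_cases)
    case (1 a)
    then show ?thesis by (simp add: span_sphere_volume)
  next
    case (2 a j p)
    then show ?thesis using ne by blast
  qed
next
  fix \<omega> :: "'a form"
  assume "\<omega> \<in> forms.span {sphere_volume}"
  then show "\<omega> \<in> dn_eigenspace n (real n + 1)"
    using dn_eigenspaceI[OF n order_refl zero_harmonic_polynomial, of _ "real n + 1"]
    by (auto simp: span_sphere_volume)
qed

lemma dn_eigenspace_eq_sum:
  assumes n: "n \<ge> 1" "DIM('a::euclidean_space) = Suc n" and k: "k \<ge> 1" and eq: "nu1 k n = real n + 1"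
  shows "dn_eigenspace n (real n + 1) = ({\<alpha> + \<beta> | \<alpha> \<beta>.
    \<alpha> \<in> forms.span {sphere_volume} \<and> \<beta> \<in> sphere_density ` harmonic_polynomials k} :: 'a form set)" (is "_ = ?X")
proof (intro set_eqI iffI)
  have X: "sphere_density (\<lambda>x. a + p x) \<in> ?X" if "p \<in> harmonic_polynomials k" for a p
    using that unfolding span_sphere_volume
    by (auto simp: sphere_density_add[symmetric, of "\<lambda>_. a" p])
  fix \<omega> :: "'a form"
  assume "\<omega> \<in> dn_eigenspace n (real n + 1)"
  from n this show "\<omega> \<in> ?X"
  proof (cases rule: dn_eigenspace_cases)
    case (1 a)
    then show ?thesis using X[OF zero_harmonic_polynomial, of a] by simp
  next
    case (2 a j p)
    then have "j = k" using nu1_inj[OF n(1) _ k] eq by metis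
    then show ?thesis using 2 X[of p a] by simp
  qed
next
  fix \<omega> :: "'a form"
  assume "\<omega> \<in> ?X"
  then obtain a p where "p \<in> harmonic_polynomials k" "\<omega> = sphere_density (\<lambda>_. a) + sphere_density p"
    by (auto simp: span_sphere_volume)
  then show "\<omega> \<in> dn_eigenspace n (real n + 1)"
    using dn_eigenspaceI[OF n k, of p a "real n + 1"] eq by (simp add: sphere_density_add)
qed

lemma dn_spectrum_eq:
  assumes n: "n \<ge> 1" "DIM('a::euclidean_space) = Suc n"
  shows "dn_spectrum TYPE('a) n = insert (real n + 1) {nu1 k n | k. k \<ge> 1}"
proof (intro set_eqI iffI)
  fix \<mu> assume "\<mu> \<in> dn_spectrum TYPE('a) n"
  then obtain \<omega> :: "'a form" where w: "\<omega> \<in> dn_eigenspace n \<mu>" "\<omega> \<noteq> 0"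
    by (auto simp: dn_spectrum_def)
  from n w(1) show "\<mu> \<in> insert (real n + 1) {nu1 k n | k. k \<ge> 1}"
  proof (cases rule: dn_eigenspace_cases)
    case (1 a)
    then have "a \<noteq> 0" using w(2) sphere_density_zero by auto
    then show ?thesis using 1 by simp
  next
    case (2 a j p)
    then show ?thesis by blast
  qed
next
  fix \<mu> assume "\<mu> \<in> insert (real n + 1) {nu1 k n | k. k \<ge> 1}"
  then consider "\<mu> = real n + 1" | k where "k \<ge> 1" "\<mu> = nu1 k n" by blast
  then show "\<mu> \<in> dn_spectrum TYPE('a) n"
  proof cases
    case 1
    have "(sphere_volume :: 'a form) \<in> dn_eigenspace n \<mu>"
      using dn_eigenspaceI[OF n order_refl zero_harmonic_polynomial, of 1 \<mu>] 1 by (simp add: sphere_volume_eq)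
    then show ?thesis using sphere_volume_nonzero by (auto simp: dn_spectrum_def)
  next
    case 2
    obtain p :: "'a \<Rightarrow> real" where p: "p \<in> harmonic_polynomials k" "sphere_density p \<noteq> 0"
      using nonzero_harmonic_polynomial[where 'a='a, of k] n by auto
    then have "sphere_density p \<in> dn_eigenspace n \<mu>"
      using dn_eigenspaceI[OF n 2(1) p(1), of 0 \<mu>] 2(2) by simp
    then show ?thesis using p(2) by (auto simp: dn_spectrum_def)
  qed
qed

text \<open>The finite spanning set makes the basis \<open>B\<close> finite; for an infinite basis
  the cardinality convention would break the count \<open>1 + dim\<close>.\<close>

lemma dim_line_plus:
  assumes V: "forms.subspace V" and T: "finite T" "V \<subseteq> forms.span T" and v: "v \<notin> V"
  shows "forms.dim {\<alpha> + \<beta> | \<alpha> \<beta>. \<alpha> \<in> forms.span {v} \<and> \<beta> \<in> V} = 1 + forms.dim V"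
proof -
  obtain B where B: "B \<subseteq> V" "forms.independent B" "V \<subseteq> forms.span B" "card B = forms.dim V"
    by (rule forms.basis_exists)
  have sp: "forms.span B = V" using B(1,3) V by (metis forms.span_minimal subset_antisym)
  have fin: "finite B" using forms.independent_span_bound[OF T(1) B(2)] B(1) T(2) by blast
  have ind: "forms.independent (insert v B)" using B(2) v sp by (simp add: forms.independent_insertI)
  have "forms.span (insert v B) = {\<alpha> + \<beta> | \<alpha> \<beta>. \<alpha> \<in> forms.span {v} \<and> \<beta> \<in> V}"
    using forms.span_Un[of "{v}" B] by (simp add: sp)
  then have "forms.dim {\<alpha> + \<beta> | \<alpha> \<beta>. \<alpha> \<in> forms.span {v} \<and> \<beta> \<in> V} = card (insert v B)"
    using forms.dim_eq_card[OF _ ind] by (metis forms.span_span)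
  also have "\<dots> = 1 + forms.dim V" using fin B(1,4) v by (subst card_insert_disjoint) auto
  finally show ?thesis .
qed

text \<open>Supplies the finite spanning set for \<open>dim_line_plus\<close> in degree 1, where the
  eigenvalues can coincide. A polynomial of degree 1 has constant partial derivatives and is a
  combination of coordinates.\<close>

lemma linear_harmonic_polynomials_span:
  "sphere_density ` harmonic_polynomials 1
    \<subseteq> forms.span ((\<lambda>b. sphere_density (\<lambda>x. x \<bullet> b)) ` (Basis :: 'a::euclidean_space set))"
proof
  fix \<omega> :: "'a form" assume "\<omega> \<in> sphere_density ` harmonic_polynomials 1"
  then obtain p where p: "p \<in> harmonic_polynomials 1" "\<omega> = sphere_density p" by blast
  have DVc: "DV UNIV b p x = DV UNIV b p 0" for b x
    using homogeneous_polynomial_scaleR[OF homogeneous_polynomial_DV[OF harmonic_polynomialsD(1)[OF p(1)]], of b 0 x] by simp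
  have px: "p x = (\<Sum>b\<in>Basis. DV UNIV b p 0 * (x \<bullet> b))" for x
  proof -
    have "p x = (\<Sum>b\<in>Basis. (x \<bullet> b) * DV UNIV b p x)"
      using harmonic_polynomialsD(3)[OF p(1), of x]
        whole_space.radial_Basis[OF harmonic_polynomialsD(2)[OF p(1)], of x] by simp
    also have "\<dots> = (\<Sum>b\<in>Basis. DV UNIV b p 0 * (x \<bullet> b))"
      by (intro sum.cong refl) (subst DVc, rule mult.commute)
    finally show ?thesis .
  qed
  have "\<omega> = (\<Sum>b\<in>Basis. form_scale (DV UNIV b p 0) (sphere_density (\<lambda>x. x \<bullet> b)))"
  proof -
    have "(\<Sum>b\<in>I. form_scale (DV UNIV b p 0) (sphere_density (\<lambda>x. x \<bullet> b)))
        = sphere_density (\<lambda>x. \<Sum>b\<in>I. DV UNIV b p 0 * (x \<bullet> b))" if "finite I" for I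
      using that by (induction I rule: finite_induct)
        (simp_all add: sphere_density_zero sphere_density_scale sphere_density_add)
    from this[OF finite_Basis] show ?thesis
      unfolding p(2) by (simp only: sphere_density_cong[OF px])
  qed
  also have "\<dots> \<in> forms.span ((\<lambda>b. sphere_density (\<lambda>x. x \<bullet> b)) ` Basis)"
    by (intro forms.span_sum forms.span_scale forms.span_base imageI)
  finally show "\<omega> \<in> forms.span ((\<lambda>b. sphere_density (\<lambda>x. x \<bullet> b)) ` Basis)" .
qed

text \<open>With \<open>\<mu> = n + 1\<close> the right side of the quadratic equation vanishes and
  leaves \<open>k (2 k + n - 3) = 0\<close>, which for positive \<open>n\<close> and
  \<open>k\<close> has only the solution \<open>n = k = 1\<close>.\<close>

lemma nu1_eq_volume_eigenvalue:
  assumes "n \<ge> 1" "k \<ge> 1" "nu1 k n = real n + 1"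
  shows "k = 1"
proof -
  have "real k * (2 * real k + real n - 3) = 0"
    using nu1_eq_iff[OF assms(1,2), of "real n + 1"] assms(3) by (simp add: algebra_simps power2_eq_square)
  then show ?thesis using assms(1,2) by auto
qed

theorem theorem3:
  fixes n :: nat
  assumes "n \<ge> 1" and "DIM('a::euclidean_space) = n + 1"
  shows
    "dn_spectrum TYPE('a) n = insert (real n + 1) {nu1 k n | k. k \<ge> 1}
     \<and> (\<forall>k\<ge>1. nu1 k n \<noteq> real n + 1 \<longrightarrow>
          (dn_eigenspace n (nu1 k n) :: 'a form set) = sphere_pullback ` H1_forms (k - 1) n
          \<and> forms.dim (dn_eigenspace n (nu1 k n) :: 'a form set) = M_dim TYPE('a) k (n - 1))
     \<and> ((\<forall>k\<ge>1. nu1 k n \<noteq> real n + 1) \<longrightarrow>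
          (dn_eigenspace n (real n + 1) :: 'a form set) = forms.span {sphere_volume}
          \<and> forms.dim (dn_eigenspace n (real n + 1) :: 'a form set) = 1)
     \<and> (\<forall>k\<ge>1. nu1 k n = real n + 1 \<longrightarrow>
          (dn_eigenspace n (real n + 1) :: 'a form set) =
            {\<alpha> + \<beta> | \<alpha> \<beta>. \<alpha> \<in> forms.span {sphere_volume} \<and> \<beta> \<in> sphere_pullback ` H1_forms (k - 1) n}
          \<and> forms.span {sphere_volume :: 'a form} \<inter> sphere_pullback ` H1_forms (k - 1) n = {0}
          \<and> forms.dim (dn_eigenspace n (real n + 1) :: 'a form set) = 1 + M_dim TYPE('a) k (n - 1))"
proof (intro conjI allI impI)
  \<comment> \<open>The bijection between closed forms and radially annihilated forms is stated for
    degrees \<open>Suc p\<close> and \<open>p\<close>.\<close>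
  obtain p where p: "n = Suc p" using assms(1) by (metis Suc_le_D One_nat_def)
  have dim: "DIM('a) = Suc n" "DIM('a) = Suc (Suc p)" using assms(2) p by simp_all
  note n = assms(1) dim(1)
  have J: "sphere_pullback ` (H1_forms (k - 1) n :: 'a form set) = sphere_density ` harmonic_polynomials k"
    and dJ: "forms.dim (sphere_pullback ` H1_forms (k - 1) n :: 'a form set) = M_dim TYPE('a) k (n - 1)"
    if "k \<ge> 1" for k
    using that sphere_pullback_H1_forms[OF dim(1), of "k - 1"] dim_sphere_pullback_H1_forms[OF dim(2), of "k - 1"] p
    by simp_all
  show "dn_spectrum TYPE('a) n = insert (real n + 1) {nu1 k n | k. k \<ge> 1}"
    by (rule dn_spectrum_eq[OF n])
  fix k :: nat
  {
    assume k: "k \<ge> 1" and ne: "nu1 k n \<noteq> real n + 1"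
    show E: "(dn_eigenspace n (nu1 k n) :: 'a form set) = sphere_pullback ` H1_forms (k - 1) n"
      unfolding J[OF k] by (rule dn_eigenspace_eq_harmonic[OF n k ne])
    show "forms.dim (dn_eigenspace n (nu1 k n) :: 'a form set) = M_dim TYPE('a) k (n - 1)"
      unfolding E by (rule dJ[OF k])
  next
    assume k: "k \<ge> 1" and eq: "nu1 k n = real n + 1"
    show E: "(dn_eigenspace n (real n + 1) :: 'a form set) =
        {\<alpha> + \<beta> | \<alpha> \<beta>. \<alpha> \<in> forms.span {sphere_volume} \<and> \<beta> \<in> sphere_pullback ` H1_forms (k - 1) n}"
      unfolding J[OF k] by (rule dn_eigenspace_eq_sum[OF n k eq])
    show I: "forms.span {sphere_volume :: 'a form} \<inter> sphere_pullback ` H1_forms (k - 1) n = {0}"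
      unfolding J[OF k] by (rule span_sphere_volume_inter[OF k])
    \<comment> \<open>Reduces the finite-dimensionality of the second summand to linear
      polynomials.\<close>
    have "k = 1" by (rule nu1_eq_volume_eigenvalue[OF assms(1) k eq])
    have "sphere_volume \<notin> sphere_pullback ` (H1_forms (k - 1) n :: 'a form set)"
      using I forms.span_base[of sphere_volume "{sphere_volume}"] sphere_volume_nonzero by blast
    moreover have "forms.subspace (sphere_pullback ` (H1_forms (k - 1) n :: 'a form set))"
      by (rule subspace_image_sphere_pullback[OF subspace_H1_forms])
    ultimately show "forms.dim (dn_eigenspace n (real n + 1) :: 'a form set) = 1 + M_dim TYPE('a) k (n - 1)"
      unfolding E dJ[OF k, symmetric]
      using linear_harmonic_polynomials_span[where 'a='a] J[OF k] \<open>k = 1\<close>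
      by (intro dim_line_plus[of _ "(\<lambda>b. sphere_density (\<lambda>x. x \<bullet> b)) ` Basis"]) auto
  }
next
  assume "\<forall>k\<ge>1. nu1 k n \<noteq> real n + 1"
  then show E: "(dn_eigenspace n (real n + 1) :: 'a form set) = forms.span {sphere_volume}"
    using assms by (intro dn_eigenspace_eq_volume) auto
  show "forms.dim (dn_eigenspace n (real n + 1) :: 'a form set) = 1"
    unfolding E using forms.dim_eq_card_independent[of "{sphere_volume :: 'a form}"] sphere_volume_nonzero
    by simp
qed

end
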